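(* Suppose $G$ is a compact abelian group, $E$ is a subset of the dual group $\Gamma$, and $0<r<1$, $0<p\le\infty$. Then $E$ satisfies $\mathcal C_p(X)$ for every $r$-normable quasi-Banach space $X$ if and only if $E$ is a set of interpolation.
   Context: All spaces are over $\mathbb C$. A quasi-Banach space is $r$-normable if it has an equivalent quasinorm which is an $r$-norm, i.e. $\|x+y\|^r\le\|x\|^r+\|y\|^r$ for all $x,y$. Every quasi-Banach space is assumed to carry a quasinorm which is an $s$-norm for some $0<s<1$ (hence continuous); for an $r$-normable space one may take an $r$-norm (property $\mathcal C_p(X)$ below does not depend on the choice of equivalent quasinorm). For a compact abelian group $G$, $\mu_G$ is normalized Haar measure, and for a Borel map $\phi:G\to X$, $\|\phi\|_p=(\int_G\|\phi(g)\|^p\,d\mu_G(g))^{1/p}$ if $0<p<\infty$ and $\|\phi\|_\infty=\operatorname{ess\,sup}_{g\in G}\|\phi(g)\|$. Let $\Delta=\{\pm1\}^{\mathbb N}$ be the Cantor group (a compact abelian group) and let $\epsilon_k(t)$ denote the $k$-th coordinate of $t\in\Delta$. Property $\mathcal C_p(X)$: a set $E\subset\Gamma$ has (satisfies) property $\mathcal C_p(X)$ if there is a constant $M$ (which may depend on $E$, $X$, $p$) such that for every finite subset $\{\gamma_1,\dots,\gamma_n\}$ of $E$ (distinct elements) and all $x_1,\dots,x_n\in X$, $$M^{-1}\Big\|\sum_{k=1}^n x_k\epsilon_k\Big\|_p\le\Big\|\sum_{k=1}^n x_k\gamma_k\Big\|_p\le M\Big\|\sum_{k=1}^n x_k\epsilon_k\Big\|_p,$$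 where the outer norms are taken over $\Delta$ and the middle one over $G$. A set $E\subset\Gamma$ is a set of interpolation (set of type $(I_0)$) if every bounded complex function on $E$ can be extended to a continuous function on the Bohr compactification $b\Gamma$ of the (discrete) group $\Gamma$. *)

theory Defs
  imports
    "HOL-Analysis.Analysis"
    "HOL-Probability.Probability"
    "HOL-Algebra.Module"
begin

section \<open>Characters, dual groups and the Bohr compactification\<close>

definition circle_group :: "complex monoid" where
  "circle_group = \<lparr>carrier = {z. norm z = 1}, monoid.mult = (*), one = 1\<rparr>"

definition dual_group :: "('g::topological_ab_group_add \<Rightarrow> complex) monoid" where
  "dual_group = \<lparr>carrier = {\<xi>. continuous_on UNIV \<xi> \<and> (\<forall>x. norm (\<xi> x) = 1) \<and>
                               (\<forall>x y. \<xi> (x + y) = \<xi> x * \<xi> y)},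
                 monoid.mult = (\<lambda>\<xi> \<psi> x. \<xi> x * \<psi> x),
                 one = (\<lambda>_. 1)\<rparr>"

text \<open>The dual of an abstract abelian group with the discrete topology: all homomorphisms into the
  circle, continuous or not.  Functions are normalised outside the carrier by extensionality,
  so that they are points of a product space.\<close>

definition discrete_dual :: "('a, 'm) monoid_scheme \<Rightarrow> ('a \<Rightarrow> complex) monoid" where
  "discrete_dual H = \<lparr>carrier = hom H circle_group \<inter> extensional (carrier H),
                      monoid.mult = (\<lambda>\<xi> \<psi>. \<lambda>x\<in>carrier H. \<xi> x * \<psi> x),
                      one = (\<lambda>x\<in>carrier H. 1)\<rparr>"

text \<open>The dual group of the discrete group \<open>H\<close> is compact; forgetting its topology and dualising
  again gives the Bohr compactification of \<open>H\<close>, with the topology of pointwise convergence.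
  An element of \<open>H\<close> corresponds to evaluation at that element.\<close>

definition bohr_compactification ::
    "('a, 'm) monoid_scheme \<Rightarrow> (('a \<Rightarrow> complex) \<Rightarrow> complex) topology" where
  "bohr_compactification H =
     subtopology (product_topology (\<lambda>_. euclidean) (carrier (discrete_dual H)))
                 (carrier (discrete_dual (discrete_dual H)))"

definition bohr_embedding ::
    "('a, 'm) monoid_scheme \<Rightarrow> 'a \<Rightarrow> (('a \<Rightarrow> complex) \<Rightarrow> complex)" where
  "bohr_embedding H a = (\<lambda>\<xi>\<in>carrier (discrete_dual H). \<xi> a)"

definition interpolation_set :: "('a, 'm) monoid_scheme \<Rightarrow> 'a set \<Rightarrow> bool" where
  "interpolation_set H E \<longleftrightarrow>
     (\<forall>f :: 'a \<Rightarrow> complex. bounded (f ` E) \<longrightarrow>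
        (\<exists>F. continuous_map (bohr_compactification H) euclidean F \<and>
             (\<forall>a\<in>E. F (bohr_embedding H a) = f a)))"

lemma comm_group_dual_group: "comm_group dual_group"
proof (rule comm_groupI)
  fix \<xi> assume \<xi>: "\<xi> \<in> carrier (dual_group :: ('a \<Rightarrow> complex) monoid)"
  have "(\<lambda>x. cnj (\<xi> x)) \<in> carrier dual_group"
    using \<xi> by (auto simp: dual_group_def intro!: continuous_intros)
  moreover have "(\<lambda>x. cnj (\<xi> x)) \<otimes>\<^bsub>dual_group\<^esub> \<xi> = \<one>\<^bsub>dual_group\<^esub>"
    using \<xi> by (auto simp: dual_group_def fun_eq_iff mult.commute[of "cnj _"] complex_norm_square[symmetric])
  ultimately show "\<exists>\<psi>\<in>carrier dual_group. \<psi> \<otimes>\<^bsub>dual_group\<^esub> \<xi> = \<one>\<^bsub>dual_group\<^esub>"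
    by blast
qed (auto simp: dual_group_def norm_mult mult_ac intro!: continuous_intros)

lemma bohr_embedding_in_bohr_compactification:
  assumes "group H" "a \<in> carrier H"
  shows "bohr_embedding H a \<in> topspace (bohr_compactification H)"
proof -
  have "(\<lambda>x\<in>carrier H. \<xi> x * \<psi> x) \<in> carrier (discrete_dual H)"
    if "\<xi> \<in> carrier (discrete_dual H)" "\<psi> \<in> carrier (discrete_dual H)" for \<xi> \<psi>
    using that assms(1)
    by (auto simp: discrete_dual_def circle_group_def hom_def Pi_def norm_mult mult_ac
        group.is_monoid monoid.m_closed)
  then have "bohr_embedding H a \<in> carrier (discrete_dual (discrete_dual H))"
    using assms(2)
    by (auto simp: bohr_embedding_def discrete_dual_def circle_group_def hom_def Pi_def)
  moreover have "carrier (discrete_dual (discrete_dual H)) \<subseteq> extensional (carrier (discrete_dual H))"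
    by (auto simp: discrete_dual_def)
  ultimately show ?thesis
    by (auto simp: bohr_compactification_def PiE_def)
qed

section \<open>Haar measure\<close>

definition normalized_haar_measure :: "'g::topological_ab_group_add measure \<Rightarrow> bool" where
  "normalized_haar_measure \<mu> \<longleftrightarrow>
     sets \<mu> = sets borel \<and>
     emeasure \<mu> UNIV = 1 \<and>
     (\<forall>g. \<forall>A\<in>sets borel. emeasure \<mu> ((+) g ` A) = emeasure \<mu> A) \<and>
     (\<forall>A\<in>sets borel. emeasure \<mu> A = (INF U\<in>{U. open U \<and> A \<subseteq> U}. emeasure \<mu> U)) \<and>
     (\<forall>U. open U \<longrightarrow> emeasure \<mu> U = (SUP K\<in>{K. compact K \<and> K \<subseteq> U}. emeasure \<mu> K))"

text \<open>The normalised Haar measure of the Cantor group \<open>{1, -1}\<^sup>\<nat>\<close> is the product of the uniform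
  measures on the factors; the group is metrizable, so its Borel sets are the product sets and
  regularity is automatic.  Translation invariance is checked below.\<close>

definition cantor_haar :: "(nat \<Rightarrow> complex) measure" where
  "cantor_haar = (\<Pi>\<^sub>M k\<in>UNIV. uniform_count_measure {1, -1})"

lemma prob_space_uniform_signs: "prob_space (uniform_count_measure {1, -1 :: complex})"
  by (rule prob_space_uniform_count_measure) auto

lemma prob_space_cantor_haar: "prob_space cantor_haar"
  unfolding cantor_haar_def by (intro prob_space_PiM prob_space_uniform_signs)

lemma space_cantor_haar: "space cantor_haar = UNIV \<rightarrow> {1, -1}"
  by (simp add: cantor_haar_def space_PiM space_uniform_count_measure PiE_UNIV_domain)

lemma cantor_haar_translation_invariant:
  assumes s: "s \<in> UNIV \<rightarrow> {1, -1}"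
  shows "distr cantor_haar cantor_haar (\<lambda>t k. s k * t k) = cantor_haar"
proof -
  define U where "U = uniform_count_measure {1, -1 :: complex}"
  have pU: "prob_space U"
    by (simp add: U_def prob_space_uniform_signs)
  interpret product_prob_space "\<lambda>_. U" "UNIV :: nat set"
    using pU by (intro product_prob_spaceI)
  have sgn: "s k = 1 \<or> s k = -1" for k
    using s by auto
  have spU: "space U = {1, -1}" and stU: "sets U = Pow {1, -1}"
    by (auto simp: U_def space_uniform_count_measure sets_uniform_count_measure)
  have mU: "(\<lambda>z. s k * z) \<in> measurable U U" for k
    using sgn[of k] by (auto simp: measurable_def spU stU)
  have eU: "emeasure U ((\<lambda>z. s k * z) -` A \<inter> space U) = emeasure U A" if "A \<in> sets U" for k A
  proof -
    have A: "A \<subseteq> {1, -1}"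
      using that stU by auto
    have "(\<lambda>z. s k * z) -` A \<inter> space U = (\<lambda>z. s k * z) ` A"
    proof (intro equalityI subsetI)
      fix z assume "z \<in> (\<lambda>z. s k * z) -` A \<inter> space U"
      then show "z \<in> (\<lambda>z. s k * z) ` A"
        using sgn[of k] by (auto intro!: image_eqI[of z _ "s k * z"])
    next
      fix z assume "z \<in> (\<lambda>z. s k * z) ` A"
      then show "z \<in> (\<lambda>z. s k * z) -` A \<inter> space U"
        using sgn[of k] A by (auto simp: spU)
    qed
    moreover have "card ((\<lambda>z. s k * z) ` A) = card A"
      using sgn[of k] by (intro card_image) (auto simp: inj_on_def)
    moreover have "(\<lambda>z. s k * z) ` A \<subseteq> {1, -1}"
      using sgn[of k] A by auto
    ultimately show ?thesis
      using A by (simp add: U_def emeasure_uniform_count_measure)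
  qed
  let ?P = "PiM (UNIV :: nat set) (\<lambda>_. U)"
  have spP: "space ?P = UNIV \<rightarrow> space U"
    by (simp add: space_PiM PiE_UNIV_domain)
  have meas: "(\<lambda>t k. s k * t k) \<in> measurable ?P ?P"
  proof (rule measurable_PiM_single')
    show "(\<lambda>t. s k * t k) \<in> measurable ?P U" for k
      using measurable_compose[OF measurable_component_singleton[of k UNIV "\<lambda>_. U"] mU[of k]] by simp
    show "(\<lambda>t k. s k * t k) \<in> space ?P \<rightarrow> (\<Pi>\<^sub>E k\<in>UNIV. space U)"
      using measurable_space[OF mU] by (auto simp: spP PiE_UNIV_domain)
  qed
  have "distr ?P ?P (\<lambda>t k. s k * t k) = ?P"
  proof (rule PiM_eq)
    fix J and F :: "nat \<Rightarrow> complex set"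
    assume J: "finite J" "J \<subseteq> UNIV" and F: "\<And>j. j \<in> J \<Longrightarrow> F j \<in> sets U"
    let ?G = "\<lambda>j. (\<lambda>z. s j * z) -` F j \<inter> space U"
    have G: "?G j \<in> sets U" if "j \<in> J" for j
      using measurable_sets[OF mU F[OF that]] .
    have "(\<lambda>t k. s k * t k) -` prod_emb UNIV (\<lambda>_. U) J (\<Pi>\<^sub>E j\<in>J. F j) \<inter> space ?P
        = prod_emb UNIV (\<lambda>_. U) J (\<Pi>\<^sub>E j\<in>J. ?G j)"
      using measurable_space[OF meas]
      by (auto simp: prod_emb_def spP PiE_UNIV_domain PiE_iff Pi_iff)
    then have "emeasure (distr ?P ?P (\<lambda>t k. s k * t k)) (prod_emb UNIV (\<lambda>_. U) J (\<Pi>\<^sub>E j\<in>J. F j))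
        = emeasure ?P (prod_emb UNIV (\<lambda>_. U) J (\<Pi>\<^sub>E j\<in>J. ?G j))"
      using J F by (subst emeasure_distr[OF meas]) (auto intro!: sets_PiM_I)
    also have "\<dots> = (\<Prod>j\<in>J. emeasure U (?G j))"
      using J G by (intro emeasure_PiM_emb) auto
    also have "\<dots> = (\<Prod>j\<in>J. emeasure U (F j))"
      using F by (intro prod.cong refl eU)
    finally show "emeasure (distr ?P ?P (\<lambda>t k. s k * t k)) (prod_emb UNIV (\<lambda>_. U) J (\<Pi>\<^sub>E j\<in>J. F j))
        = (\<Prod>j\<in>J. emeasure U (F j))" .
  qed simp
  then show ?thesis
    by (simp add: cantor_haar_def U_def)
qed

section \<open>Quasi-Banach spaces\<close>

definition complex_ring :: "complex ring" where
  "complex_ring = \<lparr>carrier = UNIV, monoid.mult = (*), one = 1, ring.zero = 0, add = (+)\<rparr>"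

lemma field_complex_ring: "field complex_ring"
proof (rule cring.cring_fieldI)
  show R: "cring complex_ring"
  proof (rule cringI)
    show "abelian_group complex_ring"
      by (rule abelian_groupI) (auto simp: complex_ring_def intro: exI[of _ "- _"] add_ac left_minus)
    show "comm_monoid complex_ring"
      by (rule comm_monoidI) (auto simp: complex_ring_def mult_ac)
  qed (auto simp: complex_ring_def algebra_simps)
  have "\<exists>z. w * z = 1 \<and> z * w = 1" if "w \<noteq> 0" for w :: complex
    using that by (intro exI[of _ "inverse w"]) auto
  then show "Units complex_ring = carrier complex_ring - {\<zero>\<^bsub>complex_ring\<^esub>}"
    by (auto simp: Units_def complex_ring_def)
qed

text \<open>A complex vector space with a distinguished quasinorm.  As for every module record, the
  inherited fields \<open>mult\<close> and \<open>one\<close> play no role.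

  Spaces are structures on a carrier set, since one has to quantify over all of them inside a
  formula.  For a carrier in a given type \<open>'x\<close>, the quantifier only reaches the spaces that fit into
  \<open>'x\<close>; a result about ``all spaces'' is therefore stated for an arbitrary \<open>'x\<close> that is large enough
  to contain a copy of \<open>nat \<Rightarrow> complex\<close>.  No space is excluded: one over any type \<open>'y\<close> is
  isomorphic to one with carrier in \<open>'y + (nat \<Rightarrow> complex)\<close>.\<close>

record 'x quasi_normed = "(complex, 'x) module" +
  qnorm :: "'x \<Rightarrow> real"

definition is_quasinorm :: "('x, 'm) quasi_normed_scheme \<Rightarrow> ('x \<Rightarrow> real) \<Rightarrow> bool" where
  "is_quasinorm X N \<longleftrightarrow>
     (\<forall>x\<in>carrier X. 0 \<le> N x \<and> (N x = 0 \<longleftrightarrow> x = \<zero>\<^bsub>X\<^esub>)) \<and>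
     (\<forall>a. \<forall>x\<in>carrier X. N (a \<odot>\<^bsub>X\<^esub> x) = norm a * N x) \<and>
     (\<exists>K. \<forall>x\<in>carrier X. \<forall>y\<in>carrier X. N (x \<oplus>\<^bsub>X\<^esub> y) \<le> K * (N x + N y))"

definition is_r_norm :: "real \<Rightarrow> ('x, 'm) quasi_normed_scheme \<Rightarrow> ('x \<Rightarrow> real) \<Rightarrow> bool" where
  "is_r_norm r X N \<longleftrightarrow>
     (\<forall>x\<in>carrier X. \<forall>y\<in>carrier X. N (x \<oplus>\<^bsub>X\<^esub> y) powr r \<le> N x powr r + N y powr r)"

definition equivalent_quasinorms ::
    "('x, 'm) quasi_normed_scheme \<Rightarrow> ('x \<Rightarrow> real) \<Rightarrow> ('x \<Rightarrow> real) \<Rightarrow> bool" where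
  "equivalent_quasinorms X N N' \<longleftrightarrow>
     (\<exists>c>0. \<exists>C>0. \<forall>x\<in>carrier X. c * N x \<le> N' x \<and> N' x \<le> C * N x)"

definition qnorm_complete :: "('x, 'm) quasi_normed_scheme \<Rightarrow> bool" where
  "qnorm_complete X \<longleftrightarrow>
     (\<forall>u :: nat \<Rightarrow> 'x. range u \<subseteq> carrier X \<longrightarrow>
        (\<forall>e>0. \<exists>n0. \<forall>m\<ge>n0. \<forall>n\<ge>n0. qnorm X (u m \<ominus>\<^bsub>X\<^esub> u n) < e) \<longrightarrow>
        (\<exists>l\<in>carrier X. (\<lambda>n. qnorm X (u n \<ominus>\<^bsub>X\<^esub> l)) \<longlonglongrightarrow> 0))"

text \<open>The distinguished quasinorm is required to be an \<open>s\<close>-norm for some \<open>0 < s < 1\<close>; this makes it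
  continuous.\<close>

definition quasi_banach :: "('x, 'm) quasi_normed_scheme \<Rightarrow> bool" where
  "quasi_banach X \<longleftrightarrow>
     module complex_ring X \<and>
     is_quasinorm X (qnorm X) \<and>
     (\<exists>s. 0 < s \<and> s < 1 \<and> is_r_norm s X (qnorm X)) \<and>
     qnorm_complete X"

definition r_normable :: "real \<Rightarrow> ('x, 'm) quasi_normed_scheme \<Rightarrow> bool" where
  "r_normable r X \<longleftrightarrow>
     (\<exists>N. is_quasinorm X N \<and> equivalent_quasinorms X (qnorm X) N \<and> is_r_norm r X N)"

section \<open>Vector-valued \<open>L\<^sub>p\<close> quasinorms and property \<open>C\<^sub>p(X)\<close>\<close>

text \<open>\<open>Lp_qnorm M p X \<phi>\<close> is only used for \<open>\<phi>\<close> with \<open>qnorm X \<circ> \<phi>\<close> bounded and measurable and \<open>M\<close> a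
  probability measure, where the integral and the essential supremum are finite.\<close>

definition Lp_qnorm ::
    "'t measure \<Rightarrow> ennreal \<Rightarrow> ('x, 'm) quasi_normed_scheme \<Rightarrow> ('t \<Rightarrow> 'x) \<Rightarrow> real" where
  "Lp_qnorm M p X \<phi> =
     (if p = \<infinity> then real_of_ereal (esssup M (\<lambda>t. ereal (qnorm X (\<phi> t))))
      else (\<integral>t. qnorm X (\<phi> t) powr enn2real p \<partial>M) powr (1 / enn2real p))"

definition property_C ::
    "'g measure \<Rightarrow> ennreal \<Rightarrow> ('x, 'm) quasi_normed_scheme \<Rightarrow> ('g \<Rightarrow> complex) set \<Rightarrow> bool" where
  "property_C \<mu> p X E \<longleftrightarrow>
     (\<exists>M>0. \<forall>(n::nat) (\<gamma> :: nat \<Rightarrow> 'g \<Rightarrow> complex) (x :: nat \<Rightarrow> 'x).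
        inj_on \<gamma> {..<n} \<longrightarrow> \<gamma> ` {..<n} \<subseteq> E \<longrightarrow> x ` {..<n} \<subseteq> carrier X \<longrightarrow>
        (let R = Lp_qnorm cantor_haar p X (\<lambda>t. \<Oplus>\<^bsub>X\<^esub>k\<in>{..<n}. t k \<odot>\<^bsub>X\<^esub> x k);
             S = Lp_qnorm \<mu> p X (\<lambda>g. \<Oplus>\<^bsub>X\<^esub>k\<in>{..<n}. \<gamma> k g \<odot>\<^bsub>X\<^esub> x k)
         in inverse M * R \<le> S \<and> S \<le> M * R))"

end

theory Submission
  imports Defs
begin

text \<open>
  The proof goes through a third condition, \<open>uniformly_approximable\<close>: every
  function on \<open>E\<close> bounded by 1 is, to any prescribed accuracy, uniformly close on
  \<open>E\<close> to the transform \<open>\<gamma> \<mapsto> \<Sum> c \<gamma>(g)\<close> of a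
  discrete measure on \<open>G\<close>, where the number of atoms and the size of the
  coefficients depend only on the accuracy. It is enough to treat functions with values
  \<open>\<plusminus>1\<close> and accuracy \<open>1/8\<close>, since the error can be corrected
  again and again with geometrically decreasing weights
  (\<open>signs_approximable_imp_uniformly\<close>).

  This condition describes interpolation sets. The corrections sum to a uniformly convergent
  series on the Bohr compactification, which gives one direction. For the other, every
  homomorphism from the discrete dual group into the circle is evaluation at a point of
  \<open>G\<close> (\<open>circle_hom_eq_evaluation\<close>). By the Stone-Weierstrass theorem
  each individual sign function on an interpolation set is therefore close to the transform of
  some discrete measure, and Baire's theorem in the compact space \<open>{1, -1}\<^sup>E\<close>
  makes the size of the measures uniform (\<open>interpolation_imp_signs_approximable\<close>).

  The condition implies property \<open>C\<^sub>p\<close>. Multiplying the coefficients of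
  \<open>\<Sum> x\<^sub>k \<gamma>\<^sub>k\<close> by \<open>\<gamma>\<^sub>k(g)\<close> is a
  translation and preserves the \<open>L\<^sub>p\<close> quasinorm. A bounded multiplier is a
  combination of boundedly many translations, up to an error so small that it can be absorbed
  (\<open>multiplier_absorption\<close>). So bounded multipliers act boundedly, on
  \<open>G\<close> and in the same way on the Cantor group, and the two quasinorms are compared
  by looking at \<open>\<Sum> x\<^sub>k t\<^sub>k \<gamma>\<^sub>k(g)\<close> as a function of
  both \<open>t\<close> and \<open>g\<close> (\<open>multiplier_bound_comparison\<close>).

  Conversely, for finitely many characters \<open>\<gamma>\<^sub>k\<close> equip
  \<open>\<complex>\<^sup>n\<close> with the \<open>r\<close>-norm for which
  \<open>\<parallel>y\<parallel>\<^sup>r\<close> is the infimum of \<open>\<Sum>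
  \<bar>c\<bar>\<^sup>r\<close> over the discrete measures with transform \<open>y\<close>
  (\<open>gauge\<close>). The function \<open>\<Sum> \<gamma>\<^sub>k e\<^sub>k\<close> has
  values of norm at most 1, so property \<open>C\<^sub>p\<close> bounds the norm of most sign
  vectors. Every sign vector is a product of two such vectors, and products correspond to
  convolutions of measures, so all sign vectors are bounded. The bound is the same for all
  finite subsets of \<open>E\<close>, because countably many of these spaces fit into a single
  one (\<open>property_C_imp_signs_approximable\<close>). Because \<open>r < 1\<close>, a bound
  for \<open>\<Sum> \<bar>c\<bar>\<^sup>r\<close> makes the contribution of the small
  coefficients negligible (\<open>cost_bound_imp_short_sum\<close>), which leaves boundedly many
  atoms; compactness of \<open>G\<close> extends the approximation from finite sets to
  \<open>E\<close>.
\<close>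

section \<open>Discrete measures and their transforms\<close>

text \<open>
  A list of pairs \<open>(c, g)\<close> stands for the discrete measure \<open>\<Sum> c
  \<delta>\<^sub>g\<close>. It is kept as a list, without merging equal points, so that the
  number of atoms is visible and convolution is a mere listing of products.
\<close>

type_synonym 'g atoms = "(complex \<times> 'g) list"
type_synonym 'g char_fun = "('g \<Rightarrow> complex) \<Rightarrow> complex"
type_synonym 'g bohr_point = "'g char_fun \<Rightarrow> complex"

definition trig_sum :: "'g atoms \<Rightarrow> ('g \<Rightarrow> complex) \<Rightarrow> complex" where
  "trig_sum L \<gamma> = (\<Sum>(c, g)\<leftarrow>L. c * \<gamma> g)"

abbreviation close_on ::
    "('g \<Rightarrow> complex) set \<Rightarrow> real \<Rightarrow> (('g \<Rightarrow> complex) \<Rightarrow> complex) \<Rightarrow> 'g atoms \<Rightarrow> bool" where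
  "close_on E \<delta> f L \<equiv> \<forall>\<gamma>\<in>E. norm (f \<gamma> - trig_sum L \<gamma>) \<le> \<delta>"

text \<open>
  The \<open>r\<close>-th power of the \<open>\<ell>\<^sub>r\<close> quasinorm of the
  coefficients; this power, not the quasinorm, is additive.
\<close>

definition cost :: "real \<Rightarrow> 'g atoms \<Rightarrow> real" where
  "cost r L = (\<Sum>(c, g)\<leftarrow>L. norm c powr r)"

definition scale_coeffs :: "complex \<Rightarrow> 'g atoms \<Rightarrow> 'g atoms" where
  "scale_coeffs a L = map (\<lambda>(c, g). (a * c, g)) L"

definition convolve :: "'g::plus atoms \<Rightarrow> 'g atoms \<Rightarrow> 'g atoms" where
  "convolve L L' = concat (map (\<lambda>(c, g). map (\<lambda>(c', g'). (c * c', g + g')) L') L)"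

lemma trig_sum_simps [simp]:
  "trig_sum [] \<gamma> = 0"
  "trig_sum ((c, g) # L) \<gamma> = c * \<gamma> g + trig_sum L \<gamma>"
  "trig_sum (L @ L') \<gamma> = trig_sum L \<gamma> + trig_sum L' \<gamma>"
  by (simp_all add: trig_sum_def)

lemma cost_simps [simp]:
  "cost r [] = 0"
  "cost r ((c, g) # L) = norm c powr r + cost r L"
  "cost r (L @ L') = cost r L + cost r L'"
  by (simp_all add: cost_def)

lemma cost_nonneg: "0 \<le> cost r L"
  by (induction L) auto

lemma trig_sum_scale: "trig_sum (scale_coeffs a L) \<gamma> = a * trig_sum L \<gamma>"
  by (induction L) (auto simp: scale_coeffs_def algebra_simps)

lemma cost_scale: "cost r (scale_coeffs a L) = norm a powr r * cost r L"
  by (induction L) (auto simp: scale_coeffs_def algebra_simps norm_mult powr_mult)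

text \<open>
  Since \<open>\<delta>\<^sub>x * \<delta>\<^sub>y = \<delta>\<^bsub>x+y\<^esub>\<close>,
  convolution multiplies the transforms at every character. Together with the multiplicativity
  of the cost this makes the set of functions with a cheap representation stable under products.
\<close>

lemma trig_sum_convolve:
  assumes "\<And>x y. \<gamma> (x + y) = \<gamma> x * \<gamma> y"
  shows "trig_sum (convolve L L') \<gamma> = trig_sum L \<gamma> * trig_sum L' \<gamma>"
proof (induction L)
  case (Cons a L)
  have "trig_sum (map (\<lambda>(c', g'). (c * c', g + g')) L') \<gamma> = c * \<gamma> g * trig_sum L' \<gamma>" for c g
    by (induction L') (auto simp: assms algebra_simps)
  with Cons show ?case
    by (cases a) (auto simp: convolve_def algebra_simps)
qed (simp add: convolve_def)

lemma cost_convolve: "cost r (convolve L L') = cost r L * cost r L'"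
proof (induction L)
  case (Cons a L)
  have "cost r (map (\<lambda>(c', g'). (c * c', g + g')) L') = norm c powr r * cost r L'" for c :: complex and g
    by (induction L') (auto simp: algebra_simps norm_mult powr_mult)
  with Cons show ?case
    by (cases a) (auto simp: convolve_def algebra_simps)
qed (simp add: convolve_def)

text \<open>
  One number bounds both the length and the coefficients, so that the admissible measures for a
  given \<open>N\<close> are the continuous image of a compact space when the group is compact.
\<close>

definition short_sum :: "nat \<Rightarrow> 'g atoms \<Rightarrow> bool" where
  "short_sum N L \<longleftrightarrow> length L \<le> N \<and> (\<forall>(c, g)\<in>set L. norm c \<le> real N)"

lemma short_sum_append: "short_sum N L \<Longrightarrow> short_sum N' L' \<Longrightarrow> short_sum (N + N') (L @ L')"
  unfolding short_sum_def by (fastforce intro: order_trans)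

lemma short_sum_scale: "short_sum N L \<Longrightarrow> norm a \<le> 1 \<Longrightarrow> short_sum N (scale_coeffs a L)"
  unfolding short_sum_def scale_coeffs_def
  by (auto simp: norm_mult) (metis case_prodD mult_left_le_one_le norm_ge_zero order_trans)

lemma ex_short_sum: "\<exists>N. short_sum N L"
proof (induction L)
  case (Cons a L)
  then obtain N where N: "short_sum N L" by blast
  obtain c g where a: "a = (c, g)" by fastforce
  have "short_sum (nat \<lceil>norm c\<rceil> + 1) [a]"
    using real_nat_ceiling_ge[of "norm c"] unfolding short_sum_def a by auto linarith
  from short_sum_append[OF this N] show ?case by auto
qed (auto simp: short_sum_def)

definition character :: "('g::{plus,topological_space} \<Rightarrow> complex) \<Rightarrow> bool" where
  "character \<gamma> \<longleftrightarrow> continuous_on UNIV \<gamma> \<and> (\<forall>x. norm (\<gamma> x) = 1) \<and> (\<forall>x y. \<gamma> (x + y) = \<gamma> x * \<gamma> y)"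

lemma in_dual_group_iff: "\<gamma> \<in> carrier dual_group \<longleftrightarrow> character \<gamma>"
  by (simp add: dual_group_def character_def)

lemma norm_trig_sum_le:
  assumes "short_sum N L" "\<And>x. norm (\<gamma> x) = 1"
  shows "norm (trig_sum L \<gamma>) \<le> real N * real N"
proof -
  have *: "norm (trig_sum L \<gamma>) \<le> real (length L) * real N" if "\<forall>(c, g)\<in>set L. norm c \<le> real N"
    using that
  proof (induction L)
    case (Cons a L)
    obtain c g where a: "a = (c, g)" by fastforce
    have "norm (c * \<gamma> g) \<le> real N" using Cons.prems by (simp add: norm_mult assms a)
    moreover have "norm (trig_sum L \<gamma>) \<le> real (length L) * real N"
      using Cons by auto
    ultimately show ?case
      using norm_triangle_ineq[of "c * \<gamma> g" "trig_sum L \<gamma>"] by (simp add: algebra_simps a)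
  qed simp
  have "real (length L) * real N \<le> real N * real N"
    using assms(1) by (intro mult_right_mono) (auto simp: short_sum_def)
  with * assms(1) show ?thesis by (auto simp: short_sum_def)
qed

text \<open>
  The \<open>N\<close>-tuples of atoms with coefficients of modulus at most \<open>N\<close>
  form a compact product space, and closeness at a single character is a closed condition on
  them. The finite intersection property therefore passes from finite sets of characters to
  arbitrary ones.
\<close>

lemma short_sum_compactness:
  fixes f :: "('g::{plus,topological_space} \<Rightarrow> complex) \<Rightarrow> complex"
  assumes G: "compact (UNIV :: 'g set)"
    and E: "\<And>\<gamma>. \<gamma> \<in> E \<Longrightarrow> continuous_on UNIV \<gamma>"
    and fin: "\<And>F. finite F \<Longrightarrow> F \<subseteq> E \<Longrightarrow>
      \<exists>L. short_sum N L \<and> close_on F \<delta> f L"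
  shows "\<exists>L. short_sum N L \<and> close_on E \<delta> f L"
proof -
  define K where "K = {h :: nat \<Rightarrow> complex \<times> 'g. \<forall>j. h j \<in> cball 0 (real N) \<times> UNIV}"
  define v :: "(nat \<Rightarrow> complex \<times> 'g) \<Rightarrow> ('g \<Rightarrow> complex) \<Rightarrow> complex"
    where "v = (\<lambda>h \<gamma>. trig_sum (map h [0..<N]) \<gamma>)"
  have v_eq: "v h \<gamma> = (\<Sum>j<N. fst (h j) * \<gamma> (snd (h j)))" for h \<gamma>
    by (simp add: v_def trig_sum_def interv_sum_list_conv_sum_set_nat case_prod_beta' comp_def
        atLeast0LessThan)
  have "compact K"
  proof -
    have "compactin (product_topology (\<lambda>_. euclidean) UNIV) (Pi\<^sub>E (UNIV :: nat set) (\<lambda>_. (cball 0 (real N) :: complex set) \<times> (UNIV :: 'g set)))"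
      using compact_Times[OF compact_cball G] by (subst compactin_PiE) auto
    moreover have "K = Pi\<^sub>E UNIV (\<lambda>_. cball 0 (real N) \<times> UNIV)"
      by (auto simp: K_def)
    ultimately show ?thesis
      by (simp add: euclidean_product_topology)
  qed
  have cont: "continuous_on UNIV (\<lambda>h :: nat \<Rightarrow> complex \<times> 'g. v h \<gamma>)" if "\<gamma> \<in> E" for \<gamma>
  proof -
    have 1: "continuous_on UNIV (\<lambda>h :: nat \<Rightarrow> complex \<times> 'g. h j)" for j
      by simp
    have "continuous_on UNIV (\<lambda>h :: nat \<Rightarrow> complex \<times> 'g. \<gamma> (snd (h j)))" for j
      using continuous_on_compose2[OF E[OF that] continuous_on_snd[OF 1]] by simp
    then show ?thesis
      unfolding v_eq using 1 by (intro continuous_on_sum continuous_on_mult continuous_on_fst)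
  qed
  have "K \<inter> (\<Inter>\<gamma>\<in>E. {h. norm (f \<gamma> - v h \<gamma>) \<le> \<delta>}) \<noteq> {}"
  proof (rule compact_imp_fip_image[OF \<open>compact K\<close>])
    show "closed {h. norm (f \<gamma> - v h \<gamma>) \<le> \<delta>}" if "\<gamma> \<in> E" for \<gamma>
      by (intro closed_Collect_le continuous_intros cont that)
  next
    fix F assume F: "finite F" "F \<subseteq> E"
    then obtain L where L: "short_sum N L" "close_on F \<delta> f L"
      using fin by blast
    \<comment> \<open>Shorter lists are padded by atoms with coefficient 0.\<close>
    define h where "h = (\<lambda>j. if j < length L then L ! j else (0, undefined))"
    have "h j \<in> cball 0 (real N) \<times> UNIV" for j
      using L(1) by (cases "L ! j") (auto simp: short_sum_def h_def dest!: nth_mem)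
    moreover have "v h \<gamma> = trig_sum L \<gamma>" for \<gamma>
    proof -
      have "v h \<gamma> = (\<Sum>j<length L. fst (h j) * \<gamma> (snd (h j)))"
        unfolding v_eq using L(1)
        by (intro sum.mono_neutral_right) (auto simp: h_def short_sum_def)
      also have "\<dots> = trig_sum L \<gamma>"
        by (auto simp: trig_sum_def h_def sum_list_sum_nth atLeast0LessThan case_prod_beta' intro: sum.cong)
      finally show ?thesis .
    qed
    ultimately have "h \<in> K \<inter> (\<Inter>\<gamma>\<in>F. {h. norm (f \<gamma> - v h \<gamma>) \<le> \<delta>})"
      using L(2) by (auto simp: K_def)
    then show "K \<inter> (\<Inter>\<gamma>\<in>F. {h. norm (f \<gamma> - v h \<gamma>) \<le> \<delta>}) \<noteq> {}" by blast
  qed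
  then obtain h where h: "h \<in> K" "\<forall>\<gamma>\<in>E. norm (f \<gamma> - v h \<gamma>) \<le> \<delta>"
    by blast
  have "short_sum N (map h [0..<N])"
    using h(1) by (auto simp: short_sum_def K_def mem_Times_iff) (metis fst_conv)
  with h(2) show ?thesis
    unfolding v_def by blast
qed

section \<open>Characters and Haar measure\<close>

lemma character_cnj: "character \<gamma> \<Longrightarrow> character (\<lambda>x. cnj (\<gamma> x))"
  by (auto simp: character_def intro: continuous_intros)

lemma character_mult: "character \<gamma> \<Longrightarrow> character \<psi> \<Longrightarrow> character (\<lambda>x. \<gamma> x * \<psi> x)"
  by (auto simp: character_def norm_mult mult_ac intro: continuous_intros)

lemma character_zero: 
  fixes \<gamma> :: "'g::{monoid_add, topological_space} \<Rightarrow> complex"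
  assumes "character \<gamma>" shows "\<gamma> 0 = 1"
proof -
  have "\<gamma> 0 * \<gamma> 0 = \<gamma> 0 * 1"
    using assms unfolding character_def by (metis add.right_neutral mult.right_neutral)
  moreover have "\<gamma> 0 \<noteq> 0" using assms unfolding character_def by (metis norm_zero zero_neq_one)
  ultimately show ?thesis by simp
qed

lemma haar_sets: "normalized_haar_measure \<mu> \<Longrightarrow> sets \<mu> = sets borel"
  unfolding normalized_haar_measure_def by (elim conjE)

lemma haar_space: "normalized_haar_measure \<mu> \<Longrightarrow> space \<mu> = UNIV"
  using sets_eq_imp_space_eq[OF haar_sets] by simp

lemma haar_prob_space: "normalized_haar_measure \<mu> \<Longrightarrow> prob_space \<mu>"
proof (rule prob_spaceI)
  assume haar: "normalized_haar_measure \<mu>"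
  then have "emeasure \<mu> UNIV = 1"
    unfolding normalized_haar_measure_def by (elim conjE)
  then show "emeasure \<mu> (space \<mu>) = 1"
    by (simp only: haar_space[OF haar])
qed

lemma haar_translate:
  assumes "normalized_haar_measure \<mu>" "A \<in> sets borel"
  shows "emeasure \<mu> ((+) g ` A) = emeasure \<mu> A"
proof -
  have "\<forall>g. \<forall>A\<in>sets borel. emeasure \<mu> ((+) g ` A) = emeasure \<mu> A"
    using assms(1) unfolding normalized_haar_measure_def by (elim conjE)
  with assms(2) show ?thesis by blast
qed

lemma haar_borel_measurable:
  fixes u :: "'g::topological_ab_group_add \<Rightarrow> 'b::topological_space"
  assumes "normalized_haar_measure \<mu>" "continuous_on UNIV u"
  shows "u \<in> borel_measurable \<mu>"
proof -
  have "u \<in> borel_measurable borel" using assms(2) by (rule borel_measurable_continuous_onI)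
  then show ?thesis
    by (simp only: measurable_cong_sets[OF haar_sets[OF assms(1)] refl])
qed

lemma haar_translation_measurable:
  fixes h :: "'g::topological_ab_group_add"
  assumes "normalized_haar_measure \<mu>"
  shows "(+) h \<in> measurable \<mu> \<mu>"
proof -
  have "continuous_on UNIV ((+) h)" by (intro continuous_intros)
  then have "(+) h \<in> borel_measurable \<mu>" by (rule haar_borel_measurable[OF assms])
  then show ?thesis
    by (simp only: measurable_cong_sets[OF refl haar_sets[OF assms]])
qed

lemma haar_translation_invariant:
  fixes h :: "'g::topological_ab_group_add"
  assumes "normalized_haar_measure \<mu>"
  shows "distr \<mu> \<mu> ((+) h) = \<mu>"
proof (rule measure_eqI)
  fix A assume "A \<in> sets (distr \<mu> \<mu> ((+) h))"
  then have A: "A \<in> sets \<mu>" by simp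
  have "(+) h -` A \<inter> space \<mu> = (+) (- h) ` A"
  proof (intro equalityI subsetI)
    fix x assume "x \<in> (+) h -` A \<inter> space \<mu>"
    then show "x \<in> (+) (- h) ` A" by (intro image_eqI[of _ _ "h + x"]) auto
  qed (auto simp: haar_space[OF assms])
  moreover have "A \<in> sets borel"
    using A haar_sets[OF assms] by simp
  ultimately show "emeasure (distr \<mu> \<mu> ((+) h)) A = emeasure \<mu> A"
    using emeasure_distr[OF haar_translation_measurable[OF assms] A] haar_translate[OF assms, of A "- h"]
    by presburger
qed (rule sets_distr)

lemma haar_integrable:
  fixes u :: "'g::topological_ab_group_add \<Rightarrow> 'b::{banach, second_countable_topology}"
  assumes "normalized_haar_measure \<mu>" "compact (UNIV :: 'g set)" "continuous_on UNIV u"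
  shows "integrable \<mu> u"
proof -
  interpret prob_space \<mu> by (rule haar_prob_space[OF assms(1)])
  have "bounded (range u)"
    using assms compact_continuous_image compact_imp_bounded by blast
  then obtain B where "\<And>x. norm (u x) \<le> B"
    by (auto simp: bounded_iff)
  then show ?thesis
    using haar_borel_measurable[OF assms(1,3)] by (intro integrable_const_bound[of _ B]) auto
qed

text \<open>
  Haar measure has full support, because finitely many translates of a nonempty open set cover
  the compact group.
\<close>

lemma haar_open_pos:
  fixes U :: "'g::topological_ab_group_add set"
  assumes haar: "normalized_haar_measure \<mu>" and G: "compact (UNIV :: 'g set)"
    and U: "open U" "U \<noteq> {}"
  shows "0 < measure \<mu> U"
proof (rule ccontr)
  interpret prob_space \<mu> by (rule haar_prob_space[OF haar])
  assume "\<not> 0 < measure \<mu> U"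
  then have 0: "emeasure \<mu> U = 0"
    using measure_nonneg[of \<mu> U] by (simp add: emeasure_eq_measure)
  obtain u where u: "u \<in> U" using U(2) by blast
  have op: "open ((+) h ` U)" for h
  proof -
    have "(+) h ` U = (+) (- h) -` U"
    proof (intro equalityI subsetI)
      fix x assume "x \<in> (+) (- h) -` U"
      then show "x \<in> (+) h ` U" by (intro image_eqI[of _ _ "- h + x"]) auto
    qed auto
    moreover have "open ((+) (- h) -` U)"
      by (intro open_vimage U(1) continuous_intros)
    ultimately show ?thesis by simp
  qed
  have "UNIV \<subseteq> (\<Union>h\<in>UNIV. (+) h ` U)"
  proof
    fix x :: 'g
    have "x = (x - u) + u" by simp
    then show "x \<in> (\<Union>h\<in>UNIV. (+) h ` U)" using u by blast
  qed
  then obtain C where C: "finite C" "UNIV \<subseteq> (\<Union>h\<in>C. (+) h ` U)"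
    using compactE_image[OF G, of UNIV "\<lambda>h. (+) h ` U"] op by (metis subset_UNIV)
  have m: "(+) h ` U \<in> sets \<mu>" for h
    using op haar_sets[OF haar] by simp
  have "emeasure \<mu> (\<Union>h\<in>C. (+) h ` U) \<le> (\<Sum>h\<in>C. emeasure \<mu> ((+) h ` U))"
    using m C(1) by (intro emeasure_subadditive_finite) auto
  also have "\<dots> = 0"
    by (simp only: haar_translate[OF haar] borel_open[OF U(1)] 0 sum.neutral_const)
  finally have "emeasure \<mu> UNIV = 0"
    using C(2) by (simp add: top.extremum_unique)
  then show False using emeasure_space_1 haar_space[OF haar] by simp
qed

text \<open>
  Translating by \<open>h\<close> multiplies the integral of \<open>\<gamma>\<close> by
  \<open>\<gamma> h \<noteq> 1\<close> and also leaves it unchanged.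
\<close>

lemma character_integral:
  fixes \<gamma> :: "'g::topological_ab_group_add \<Rightarrow> complex"
  assumes haar: "normalized_haar_measure \<mu>" and "character \<gamma>" "\<gamma> h \<noteq> 1"
  shows "(\<integral>x. \<gamma> x \<partial>\<mu>) = 0"
proof -
  have "(\<integral>x. \<gamma> x \<partial>\<mu>) = (\<integral>x. \<gamma> x \<partial>(distr \<mu> \<mu> ((+) h)))"
    by (simp add: haar_translation_invariant[OF haar])
  also have "\<dots> = (\<integral>x. \<gamma> (h + x) \<partial>\<mu>)"
    using assms by (intro integral_distr haar_translation_measurable haar_borel_measurable)
      (auto simp: character_def)
  also have "\<dots> = \<gamma> h * (\<integral>x. \<gamma> x \<partial>\<mu>)"
    using assms by (simp add: character_def)
  finally have "(1 - \<gamma> h) * (\<integral>x. \<gamma> x \<partial>\<mu>) = 0" by (simp add: algebra_simps)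
  with assms(3) show ?thesis by simp
qed

section \<open>Homomorphisms on the dual group are evaluations\<close>

text \<open>
  These are the homomorphisms from the discrete group of characters into the circle. The aim is
  to show that for a compact group each of them is evaluation at a point of the group, which is
  the part of Pontryagin duality that says that the map into the bidual is onto.
\<close>

definition circle_hom :: "(('g::{plus,topological_space} \<Rightarrow> complex) \<Rightarrow> complex) \<Rightarrow> bool" where
  "circle_hom \<xi> \<longleftrightarrow> (\<forall>\<gamma>. character \<gamma> \<longrightarrow> norm (\<xi> \<gamma>) = 1) \<and>
     (\<forall>\<gamma> \<psi>. character \<gamma> \<longrightarrow> character \<psi> \<longrightarrow> \<xi> (\<lambda>x. \<gamma> x * \<psi> x) = \<xi> \<gamma> * \<xi> \<psi>)"

lemma circle_hom_one: "circle_hom \<xi> \<Longrightarrow> \<xi> (\<lambda>_. 1) = 1"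
proof -
  assume \<xi>: "circle_hom \<xi>"
  have one: "character (\<lambda>_. 1)" by (simp add: character_def)
  with \<xi> have "\<xi> (\<lambda>_. 1 * 1) = \<xi> (\<lambda>_. 1) * \<xi> (\<lambda>_. 1)" "\<xi> (\<lambda>_. 1) \<noteq> 0"
    unfolding circle_hom_def using one by (blast, force)
  then show ?thesis by simp
qed

lemma circle_hom_cnj:
  assumes \<xi>: "circle_hom \<xi>" and \<gamma>: "character \<gamma>"
  shows "\<xi> (\<lambda>x. cnj (\<gamma> x)) = cnj (\<xi> \<gamma>)"
proof -
  have "(\<lambda>x. \<gamma> x * cnj (\<gamma> x)) = (\<lambda>_. 1)"
    using \<gamma> by (auto simp: character_def complex_norm_square[symmetric])
  then have "\<xi> \<gamma> * \<xi> (\<lambda>x. cnj (\<gamma> x)) = 1"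
    using \<xi> \<gamma> character_cnj[OF \<gamma>] circle_hom_one[OF \<xi>] unfolding circle_hom_def by metis
  moreover have "\<xi> \<gamma> * cnj (\<xi> \<gamma>) = 1"
    using \<xi> \<gamma> by (auto simp: circle_hom_def complex_norm_square[symmetric])
  ultimately show ?thesis
    by (metis mult_left_cancel mult_zero_left zero_neq_one)
qed

text \<open>
  \<open>twisted \<xi> u v\<close> relates a trigonometric polynomial \<open>u = \<Sum> c
  \<gamma>\<close> to \<open>v = \<Sum> c \<xi>(\<gamma>) \<gamma>\<close>. A relation between
  functions avoids having to know that the coefficients are determined by \<open>u\<close>.
  Because \<open>\<xi>\<close> is a homomorphism, the relation is compatible with products.
\<close>

inductive twisted :: "(('g::{plus,topological_space} \<Rightarrow> complex) \<Rightarrow> complex) \<Rightarrow> ('g \<Rightarrow> complex) \<Rightarrow> ('g \<Rightarrow> complex) \<Rightarrow> bool"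
  for \<xi> where
  character: "character \<gamma> \<Longrightarrow> twisted \<xi> (\<lambda>x. c * \<gamma> x) (\<lambda>x. c * \<xi> \<gamma> * \<gamma> x)"
| add: "twisted \<xi> u v \<Longrightarrow> twisted \<xi> u' v' \<Longrightarrow> twisted \<xi> (\<lambda>x. u x + u' x) (\<lambda>x. v x + v' x)"

lemma twisted_mult_character:
  assumes \<xi>: "circle_hom \<xi>" and \<gamma>: "character \<gamma>" and "twisted \<xi> u v"
  shows "twisted \<xi> (\<lambda>x. (c * \<gamma> x) * u x) (\<lambda>x. (c * \<xi> \<gamma> * \<gamma> x) * v x)"
  using assms(3)
proof induction
  case (character \<psi> d)
  have "twisted \<xi> (\<lambda>x. (c * d) * (\<gamma> x * \<psi> x)) (\<lambda>x. (c * d) * \<xi> (\<lambda>x. \<gamma> x * \<psi> x) * (\<gamma> x * \<psi> x))"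
    by (intro twisted.character character_mult \<gamma> character)
  moreover have "\<xi> (\<lambda>x. \<gamma> x * \<psi> x) = \<xi> \<gamma> * \<xi> \<psi>"
    using \<xi> \<gamma> character by (auto simp: circle_hom_def)
  ultimately show ?case by (simp add: mult_ac)
next
  case (add u v u' v')
  then show ?case by (simp add: distrib_left twisted.add)
qed

lemma twisted_mult:
  assumes \<xi>: "circle_hom \<xi>" and "twisted \<xi> u v" "twisted \<xi> u' v'"
  shows "twisted \<xi> (\<lambda>x. u x * u' x) (\<lambda>x. v x * v' x)"
  using assms(2)
proof induction
  case (character \<gamma> c)
  then show ?case by (rule twisted_mult_character[OF \<xi> _ assms(3)])
next
  case (add u v u' v')
  then show ?case by (simp add: distrib_right twisted.add)
qed

lemma twisted_const: "circle_hom \<xi> \<Longrightarrow> twisted \<xi> (\<lambda>_. c) (\<lambda>_. c)"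
  using twisted.character[of "\<lambda>_. 1" \<xi> c] circle_hom_one[of \<xi>] by (simp add: character_def)

lemma twisted_prod:
  assumes "circle_hom \<xi>" "finite F" "\<And>i. i \<in> F \<Longrightarrow> twisted \<xi> (u i) (v i)"
  shows "twisted \<xi> (\<lambda>x. \<Prod>i\<in>F. u i x) (\<lambda>x. \<Prod>i\<in>F. v i x)"
  using assms(2,3) by (induction F) (auto intro: twisted_const twisted_mult assms(1))

lemma twisted_power:
  assumes "circle_hom \<xi>" "twisted \<xi> u v"
  shows "twisted \<xi> (\<lambda>x. u x ^ K) (\<lambda>x. v x ^ K)"
  by (induction K) (auto intro: twisted_const twisted_mult assms)

text \<open>
  The integral only sees the coefficient of the trivial character, where \<open>\<xi>\<close>
  takes the value 1.
\<close>

lemma twisted_integral: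
  fixes u v :: "'g::topological_ab_group_add \<Rightarrow> complex"
  assumes haar: "normalized_haar_measure \<mu>" and G: "compact (UNIV :: 'g set)"
    and \<xi>: "circle_hom \<xi>" and "twisted \<xi> u v"
  shows "integrable \<mu> u \<and> integrable \<mu> v \<and> (\<integral>x. u x \<partial>\<mu>) = (\<integral>x. v x \<partial>\<mu>)"
  using assms(4)
proof induction
  case (character \<gamma> c)
  have "integrable \<mu> \<gamma>"
    using character by (intro haar_integrable haar G) (auto simp: character_def)
  moreover have "\<xi> \<gamma> * (\<integral>x. \<gamma> x \<partial>\<mu>) = (\<integral>x. \<gamma> x \<partial>\<mu>)"
  proof (cases "\<forall>h. \<gamma> h = 1")
    case True
    then have "\<gamma> = (\<lambda>_. 1)" by auto
    then show ?thesis using circle_hom_one[OF \<xi>] by simp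
  next
    case False
    then show ?thesis using character_integral[OF haar character] by auto
  qed
  ultimately show ?case by (simp add: mult.assoc)
qed auto

text \<open>
  The growth rate of \<open>\<integral> u\<^sup>K\<close> as \<open>K\<close> tends to infinity
  is the maximum of \<open>u\<close>; for \<open>v\<close> it is at least \<open>v a = 1\<close>
  because a neighbourhood of \<open>a\<close> has positive measure.
\<close>

lemma ex_ge_one_if_power_integrals_eq:
  fixes u v :: "'g::topological_ab_group_add \<Rightarrow> real"
  assumes haar: "normalized_haar_measure \<mu>" and G: "compact (UNIV :: 'g set)"
    and u: "continuous_on UNIV u" "\<And>x. 0 \<le> u x" and v: "continuous_on UNIV v" "\<And>x. 0 \<le> v x" "v a = 1"
    and eq: "\<And>K. (\<integral>x. u x ^ K \<partial>\<mu>) = (\<integral>x. v x ^ K \<partial>\<mu>)"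
  shows "\<exists>x. 1 \<le> u x"
proof (rule ccontr)
  interpret prob_space \<mu> by (rule haar_prob_space[OF haar])
  assume "\<not> ?thesis"
  then have less: "u x < 1" for x by (simp add: not_le)
  obtain y where y: "\<And>x. u x \<le> u y"
    using continuous_attains_sup[OF G _ u(1)] by auto
  define m where "m = u y"
  define q where "q = (m + 1) / 2"
  have mq: "0 \<le> m" "m < q" "q < 1" "0 < q"
    using less[of y] u(2)[of y] by (auto simp: m_def q_def)
  define U where "U = {x. q < v x}"
  have U: "open U" "U \<noteq> {}"
    using v(1) mq v(3) by (auto simp: U_def intro!: open_Collect_less continuous_intros exI[of _ a])
  then have pos: "0 < measure \<mu> U" by (intro haar_open_pos haar G)
  have Us: "U \<in> sets \<mu>" using U(1) haar_sets[OF haar] by simp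
  have "q ^ K * measure \<mu> U \<le> m ^ K" for K
  proof -
    have "q ^ K * measure \<mu> U = (\<integral>x. q ^ K * indicator U x \<partial>\<mu>)"
      using Us by simp
    also have "\<dots> \<le> (\<integral>x. v x ^ K \<partial>\<mu>)"
    proof (rule integral_mono)
      show "integrable \<mu> (\<lambda>x. q ^ K * indicator U x)"
        using Us by (intro integrable_mult_right integrable_real_indicator) (simp_all add: less_top[symmetric])
      show "integrable \<mu> (\<lambda>x. v x ^ K)" by (intro haar_integrable haar G continuous_intros v)
      show "q ^ K * indicator U x \<le> v x ^ K" for x
        using mq v(2)[of x] by (auto simp: U_def indicator_def intro: power_mono)
    qed
    also have "\<dots> = (\<integral>x. u x ^ K \<partial>\<mu>)" by (simp add: eq)
    also have "\<dots> \<le> (\<integral>x. m ^ K \<partial>\<mu>)"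
      using y u(2) by (intro integral_mono haar_integrable haar G continuous_intros u power_mono)
        (auto simp: m_def)
    finally show ?thesis by (simp add: prob_space)
  qed
  then have le: "measure \<mu> U \<le> (m / q) ^ K" for K
    using mq by (simp add: power_divide field_simps)
  have "(\<lambda>K. (m / q) ^ K) \<longlonglongrightarrow> 0"
    using mq by (intro LIMSEQ_realpow_zero) auto
  then have "measure \<mu> U \<le> 0"
    using le by (intro LIMSEQ_le_const) auto
  with pos show False by simp
qed

text \<open>
  For finitely many characters, \<open>u = \<Prod> (1 + Re (cnj (\<xi> \<gamma>) \<gamma>)) /
  2\<close> takes values in \<open>[0, 1]\<close> and equals 1 exactly where \<open>\<gamma> =
  \<xi> \<gamma>\<close> for all these characters. Twisting turns it into \<open>v = \<Prod> (1
  + Re \<gamma>) / 2\<close>, which equals 1 at 0. All powers of \<open>u\<close> and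
  \<open>v\<close> have the same integral, so \<open>u\<close> attains 1 as well. Compactness of
  the group then provides one point that works for all characters.
\<close>

theorem circle_hom_eq_evaluation:
  fixes \<xi> :: "('g::topological_ab_group_add \<Rightarrow> complex) \<Rightarrow> complex"
  assumes haar: "normalized_haar_measure (\<mu> :: 'g measure)" and G: "compact (UNIV :: 'g set)"
    and \<xi>: "circle_hom \<xi>"
  shows "\<exists>g. \<forall>\<gamma>. character \<gamma> \<longrightarrow> \<xi> \<gamma> = \<gamma> g"
proof -
  have fin: "\<exists>g. \<forall>\<gamma>\<in>F. \<gamma> g = \<xi> \<gamma>" if F: "finite F" "\<And>\<gamma>. \<gamma> \<in> F \<Longrightarrow> character \<gamma>" for F
  proof -
    define u where "u = (\<lambda>x. \<Prod>\<gamma>\<in>F. (1 + Re (cnj (\<xi> \<gamma>) * \<gamma> x)) / 2)"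
    define v where "v = (\<lambda>x. \<Prod>\<gamma>\<in>F. (1 + Re (\<gamma> x)) / 2)"
    have cont: "continuous_on UNIV \<gamma>" if "\<gamma> \<in> F" for \<gamma>
      using F(2)[OF that] by (simp add: character_def)
    have norm1: "norm (\<gamma> x) = 1" "norm (cnj (\<xi> \<gamma>) * \<gamma> x) = 1" if "\<gamma> \<in> F" for \<gamma> x
      using F(2)[OF that] \<xi> by (auto simp: character_def circle_hom_def norm_mult)
    have Re1: "\<bar>Re (\<gamma> x)\<bar> \<le> 1" "\<bar>Re (cnj (\<xi> \<gamma>) * \<gamma> x)\<bar> \<le> 1" if "\<gamma> \<in> F" for \<gamma> x
      using norm1[OF that, of x] abs_Re_le_cmod by metis+
    have "twisted \<xi> (\<lambda>x. of_real ((1 + Re (cnj (\<xi> \<gamma>) * \<gamma> x)) / 2)) (\<lambda>x. of_real ((1 + Re (\<gamma> x)) / 2))"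
      if "\<gamma> \<in> F" for \<gamma>
    proof -
      let ?c = "cnj (\<xi> \<gamma>) / 4" and ?d = "\<xi> \<gamma> / 4"
      have unit: "\<xi> \<gamma> * cnj (\<xi> \<gamma>) = 1"
        using F(2)[OF that] \<xi> by (auto simp: circle_hom_def complex_norm_square[symmetric])
      have "twisted \<xi> (\<lambda>x. 1/2 + (?c * \<gamma> x + ?d * cnj (\<gamma> x)))
          (\<lambda>x. 1/2 + (?c * \<xi> \<gamma> * \<gamma> x + ?d * \<xi> (\<lambda>x. cnj (\<gamma> x)) * cnj (\<gamma> x)))"
        using twisted.character[of "\<lambda>x. cnj (\<gamma> x)" \<xi> ?d] F(2)[OF that]
        by (intro twisted.add twisted_const \<xi> twisted.character character_cnj) auto
      moreover have half: "complex_of_real ((1 + Re w) / 2) = 1/2 + (w + cnj w) / 4" for w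
        by (simp add: complex_eq_iff)
      have "(\<lambda>x. 1/2 + (?c * \<gamma> x + ?d * cnj (\<gamma> x))) = (\<lambda>x. of_real ((1 + Re (cnj (\<xi> \<gamma>) * \<gamma> x)) / 2))"
        unfolding half by (simp add: add_divide_distrib)
      moreover have "?c * \<xi> \<gamma> * w = w / 4" "?d * \<xi> (\<lambda>x. cnj (\<gamma> x)) * w = w / 4" for w
        using unit by (simp_all add: circle_hom_cnj[OF \<xi> F(2)[OF that]] mult.commute)
      then have "(\<lambda>x. 1/2 + (?c * \<xi> \<gamma> * \<gamma> x + ?d * \<xi> (\<lambda>x. cnj (\<gamma> x)) * cnj (\<gamma> x))) = (\<lambda>x. of_real ((1 + Re (\<gamma> x)) / 2))"
        unfolding half by (simp only: add_divide_distrib)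
      ultimately show ?thesis by (simp only:)
    qed
    then have tw: "twisted \<xi> (\<lambda>x. of_real (u x) ^ K) (\<lambda>x. of_real (v x) ^ K)" for K
      unfolding u_def v_def of_real_prod by (intro twisted_power twisted_prod \<xi> F(1))
    have "(\<integral>x. u x ^ K \<partial>\<mu>) = (\<integral>x. v x ^ K \<partial>\<mu>)" for K
    proof -
      have "complex_of_real (\<integral>x. u x ^ K \<partial>\<mu>) = complex_of_real (\<integral>x. v x ^ K \<partial>\<mu>)"
        using twisted_integral[OF haar G \<xi> tw[of K]] by (simp flip: integral_complex_of_real)
      then show ?thesis by simp
    qed
    moreover have "v 0 = 1"
      unfolding v_def by (intro prod.neutral) (auto simp: character_zero F)
    moreover have "continuous_on UNIV u" "continuous_on UNIV v"
      unfolding u_def v_def by (intro continuous_intros cont; simp)+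
    moreover have half_nonneg: "0 \<le> (1 + a) / 2" if "\<bar>a\<bar> \<le> 1" for a :: real
      using that by (simp add: abs_le_iff)
    have "0 \<le> (1 + Re (cnj (\<xi> \<gamma>) * \<gamma> x)) / 2" "0 \<le> (1 + Re (\<gamma> x)) / 2" if "\<gamma> \<in> F" for \<gamma> x
      using half_nonneg[OF Re1(1)[OF that]] half_nonneg[OF Re1(2)[OF that]] by blast+
    then have "0 \<le> u x" "0 \<le> v x" for x
      unfolding u_def v_def by (simp_all only: prod_nonneg)
    ultimately obtain g where g: "1 \<le> u g"
      using ex_ge_one_if_power_integrals_eq[OF haar G, of u v 0] by blast
    have "\<gamma> g = \<xi> \<gamma>" if \<gamma>: "\<gamma> \<in> F" for \<gamma>
    proof -
      let ?w = "\<lambda>\<gamma>. cnj (\<xi> \<gamma>) * \<gamma> g"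
      have "u g = (1 + Re (?w \<gamma>)) / 2 * (\<Prod>\<gamma>\<in>F - {\<gamma>}. (1 + Re (?w \<gamma>)) / 2)"
        unfolding u_def using F(1) \<gamma> by (rule prod.remove)
      also have "\<dots> \<le> (1 + Re (?w \<gamma>)) / 2 * 1"
      proof (rule mult_left_mono)
        have "0 \<le> (1 + Re (?w \<psi>)) / 2 \<and> (1 + Re (?w \<psi>)) / 2 \<le> 1" if "\<psi> \<in> F - {\<gamma>}" for \<psi>
          using Re1(2)[of \<psi> g] that by (simp add: abs_le_iff)
        then show "(\<Prod>\<gamma>\<in>F - {\<gamma>}. (1 + Re (?w \<gamma>)) / 2) \<le> 1"
          by (rule prod_le_1)
      qed (use Re1(2)[OF \<gamma>, of g] in \<open>simp add: abs_le_iff\<close>)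
      finally have "Re (?w \<gamma>) = 1"
        using g Re1(2)[OF \<gamma>, of g] by (simp add: abs_le_iff)
      moreover have "(Re (?w \<gamma>))\<^sup>2 + (Im (?w \<gamma>))\<^sup>2 = 1"
        using norm1(2)[OF \<gamma>, of g] cmod_power2 by (metis one_power2)
      ultimately have "?w \<gamma> = 1"
        by (auto simp: complex_eq_iff)
      moreover have "\<xi> \<gamma> * cnj (\<xi> \<gamma>) = 1"
        using F(2)[OF \<gamma>] \<xi> by (auto simp: circle_hom_def complex_norm_square[symmetric])
      then have "\<xi> \<gamma> * ?w \<gamma> = \<gamma> g"
        by (simp flip: mult.assoc)
      ultimately show ?thesis by simp
    qed
    then show ?thesis by blast
  qed
  have "UNIV \<inter> (\<Inter>\<gamma>\<in>Collect character. {g. \<gamma> g = \<xi> \<gamma>}) \<noteq> {}"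
  proof (rule compact_imp_fip_image[OF G])
    show "closed {g. \<gamma> g = \<xi> \<gamma>}" if "\<gamma> \<in> Collect character" for \<gamma>
      using that by (intro closed_Collect_eq continuous_intros) (auto simp: character_def)
  next
    fix F :: "('g \<Rightarrow> complex) set" assume "finite F" "F \<subseteq> Collect character"
    with fin[of F] show "UNIV \<inter> (\<Inter>\<gamma>\<in>F. {g. \<gamma> g = \<xi> \<gamma>}) \<noteq> {}" by auto
  qed
  then obtain g where "\<forall>\<gamma>\<in>Collect character. \<gamma> g = \<xi> \<gamma>" by blast
  then show ?thesis by (intro exI[of _ g]) simp
qed

section \<open>The Bohr compactification\<close>

lemma open_coordinate_vimage: "open W \<Longrightarrow> open ((\<lambda>f. f i) -` W)"
  for W :: "'b::topological_space set"
  by (intro open_vimage) auto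

text \<open>
  The points of the Bohr compactification are functions, and the Stone-Weierstrass theorem is
  applied to a compact set of them; for this the type of functions into a Hausdorff space has to
  be Hausdorff itself, as a topological product. The weaker separation classes come first
  because they contain the stronger ones.
\<close>

instance "fun" :: (type, t0_space) t0_space
proof
  fix x y :: "'a \<Rightarrow> 'b" assume "x \<noteq> y"
  then obtain i where i: "x i \<noteq> y i" by auto
  obtain U where "open U" "\<not> (x i \<in> U \<longleftrightarrow> y i \<in> U)"
    using t0_space_class.t0_space[OF i] by blast
  then show "\<exists>U. open U \<and> \<not> (x \<in> U \<longleftrightarrow> y \<in> U)"
    using open_coordinate_vimage[of U i] by (intro exI[of _ "(\<lambda>f. f i) -` U"]) auto
qed

instance "fun" :: (type, t1_space) t1_space
proof
  fix x y :: "'a \<Rightarrow> 'b" assume "x \<noteq> y"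
  then obtain i where i: "x i \<noteq> y i" by auto
  obtain U where "open U" "x i \<in> U" "y i \<notin> U"
    using t1_space_class.t1_space[OF i] by blast
  then show "\<exists>U. open U \<and> x \<in> U \<and> y \<notin> U"
    using open_coordinate_vimage[of U i] by (intro exI[of _ "(\<lambda>f. f i) -` U"]) auto
qed

instance "fun" :: (type, t2_space) t2_space
proof
  fix x y :: "'a \<Rightarrow> 'b" assume "x \<noteq> y"
  then obtain i where i: "x i \<noteq> y i" by auto
  obtain U V where UV: "open U" "open V" "x i \<in> U" "y i \<in> V" "U \<inter> V = {}"
    using hausdorff[OF i] by blast
  with open_coordinate_vimage show "\<exists>U V. open U \<and> open V \<and> x \<in> U \<and> y \<in> V \<and> U \<inter> V = {}"
    by (intro exI[of _ "(\<lambda>f. f i) -` U"] exI[of _ "(\<lambda>f. f i) -` V"]) (use UV in auto)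
qed

text \<open>
  A point of the Bohr compactification is a function on \<open>bohr_coords\<close>, the group of
  homomorphisms from the discrete dual group into the circle; \<open>bohr_points\<close> is the
  underlying set of the compactification.
\<close>

abbreviation bohr_coords :: "'g::topological_ab_group_add char_fun set" where
  "bohr_coords \<equiv> carrier (discrete_dual dual_group)"

abbreviation bohr_points :: "'g::topological_ab_group_add bohr_point set" where
  "bohr_points \<equiv> carrier (discrete_dual (discrete_dual dual_group))"

definition coord_mult :: "'g::topological_ab_group_add char_fun \<Rightarrow> 'g char_fun \<Rightarrow> ('g \<Rightarrow> complex) \<Rightarrow> complex" where
  "coord_mult \<xi> \<psi> = (\<lambda>\<gamma>\<in>Collect character. \<xi> \<gamma> * \<psi> \<gamma>)"

lemma carrier_dual_group: "carrier dual_group = Collect character"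
  by (auto simp: in_dual_group_iff)

lemma bohr_coords_iff: "\<xi> \<in> bohr_coords \<longleftrightarrow> circle_hom \<xi> \<and> \<xi> \<in> extensional (Collect character)"
proof -
  have "mult dual_group \<gamma> \<psi> = (\<lambda>x. \<gamma> x * \<psi> x)" for \<gamma> \<psi> :: "'a \<Rightarrow> complex"
    by (simp add: dual_group_def)
  then show ?thesis
    by (auto simp: discrete_dual_def hom_def circle_group_def carrier_dual_group circle_hom_def Pi_def)
qed

lemma bohr_points_iff:
  "z \<in> bohr_points \<longleftrightarrow> z \<in> extensional bohr_coords \<and> (\<forall>\<xi>\<in>bohr_coords. norm (z \<xi>) = 1) \<and>
     (\<forall>\<xi>\<in>bohr_coords. \<forall>\<psi>\<in>bohr_coords. z (coord_mult \<xi> \<psi>) = z \<xi> * z \<psi>)"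
proof -
  have "mult (discrete_dual dual_group) = (coord_mult :: (('a \<Rightarrow> complex) \<Rightarrow> complex) \<Rightarrow> _)"
    by (simp add: discrete_dual_def coord_mult_def fun_eq_iff carrier_dual_group)
  moreover have "z \<in> bohr_points \<longleftrightarrow> z \<in> extensional bohr_coords \<and> z \<in> hom (discrete_dual dual_group) circle_group"
    by (auto simp: discrete_dual_def[of "discrete_dual dual_group"])
  ultimately show ?thesis
    by (auto simp: hom_def circle_group_def Pi_def)
qed

lemma coord_mult_closed: "\<xi> \<in> bohr_coords \<Longrightarrow> \<psi> \<in> bohr_coords \<Longrightarrow> coord_mult \<xi> \<psi> \<in> bohr_coords"
  by (auto simp: bohr_coords_iff coord_mult_def circle_hom_def norm_mult character_mult mult_ac)

lemma evaluation_in_bohr_coords: "(\<lambda>\<gamma>\<in>Collect character. \<gamma> g) \<in> bohr_coords"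
  by (auto simp: bohr_coords_iff circle_hom_def character_mult) (auto simp: character_def)

lemma bohr_coords_evaluation:
  fixes \<xi> :: "('g::topological_ab_group_add \<Rightarrow> complex) \<Rightarrow> complex"
  assumes "normalized_haar_measure (\<mu> :: 'g measure)" "compact (UNIV :: 'g set)"
    and "\<xi> \<in> bohr_coords"
  shows "\<exists>g. \<forall>\<gamma>. character \<gamma> \<longrightarrow> \<xi> \<gamma> = \<gamma> g"
  using circle_hom_eq_evaluation[OF assms(1,2)] assms(3) by (auto simp: bohr_coords_iff)

lemma bohr_embedding_eq: "bohr_embedding dual_group \<gamma> = (\<lambda>\<xi>\<in>bohr_coords. \<xi> \<gamma>)"
  by (simp add: bohr_embedding_def)

lemma bohr_embedding_in_bohr_points:
  assumes "character \<gamma>" shows "bohr_embedding dual_group \<gamma> \<in> bohr_points"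
  using assms by (auto simp: bohr_embedding_eq bohr_points_iff coord_mult_closed)
    (auto simp: bohr_coords_iff circle_hom_def coord_mult_def)

text \<open>
  All points agree, with value \<open>undefined\<close>, outside \<open>bohr_coords\<close>, so
  the product topology over these coordinates and the product topology over the whole type
  induce the same topology on \<open>bohr_points\<close>.
\<close>

lemma continuous_map_bohr_iff:
  fixes F :: "'g::topological_ab_group_add bohr_point \<Rightarrow> complex"
  shows "continuous_map (bohr_compactification dual_group) euclidean F \<longleftrightarrow> continuous_on bohr_points F"
proof -
  let ?I = "bohr_coords :: 'g char_fun set"
  let ?S = "bohr_points :: 'g bohr_point set"
  let ?B = "bohr_compactification (dual_group :: ('g \<Rightarrow> complex) monoid)"
  have S_ext: "?S \<subseteq> extensional ?I" by (auto simp: bohr_points_iff)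
  have B: "?B = subtopology (product_topology (\<lambda>_. euclidean) ?I) ?S"
    by (simp add: bohr_compactification_def)
  have topB: "topspace ?B = ?S"
    using S_ext by (auto simp: B PiE_UNIV_domain PiE_def)
  have 1: "continuous_map (top_of_set ?S) ?B id"
    unfolding B using S_ext
    by (auto simp: continuous_map_in_subtopology continuous_map_componentwise
        continuous_on_subset[OF continuous_on_product_coordinates])
  have 2: "continuous_map ?B (top_of_set ?S) id"
  proof -
    have "continuous_map ?B euclidean (\<lambda>z. z i)" for i
    proof (cases "i \<in> ?I")
      case True
      then show ?thesis
        unfolding B by (intro continuous_map_from_subtopology continuous_map_product_projection)
    next
      case False
      have undef: "undefined = z i" if "z \<in> topspace ?B" for z
        using that S_ext False unfolding topB by (auto simp: extensional_def)
      show ?thesis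
        by (rule continuous_map_eq[of ?B euclidean "\<lambda>_. undefined"]) (auto intro: undef)
    qed
    then have "continuous_map ?B euclidean id"
      by (subst euclidean_product_topology[symmetric]) (auto simp: continuous_map_componentwise_UNIV)
    then show ?thesis
      using topB by (simp add: continuous_map_in_subtopology)
  qed
  show ?thesis
    using continuous_map_compose[OF 1, of euclidean F] continuous_map_compose[OF 2, of euclidean F] by auto
qed

text \<open>
  The homomorphism equations cut out a closed subset of a product of circles and singletons.
\<close>

lemma compact_bohr_points: "compact (bohr_points :: 'g::topological_ab_group_add bohr_point set)"
proof -
  let ?I = "bohr_coords :: 'g char_fun set"
  define P where "P = Pi\<^sub>E UNIV (\<lambda>\<xi>. if \<xi> \<in> ?I then sphere 0 1 else {undefined :: complex})"
  define Q where "Q = {z. \<forall>\<xi>\<in>?I. \<forall>\<psi>\<in>?I. z (coord_mult \<xi> \<psi>) = z \<xi> * (z \<psi> :: complex)}"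
  have "compactin (product_topology (\<lambda>_. euclidean) UNIV) P"
    unfolding P_def by (subst compactin_PiE) auto
  then have "compact P"
    by (simp add: euclidean_product_topology)
  moreover have "closed Q"
    unfolding Q_def Ball_def by (intro closed_Collect_all closed_Collect_imp closed_Collect_eq continuous_intros
        continuous_on_product_coordinates open_Collect_const)
  moreover have "bohr_points = P \<inter> Q"
    by (auto simp: bohr_points_iff P_def Q_def PiE_iff extensional_def split: if_splits)
  ultimately show ?thesis
    by (simp add: compact_Int_closed)
qed

text \<open>
  On \<open>bohr_points\<close>, these linear combinations of coordinates are the trigonometric
  polynomials on the Bohr compactification.
\<close>

inductive bohr_polynomial :: "('g::topological_ab_group_add bohr_point \<Rightarrow> complex) \<Rightarrow> bool" where
  coord: "\<xi> \<in> bohr_coords \<Longrightarrow> bohr_polynomial (\<lambda>z. c * z \<xi>)"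
| add: "bohr_polynomial u \<Longrightarrow> bohr_polynomial v \<Longrightarrow> bohr_polynomial (\<lambda>z. u z + v z)"

lemma bohr_polynomial_mult_coord:
  "bohr_polynomial v \<Longrightarrow> \<xi> \<in> bohr_coords \<Longrightarrow>
     \<exists>w. bohr_polynomial w \<and> (\<forall>z\<in>bohr_points. w z = (c * z \<xi>) * v z)"
proof (induction rule: bohr_polynomial.induct)
  case (coord \<psi> d)
  then show ?case
    by (intro exI[of _ "\<lambda>z. (c * d) * z (coord_mult \<xi> \<psi>)"])
      (auto intro!: bohr_polynomial.coord coord_mult_closed simp: bohr_points_iff)
next
  case (add u v)
  then obtain w w' where "bohr_polynomial w" "bohr_polynomial w'"
    "\<forall>z\<in>bohr_points. w z = (c * z \<xi>) * u z" "\<forall>z\<in>bohr_points. w' z = (c * z \<xi>) * v z" by blast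
  then show ?case
    by (intro exI[of _ "\<lambda>z. w z + w' z"]) (auto intro: bohr_polynomial.add simp: distrib_left)
qed

lemma bohr_polynomial_mult:
  "bohr_polynomial u \<Longrightarrow> bohr_polynomial v \<Longrightarrow>
     \<exists>w. bohr_polynomial w \<and> (\<forall>z\<in>bohr_points. w z = u z * v z)"
proof (induction rule: bohr_polynomial.induct)
  case (coord \<xi> c)
  then show ?case by (intro bohr_polynomial_mult_coord)
next
  case (add u u')
  then obtain w w' where "bohr_polynomial w" "bohr_polynomial w'"
    "\<forall>z\<in>bohr_points. w z = u z * v z" "\<forall>z\<in>bohr_points. w' z = u' z * v z" by blast
  then show ?case
    by (intro exI[of _ "\<lambda>z. w z + w' z"]) (auto intro: bohr_polynomial.add simp: distrib_right)
qed

text \<open>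
  By duality each coordinate \<open>\<xi>\<close> is evaluation at a point of the group, so on
  the characters themselves a polynomial on the Bohr compactification is the transform of a
  discrete measure.
\<close>

lemma bohr_polynomial_restrict:
  assumes "normalized_haar_measure (\<mu> :: 'g::topological_ab_group_add measure)" "compact (UNIV :: 'g set)"
    and "bohr_polynomial u"
  shows "\<exists>L :: 'g atoms. \<forall>\<gamma>. character \<gamma> \<longrightarrow> u (bohr_embedding dual_group \<gamma>) = trig_sum L \<gamma>"
  using assms(3)
proof (induction rule: bohr_polynomial.induct)
  case (coord \<xi> c)
  obtain g where "\<forall>\<gamma>. character \<gamma> \<longrightarrow> \<xi> \<gamma> = \<gamma> g"
    using bohr_coords_evaluation[OF assms(1,2) coord] by blast
  then show ?case
    using coord by (intro exI[of _ "[(c, g)]"]) (simp add: bohr_embedding_eq)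
next
  case (add u v)
  then obtain L L' where "\<forall>\<gamma>. character \<gamma> \<longrightarrow> u (bohr_embedding dual_group \<gamma>) = trig_sum L \<gamma>"
    "\<forall>\<gamma>. character \<gamma> \<longrightarrow> v (bohr_embedding dual_group \<gamma>) = trig_sum L' \<gamma>" by blast
  then show ?case by (intro exI[of _ "L @ L'"]) simp
qed

text \<open>
  Evaluation at 0 is the neutral coordinate; it yields the constants among the polynomials.
\<close>

lemma bohr_point_unit:
  assumes "z \<in> bohr_points"
  shows "z (\<lambda>\<gamma>\<in>Collect character. \<gamma> (0 :: 'g::topological_ab_group_add)) = 1"
proof -
  let ?e = "\<lambda>\<gamma>\<in>Collect character. \<gamma> (0 :: 'g) :: complex"
  have e: "?e \<in> bohr_coords" by (rule evaluation_in_bohr_coords)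
  have ee: "coord_mult ?e ?e = ?e"
    by (auto simp: coord_mult_def fun_eq_iff character_zero)
  have "z (coord_mult ?e ?e) = z ?e * z ?e" "norm (z ?e) = 1"
    using assms e unfolding bohr_points_iff by blast+
  then have "z ?e * z ?e = z ?e * 1" "z ?e \<noteq> 0"
    unfolding ee by auto
  then show ?thesis by simp
qed

text \<open>
  The inverse of \<open>\<xi>\<close> in the group of coordinates is its conjugate
  \<open>\<eta>\<close>, and a point of the compactification takes conjugate values at
  \<open>\<xi>\<close> and \<open>\<eta>\<close>.
\<close>

lemma bohr_polynomial_Re_Im:
  assumes "\<xi> \<in> (bohr_coords :: 'g::topological_ab_group_add char_fun set)"
  shows "\<exists>w. bohr_polynomial w \<and> (\<forall>z\<in>bohr_points. w z = of_real (Re (z \<xi>)))"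
    and "\<exists>w. bohr_polynomial w \<and> (\<forall>z\<in>bohr_points. w z = of_real (Im (z \<xi>)))"
proof -
  define \<eta> where "\<eta> = (\<lambda>\<gamma>\<in>Collect character. cnj (\<xi> \<gamma>))"
  have \<eta>: "\<eta> \<in> bohr_coords"
    using assms by (auto simp: bohr_coords_iff circle_hom_def \<eta>_def character_mult)
  have cnj: "z \<eta> = cnj (z \<xi>)" if z: "z \<in> bohr_points" for z
  proof -
    let ?e = "\<lambda>\<gamma>\<in>Collect character. \<gamma> (0 :: 'g) :: complex"
    have unit: "\<xi> \<gamma> * cnj (\<xi> \<gamma>) = 1" if "character \<gamma>" for \<gamma>
      using assms that by (auto simp: bohr_coords_iff circle_hom_def complex_norm_square[symmetric])
    have e: "coord_mult \<xi> \<eta> = ?e"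
      by (auto simp: coord_mult_def character_zero \<eta>_def unit fun_eq_iff)
    have "z (coord_mult \<xi> \<eta>) = z \<xi> * z \<eta>"
      using z assms \<eta> unfolding bohr_points_iff by blast
    then have "z \<xi> * z \<eta> = 1"
      using bohr_point_unit[OF z] unfolding e by simp
    moreover have "z \<xi> * cnj (z \<xi>) = 1"
      using z assms by (auto simp: bohr_points_iff complex_norm_square[symmetric])
    ultimately show ?thesis
      by (metis mult_left_cancel mult_zero_left zero_neq_one)
  qed
  show "\<exists>w. bohr_polynomial w \<and> (\<forall>z\<in>bohr_points. w z = of_real (Re (z \<xi>)))"
    by (intro exI[of _ "\<lambda>z. 1/2 * z \<xi> + 1/2 * z \<eta>"] conjI bohr_polynomial.intros assms \<eta>)
      (auto simp: cnj complex_eq_iff)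
  show "\<exists>w. bohr_polynomial w \<and> (\<forall>z\<in>bohr_points. w z = of_real (Im (z \<xi>)))"
    by (intro exI[of _ "\<lambda>z. -\<i>/2 * z \<xi> + \<i>/2 * z \<eta>"] conjI bohr_polynomial.intros assms \<eta>)
      (auto simp: cnj complex_eq_iff)
qed

text \<open>
  The real polynomials form an algebra that separates points of the compactification, hence
  approximate the real part of a continuous extension of \<open>f\<close>. The number of atoms
  needed may still depend on \<open>f\<close>.
\<close>

lemma interpolation_imp_trig_approximation:
  fixes f :: "('g::topological_ab_group_add \<Rightarrow> complex) \<Rightarrow> real"
  assumes haar: "normalized_haar_measure (\<mu> :: 'g measure)" and G: "compact (UNIV :: 'g set)"
    and E: "E \<subseteq> Collect character" and int: "interpolation_set dual_group E"
    and f: "bounded (f ` E)" and \<delta>: "0 < \<delta>"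
  shows "\<exists>L :: 'g atoms. \<forall>\<gamma>\<in>E. norm (of_real (f \<gamma>) - trig_sum L \<gamma>) \<le> \<delta>"
proof -
  have "bounded ((\<lambda>\<gamma>. complex_of_real (f \<gamma>)) ` E)"
    using f by (simp add: bounded_iff)
  then obtain F :: "'g bohr_point \<Rightarrow> complex"
    where F: "continuous_map (bohr_compactification dual_group) euclidean F"
    "\<forall>\<gamma>\<in>E. F (bohr_embedding dual_group \<gamma>) = of_real (f \<gamma>)"
    using int unfolding interpolation_set_def by blast
  define P where "P = (\<lambda>u :: 'g bohr_point \<Rightarrow> real. continuous_on bohr_points u \<and>
    (\<exists>w. bohr_polynomial w \<and> (\<forall>z\<in>bohr_points. w z = of_real (u z))))"
  have "\<exists>u. P u \<and> (\<forall>z\<in>bohr_points. \<bar>Re (F z) - u z\<bar> < \<delta>)"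
  proof (rule Stone_Weierstrass_HOL[OF compact_bohr_points _ _ _ _ _ _ \<delta>])
    show "P (\<lambda>_. c)" for c
    proof -
      let ?e = "\<lambda>\<gamma>\<in>Collect character. \<gamma> (0 :: 'g) :: complex"
      have e: "?e \<in> bohr_coords" by (rule evaluation_in_bohr_coords)
      have unit: "of_real c * z ?e = of_real c" if "z \<in> bohr_points" for z
        by (simp only: bohr_point_unit[OF that] mult_1_right)
      show ?thesis unfolding P_def
      proof (rule conjI[OF continuous_on_const exI])
        show "bohr_polynomial (\<lambda>z. of_real c * z ?e) \<and> (\<forall>z\<in>bohr_points. of_real c * z ?e = of_real c)"
          by (rule conjI[OF bohr_polynomial.coord[OF e] ballI[OF unit]])
      qed
    qed
    show "continuous_on bohr_points u" if "P u" for u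
      using that by (simp add: P_def)
    show "P (\<lambda>x. u x + v x)" if "P u \<and> P v" for u v
    proof -
      obtain w w' where "bohr_polynomial w" "\<forall>z\<in>bohr_points. w z = of_real (u z)"
        "bohr_polynomial w'" "\<forall>z\<in>bohr_points. w' z = of_real (v z)"
        using \<open>P u \<and> P v\<close> by (auto simp: P_def)
      then show ?thesis
        using that unfolding P_def
        by (intro conjI continuous_on_add exI[of _ "\<lambda>z. w z + w' z"] bohr_polynomial.add) auto
    qed
    show "P (\<lambda>x. u x * v x)" if "P u \<and> P v" for u v
    proof -
      obtain w w' where w: "bohr_polynomial w" "\<forall>z\<in>bohr_points. w z = of_real (u z)"
        "bohr_polynomial w'" "\<forall>z\<in>bohr_points. w' z = of_real (v z)"
        using \<open>P u \<and> P v\<close> by (auto simp: P_def)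
      then show ?thesis
        using that bohr_polynomial_mult[OF w(1,3)] unfolding P_def
        by (intro conjI continuous_on_mult) auto
    qed
    show "\<exists>u. P u \<and> u z \<noteq> u \<psi>" if "z \<in> bohr_points \<and> \<psi> \<in> bohr_points \<and> z \<noteq> \<psi>" for z \<psi>
    proof -
      have "z \<in> extensional bohr_coords" "\<psi> \<in> extensional bohr_coords"
        using that by (simp_all add: bohr_points_iff)
      then have "\<not> (\<forall>\<xi>\<in>bohr_coords. z \<xi> = \<psi> \<xi>)"
        using extensionalityI[of z bohr_coords \<psi>] that by blast
      then obtain \<xi> where \<xi>: "\<xi> \<in> bohr_coords" "z \<xi> \<noteq> \<psi> \<xi>"
        by blast
      have cont: "continuous_on bohr_points (\<lambda>z :: 'g bohr_point. z \<xi>)"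
        by (rule continuous_on_subset[OF continuous_on_product_coordinates subset_UNIV])
      have "P (\<lambda>z. Re (z \<xi>))" "P (\<lambda>z. Im (z \<xi>))"
        unfolding P_def
        by (rule conjI[OF continuous_on_Re[OF cont] bohr_polynomial_Re_Im(1)[OF \<xi>(1)]],
            rule conjI[OF continuous_on_Im[OF cont] bohr_polynomial_Re_Im(2)[OF \<xi>(1)]])
      then show ?thesis using \<xi>(2) complex_eq_iff by blast
    qed
    show "continuous_on bohr_points (\<lambda>z. Re (F z))"
      using F(1) by (intro continuous_intros) (simp add: continuous_map_bohr_iff)
  qed
  then obtain u w where u: "\<forall>z\<in>bohr_points. \<bar>Re (F z) - u z\<bar> < \<delta>"
    and w: "bohr_polynomial w" "\<forall>z\<in>bohr_points. w z = of_real (u z)"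
    by (auto simp: P_def)
  obtain L :: "'g atoms"
    where L: "\<forall>\<gamma>. character \<gamma> \<longrightarrow> w (bohr_embedding dual_group \<gamma>) = trig_sum L \<gamma>"
    using bohr_polynomial_restrict[OF haar G w(1)] by blast
  have "norm (of_real (f \<gamma>) - trig_sum L \<gamma>) \<le> \<delta>" if "\<gamma> \<in> E" for \<gamma>
  proof -
    let ?z = "bohr_embedding dual_group \<gamma>"
    have \<gamma>: "character \<gamma>" using that E by auto
    then have z: "?z \<in> bohr_points" by (rule bohr_embedding_in_bohr_points)
    have "Re (F ?z) = f \<gamma>" using F(2) that by simp
    then have "complex_of_real (f \<gamma>) - trig_sum L \<gamma> = of_real (Re (F ?z) - u ?z)"
      using L[rule_format, OF \<gamma>] w(2)[rule_format, OF z] by simp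
    then show ?thesis using u z by (metis less_imp_le norm_of_real)
  qed
  then show ?thesis by blast
qed

section \<open>Interpolation sets and approximation by short sums\<close>

text \<open>
  The point of this notion is that \<open>N\<close> does not depend on \<open>f\<close>. It
  turns out to describe interpolation sets, in a form that refers to points of the group only.
\<close>

definition uniformly_approximable :: "('g \<Rightarrow> complex) set \<Rightarrow> bool" where
  "uniformly_approximable E \<longleftrightarrow>
     (\<forall>\<delta>>0. \<exists>N. \<forall>f. (\<forall>\<gamma>\<in>E. norm (f \<gamma>) \<le> 1) \<longrightarrow>
        (\<exists>L :: 'g atoms. short_sum N L \<and> close_on E \<delta> f L))"

definition signs_approximable :: "('g \<Rightarrow> complex) set \<Rightarrow> bool" where
  "signs_approximable E \<longleftrightarrow>
     (\<exists>N. \<forall>f. (\<forall>\<gamma>\<in>E. f \<gamma> \<in> {1, -1}) \<longrightarrow>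
        (\<exists>L :: 'g atoms. short_sum N L \<and> close_on E (1/8) f L))"

text \<open>
  If \<open>s\<close> and \<open>t\<close> are the signs of the real and imaginary part of
  \<open>f\<close>, then \<open>(s + \<i> t) / 2\<close> differs from \<open>f\<close> by at
  most \<open>1 / sqrt 2 < 3/4\<close>. Replacing both signs by short sums costs another
  \<open>1/8\<close>.
\<close>

lemma signs_approximable_step:
  fixes E :: "('g \<Rightarrow> complex) set"
  assumes "signs_approximable E"
  shows "\<exists>N. \<forall>f. (\<forall>\<gamma>\<in>E. norm (f \<gamma>) \<le> 1) \<longrightarrow>
        (\<exists>L :: 'g atoms. short_sum N L \<and> close_on E (7/8) f L)"
proof -
  obtain N where N: "\<And>s. (\<forall>\<gamma>\<in>E. s \<gamma> \<in> {1, -1}) \<Longrightarrow>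
    \<exists>L :: 'g atoms. short_sum N L \<and> close_on E (1/8) s L"
    using assms unfolding signs_approximable_def by blast
  have "\<exists>L :: 'g atoms. short_sum (N + N) L \<and> close_on E (7/8) f L"
    if f: "\<forall>\<gamma>\<in>E. norm (f \<gamma>) \<le> 1" for f
  proof -
    define s where "s = (\<lambda>\<gamma>. if Re (f \<gamma>) \<ge> 0 then 1 else -1 :: complex)"
    define t where "t = (\<lambda>\<gamma>. if Im (f \<gamma>) \<ge> 0 then 1 else -1 :: complex)"
    have s_sign: "\<forall>\<gamma>\<in>E. s \<gamma> \<in> {1, -1}" and t_sign: "\<forall>\<gamma>\<in>E. t \<gamma> \<in> {1, -1}"
      by (simp_all add: s_def t_def)
    obtain L :: "'g atoms" where L: "short_sum N L" "close_on E (1/8) s L"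
      using N[of s] s_sign by blast
    obtain L' :: "'g atoms" where L': "short_sum N L'" "close_on E (1/8) t L'"
      using N[of t] t_sign by blast
    define L'' where "L'' = scale_coeffs (1/2) L @ scale_coeffs (\<i>/2) L'"
    have "short_sum (N + N) L''"
      unfolding L''_def by (intro short_sum_append short_sum_scale L L') auto
    moreover have "norm (f \<gamma> - trig_sum L'' \<gamma>) \<le> 7/8" if \<gamma>: "\<gamma> \<in> E" for \<gamma>
    proof -
      have close: "\<bar>Re (f \<gamma>) - Re (s \<gamma>) / 2\<bar> \<le> 1/2" "\<bar>Im (f \<gamma>) - Re (t \<gamma>) / 2\<bar> \<le> 1/2"
      proof -
        have "\<bar>Re (f \<gamma>)\<bar> \<le> 1" "\<bar>Im (f \<gamma>)\<bar> \<le> 1"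
          using f \<gamma> abs_Re_le_cmod[of "f \<gamma>"] abs_Im_le_cmod[of "f \<gamma>"] order_trans by blast+
        then show "\<bar>Re (f \<gamma>) - Re (s \<gamma>) / 2\<bar> \<le> 1/2" "\<bar>Im (f \<gamma>) - Re (t \<gamma>) / 2\<bar> \<le> 1/2"
          by (auto simp: s_def t_def abs_if field_simps split: if_splits)
      qed
      define w where "w = f \<gamma> - (s \<gamma> / 2 + \<i> * t \<gamma> / 2)"
      have st: "Im (s \<gamma>) = 0" "Im (t \<gamma>) = 0" by (auto simp: s_def t_def)
      have "Re w = Re (f \<gamma>) - Re (s \<gamma>) / 2" "Im w = Im (f \<gamma>) - Re (t \<gamma>) / 2"
        using st by (auto simp: w_def)
      then have "\<bar>Re w\<bar> \<le> 1/2" "\<bar>Im w\<bar> \<le> 1/2" using close by simp_all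
      then have "(Re w)\<^sup>2 \<le> (1/2)\<^sup>2" "(Im w)\<^sup>2 \<le> (1/2)\<^sup>2"
        by (metis abs_ge_zero power2_abs power_mono)+
      then have "(norm w)\<^sup>2 \<le> (1/2)\<^sup>2 + (1/2)\<^sup>2"
        unfolding cmod_power2 by (rule add_mono)
      also have "\<dots> \<le> (3/4 :: real)\<^sup>2"
        by (simp add: power2_eq_square)
      finally have w: "norm w \<le> 3/4"
        by (rule power2_le_imp_le) simp
      have "f \<gamma> - trig_sum L'' \<gamma> = w + (s \<gamma> - trig_sum L \<gamma>) / 2 + \<i> / 2 * (t \<gamma> - trig_sum L' \<gamma>)"
        by (simp add: L''_def trig_sum_scale w_def algebra_simps diff_divide_distrib)
      also have "norm \<dots> \<le> norm w + norm ((s \<gamma> - trig_sum L \<gamma>) / 2) + norm (\<i> / 2 * (t \<gamma> - trig_sum L' \<gamma>))"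
        by (intro order_trans[OF norm_triangle_ineq] add_mono norm_triangle_ineq order_refl)
      also have "\<dots> \<le> 3/4 + 1/16 + 1/16"
        using w L(2) L'(2) \<gamma> by (intro add_mono) (auto simp: norm_mult norm_divide)
      finally show ?thesis by simp
    qed
    ultimately show ?thesis by blast
  qed
  then show ?thesis by blast
qed

text \<open>
  The remainder of one approximation step, divided by the factor \<open>7/8\<close> gained, is
  again bounded by 1, so the step can be repeated.
\<close>

lemma signs_approximable_imp_uniformly:
  fixes E :: "('g \<Rightarrow> complex) set"
  assumes "signs_approximable E"
  shows "uniformly_approximable E"
proof -
  obtain N where N: "\<And>f. (\<forall>\<gamma>\<in>E. norm (f \<gamma>) \<le> 1) \<Longrightarrow>
    \<exists>L :: 'g atoms. short_sum N L \<and> close_on E (7/8) f L"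
    using signs_approximable_step[OF assms] by blast
  have iter: "\<exists>L :: 'g atoms. short_sum (k * N) L \<and> close_on E ((7/8) ^ k) f L"
    if f: "\<forall>\<gamma>\<in>E. norm (f \<gamma>) \<le> 1" for f k
  proof (induction k)
    case 0
    then show ?case using f by (intro exI[of _ "[]"]) (auto simp: short_sum_def)
  next
    case (Suc k)
    then obtain L :: "'g atoms"
      where L: "short_sum (k * N) L" "close_on E ((7/8) ^ k) f L" by blast
    define q :: complex where "q = (7/8) ^ k"
    have q: "norm q = (7/8) ^ k" "q \<noteq> 0" by (simp_all add: q_def norm_power norm_divide)
    have "\<forall>\<gamma>\<in>E. norm ((f \<gamma> - trig_sum L \<gamma>) / q) \<le> 1"
      using L(2) q by (simp add: norm_divide divide_le_eq)
    then obtain L' :: "'g atoms" where L': "short_sum N L'"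
      "\<forall>\<gamma>\<in>E. norm ((f \<gamma> - trig_sum L \<gamma>) / q - trig_sum L' \<gamma>) \<le> 7/8"
      using N[of "\<lambda>\<gamma>. (f \<gamma> - trig_sum L \<gamma>) / q"] by blast
    have "norm (f \<gamma> - trig_sum (L @ scale_coeffs q L') \<gamma>) \<le> (7/8) ^ Suc k" if "\<gamma> \<in> E" for \<gamma>
    proof -
      have "f \<gamma> - trig_sum (L @ scale_coeffs q L') \<gamma> = q * ((f \<gamma> - trig_sum L \<gamma>) / q - trig_sum L' \<gamma>)"
        using q(2) by (simp add: trig_sum_scale field_simps)
      then show ?thesis
        using L'(2) that q(1) by (simp add: norm_mult)
    qed
    moreover have "short_sum (Suc k * N) (L @ scale_coeffs q L')"
      using short_sum_append[OF L(1) short_sum_scale[OF L'(1), of q]] q(1)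
      by (simp add: add.commute power_le_one)
    ultimately show ?case by blast
  qed
  show ?thesis
    unfolding uniformly_approximable_def
  proof (intro allI impI)
    fix \<delta> :: real assume "\<delta> > 0"
    then obtain k where q: "(7/8 :: real) ^ k < \<delta>"
      using real_arch_pow_inv[of \<delta> "7/8"] by auto
    show "\<exists>N. \<forall>f. (\<forall>\<gamma>\<in>E. norm (f \<gamma>) \<le> 1) \<longrightarrow>
        (\<exists>L :: 'g atoms. short_sum N L \<and> close_on E \<delta> f L)"
    proof (intro exI[of _ "k * N"] allI impI)
      fix f :: "('g \<Rightarrow> complex) \<Rightarrow> complex" assume "\<forall>\<gamma>\<in>E. norm (f \<gamma>) \<le> 1"
      from iter[OF this, of k] q
      show "\<exists>L :: 'g atoms. short_sum (k * N) L \<and> close_on E \<delta> f L"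
        by (meson less_imp_le order_trans)
    qed
  qed
qed

text \<open>
  Repeating approximation within \<open>1/2\<close> writes \<open>f\<close> as a series
  \<open>\<Sum>k. (1/2)^k T\<^sub>k\<close> of transforms of short sums. The same series defines
  a continuous function on the Bohr compactification, since short sums for one \<open>N\<close>
  are uniformly bounded there.
\<close>

lemma uniformly_approximable_imp_interpolation:
  fixes E :: "('g::topological_ab_group_add \<Rightarrow> complex) set"
  assumes E: "E \<subseteq> Collect character" and "uniformly_approximable E"
  shows "interpolation_set dual_group E"
  unfolding interpolation_set_def
proof (intro allI impI)
  fix f :: "('g \<Rightarrow> complex) \<Rightarrow> complex" assume "bounded (f ` E)"
  then obtain B where B: "B > 0" "\<forall>\<gamma>\<in>E. norm (f \<gamma>) \<le> B"
    by (auto simp: bounded_pos)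
  obtain N where "\<forall>f. (\<forall>\<gamma>\<in>E. norm (f \<gamma>) \<le> 1) \<longrightarrow>
    (\<exists>L :: 'g atoms. short_sum N L \<and> close_on E (1/2) f L)"
    using assms(2) unfolding uniformly_approximable_def
    by (metis half_gt_zero_iff zero_less_one)
  then obtain ap :: "'g char_fun \<Rightarrow> 'g atoms" where
    ap: "\<And>f. (\<forall>\<gamma>\<in>E. norm (f \<gamma>) \<le> 1) \<Longrightarrow> short_sum N (ap f) \<and> (\<forall>\<gamma>\<in>E. norm (f \<gamma> - trig_sum (ap f) \<gamma>) \<le> 1/2)"
    by metis
  \<comment> \<open>\<open>R k\<close> is the remainder after \<open>k\<close> steps, rescaled by \<open>2^k\<close> to keep it bounded by 1.\<close>
  define R where "R = rec_nat (\<lambda>\<gamma>. f \<gamma> / of_real B) (\<lambda>_ h \<gamma>. 2 * (h \<gamma> - trig_sum (ap h) \<gamma>))"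
  have R0: "R 0 \<gamma> = f \<gamma> / of_real B" and RS: "R (Suc k) \<gamma> = 2 * (R k \<gamma> - trig_sum (ap (R k)) \<gamma>)" for k \<gamma>
    by (simp_all add: R_def)
  have R1: "\<forall>\<gamma>\<in>E. norm (R k \<gamma>) \<le> 1" for k
  proof (induction k)
    case 0
    then show ?case using B by (simp add: R0 norm_divide)
  next
    case (Suc k)
    then have "\<forall>\<gamma>\<in>E. norm (R k \<gamma> - trig_sum (ap (R k)) \<gamma>) \<le> 1/2" using ap by blast
    then show ?case unfolding RS norm_mult by (simp add: mult.commute)
  qed
  have short: "short_sum N (ap (R k))" for k using ap R1 by blast
  define ev :: "'g \<Rightarrow> ('g \<Rightarrow> complex) \<Rightarrow> complex" where "ev = (\<lambda>g. \<lambda>\<gamma>\<in>Collect character. \<gamma> g)"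
  define T :: "nat \<Rightarrow> 'g bohr_point \<Rightarrow> complex"
    where "T = (\<lambda>k z. (1/2) ^ k * trig_sum (ap (R k)) (\<lambda>g. z (ev g)))"
  have T_cont: "continuous_on bohr_points (T k)" for k
  proof -
    have coord: "continuous_on bohr_points (\<lambda>z :: 'g bohr_point. z \<xi>)" for \<xi>
      by (rule continuous_on_subset[OF continuous_on_product_coordinates subset_UNIV])
    have "continuous_on bohr_points (\<lambda>z :: 'g bohr_point. trig_sum L (\<lambda>g. z (ev g)))" for L
    proof (induction L)
      case (Cons a L)
      then show ?case
        by (cases a) (simp add: continuous_on_add[OF continuous_on_mult[OF continuous_on_const coord]])
    qed (simp add: continuous_on_const)
    then show ?thesis unfolding T_def by (rule continuous_on_mult[OF continuous_on_const])
  qed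
  have T_bound: "norm (T k z) \<le> (1/2) ^ k * (real N * real N)" if "z \<in> bohr_points" for k z
  proof -
    have "norm (z (ev g)) = 1" for g
      using that evaluation_in_bohr_coords[of g] by (auto simp: bohr_points_iff ev_def)
    then have "norm (trig_sum (ap (R k)) (\<lambda>g. z (ev g))) \<le> real N * real N"
      by (intro norm_trig_sum_le short) auto
    then show ?thesis
      by (simp add: T_def norm_mult norm_power norm_divide divide_right_mono)
  qed
  have unif: "uniform_limit bohr_points (\<lambda>n z. \<Sum>k<n. T k z) (\<lambda>z. \<Sum>k. T k z) sequentially"
    by (rule Weierstrass_m_test[where M = "\<lambda>k. (1/2) ^ k * (real N * real N)"])
      (auto intro: T_bound summable_mult2 summable_geometric)
  define F where "F = (\<lambda>z. of_real B * (\<Sum>k. T k z))"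
  have "continuous_on bohr_points F"
    unfolding F_def
  proof (rule continuous_on_mult[OF continuous_on_const uniform_limit_theorem[OF _ unif]])
    show "\<forall>\<^sub>F n in sequentially. continuous_on bohr_points (\<lambda>z. \<Sum>k<n. T k z)"
      by (rule always_eventually, rule allI, rule continuous_on_sum, rule T_cont)
  qed simp
  moreover have "F (bohr_embedding dual_group \<gamma>) = f \<gamma>" if \<gamma>: "\<gamma> \<in> E" for \<gamma>
  proof -
    have ch: "character \<gamma>" using \<gamma> E by auto
    have "bohr_embedding dual_group \<gamma> (ev g) = \<gamma> g" for g
      using evaluation_in_bohr_coords[of g] ch by (simp add: bohr_embedding_eq ev_def)
    then have T: "T k (bohr_embedding dual_group \<gamma>) = (1/2) ^ k * trig_sum (ap (R k)) \<gamma>" for k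
      by (simp add: T_def)
    have tele: "(\<Sum>k<n. (1/2) ^ k * trig_sum (ap (R k)) \<gamma>) = f \<gamma> / of_real B - (1/2) ^ n * R n \<gamma>" for n
    proof (induction n)
      case (Suc n)
      then show ?case by (simp add: RS algebra_simps)
    qed (simp add: R0)
    have "(\<lambda>n. (1/2) ^ n * R n \<gamma>) \<longlonglongrightarrow> 0"
    proof (rule Lim_null_comparison)
      show "\<forall>\<^sub>F n in sequentially. norm ((1/2) ^ n * R n \<gamma>) \<le> (1/2) ^ n"
        using R1 \<gamma> by (intro always_eventually allI)
          (simp add: norm_mult norm_power norm_divide divide_right_mono)
      show "(\<lambda>n. (1/2) ^ n :: real) \<longlonglongrightarrow> 0" by (intro LIMSEQ_realpow_zero) auto
    qed
    then have "(\<lambda>n. \<Sum>k<n. T k (bohr_embedding dual_group \<gamma>)) \<longlonglongrightarrow> f \<gamma> / of_real B - 0"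
      unfolding T tele by (intro tendsto_intros)
    then have "(\<Sum>k. T k (bohr_embedding dual_group \<gamma>)) = f \<gamma> / of_real B"
      using sums_unique[of "\<lambda>k. T k (bohr_embedding dual_group \<gamma>)" "f \<gamma> / of_real B"] by (simp add: sums_def)
    then show ?thesis using B(1) by (simp add: F_def)
  qed
  ultimately show "\<exists>F. continuous_map (bohr_compactification dual_group) euclidean F \<and>
      (\<forall>\<gamma>\<in>E. F (bohr_embedding dual_group \<gamma>) = f \<gamma>)"
    using continuous_map_bohr_iff by blast
qed

text \<open>
  Functions supported by a fixed finite set are combinations of finitely many indicator
  functions, each of which has some approximation; therefore one \<open>N\<close> serves all of
  them. The factor 2 is the largest possible difference of two signs.
\<close>

lemma finite_support_approximation:
  fixes E :: "('g \<Rightarrow> complex) set"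
  assumes approx: "\<And>f :: ('g \<Rightarrow> complex) \<Rightarrow> real. \<And>\<delta>. bounded (f ` E) \<Longrightarrow> 0 < \<delta> \<Longrightarrow>
      \<exists>L :: 'g atoms. \<forall>\<gamma>\<in>E. norm (of_real (f \<gamma>) - trig_sum L \<gamma>) \<le> \<delta>"
    and "finite F" "0 < \<delta>"
  shows "\<exists>N. \<forall>a. (\<forall>\<gamma>\<in>F. norm (a \<gamma>) \<le> 1) \<longrightarrow> (\<exists>L :: 'g atoms. short_sum N L \<and>
      (\<forall>\<gamma>\<in>E. norm ((if \<gamma> \<in> F then 2 * a \<gamma> else 0) - trig_sum L \<gamma>) \<le> \<delta>))"
  using assms(2,3)
proof (induction F arbitrary: \<delta>)
  case empty
  then show ?case by (intro exI[of _ 0] allI impI exI[of _ "[]"]) (auto simp: short_sum_def)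
next
  case (insert \<psi> F)
  obtain N where N: "\<And>a. (\<forall>\<gamma>\<in>F. norm (a \<gamma>) \<le> 1) \<Longrightarrow> (\<exists>L :: 'g atoms. short_sum N L \<and>
      (\<forall>\<gamma>\<in>E. norm ((if \<gamma> \<in> F then 2 * a \<gamma> else 0) - trig_sum L \<gamma>) \<le> \<delta> / 2))"
    using insert.IH[of "\<delta> / 2"] insert.prems by auto
  let ?f = "\<lambda>\<gamma>. if \<gamma> = \<psi> then 2 else 0 :: real"
  have "bounded (?f ` E)"
    by (rule bounded_subset[of "{0, 2}"]) auto
  then obtain L0 :: "'g atoms" where L0: "\<forall>\<gamma>\<in>E. norm (of_real (?f \<gamma>) - trig_sum L0 \<gamma>) \<le> \<delta> / 2"
    using approx[of ?f "\<delta> / 2"] insert.prems by auto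
  obtain N0 where N0: "short_sum N0 L0" using ex_short_sum by blast
  have "\<exists>L. short_sum (N0 + N) L \<and> (\<forall>\<gamma>\<in>E. norm ((if \<gamma> \<in> insert \<psi> F then 2 * a \<gamma> else 0) - trig_sum L \<gamma>) \<le> \<delta>)"
    if a: "\<forall>\<gamma>\<in>insert \<psi> F. norm (a \<gamma>) \<le> 1" for a
  proof -
    obtain L where L: "short_sum N L" "\<forall>\<gamma>\<in>E. norm ((if \<gamma> \<in> F then 2 * a \<gamma> else 0) - trig_sum L \<gamma>) \<le> \<delta> / 2"
      using N[of a] a by auto
    define L' where "L' = scale_coeffs (a \<psi>) L0 @ L"
    have "short_sum (N0 + N) L'"
      unfolding L'_def using a by (intro short_sum_append short_sum_scale N0 L) auto
    moreover have "norm ((if \<gamma> \<in> insert \<psi> F then 2 * a \<gamma> else 0) - trig_sum L' \<gamma>) \<le> \<delta>" if \<gamma>: "\<gamma> \<in> E" for \<gamma>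
    proof -
      let ?u = "of_real (?f \<gamma>) - trig_sum L0 \<gamma>" and ?v = "(if \<gamma> \<in> F then 2 * a \<gamma> else 0) - trig_sum L \<gamma>"
      have "(if \<gamma> \<in> insert \<psi> F then 2 * a \<gamma> else 0) - trig_sum L' \<gamma> = a \<psi> * ?u + ?v"
        using insert.hyps by (auto simp: L'_def trig_sum_scale algebra_simps)
      moreover have "norm (a \<psi> * ?u) \<le> 1 * (\<delta> / 2)"
        unfolding norm_mult using a L0 \<gamma> by (intro mult_mono) auto
      moreover have "norm ?v \<le> \<delta> / 2" using L(2) \<gamma> by blast
      ultimately show ?thesis
        using norm_triangle_ineq[of "a \<psi> * ?u" ?v] by simp
    qed
    ultimately show ?thesis by blast
  qed
  then show ?case by blast
qed

text \<open>
  Let \<open>A N\<close> be the set of sign functions with an approximation by a sum of size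
  \<open>N\<close>. These sets are closed in the compact space \<open>{1, -1}\<^sup>E\<close>
  and cover it, so by Baire's theorem one of them contains all sign functions with prescribed
  values on some finite set \<open>F\<close>. An arbitrary sign function differs from such a
  function only on \<open>F\<close>, and the difference is approximated at a cost that depends
  only on \<open>F\<close>.
\<close>

lemma interpolation_imp_signs_approximable:
  fixes E :: "('g::topological_ab_group_add \<Rightarrow> complex) set"
  assumes haar: "normalized_haar_measure (\<mu> :: 'g measure)" and G: "compact (UNIV :: 'g set)"
    and E: "E \<subseteq> Collect character" and int: "interpolation_set dual_group E"
  shows "signs_approximable E"
proof -
  note approx = interpolation_imp_trig_approximation[OF haar G E int]
  define X where "X = product_topology (\<lambda>_. discrete_topology {1, -1 :: complex}) E"
  have topX: "topspace X = Pi\<^sub>E E (\<lambda>_. {1, -1})" by (simp add: X_def)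
  define A where "A = (\<lambda>N. {f \<in> topspace X. \<exists>L :: 'g atoms. short_sum N L \<and>
      close_on E (1/16) f L})"
  have closed: "closedin X (A N)" for N
  proof -
    have "X closure_of A N \<subseteq> A N"
    proof
      fix f assume f: "f \<in> X closure_of A N"
      have ftop: "f \<in> topspace X" using f by (simp add: in_closure_of)
      have "\<exists>L :: 'g atoms. short_sum N L \<and> close_on E (1/16) f L"
      proof (rule short_sum_compactness[OF G])
        show "continuous_on UNIV \<gamma>" if "\<gamma> \<in> E" for \<gamma> using that E by (auto simp: character_def)
        fix F assume F: "finite F" "F \<subseteq> E"
        define U where "U = Pi\<^sub>E E (\<lambda>\<gamma>. if \<gamma> \<in> F then {f \<gamma>} else {1, -1})"
        have "openin X U"
          unfolding X_def U_def
        proof (rule openin_PiE_gen[THEN iffD2], intro disjI2 conjI ballI)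
          have "{i \<in> E. (if i \<in> F then {f i} else {1, - 1}) \<noteq> topspace (discrete_topology {1, - 1})} \<subseteq> F"
            by auto
          then show "finite {i \<in> E. (if i \<in> F then {f i} else {1, - 1}) \<noteq> topspace (discrete_topology {1, - 1})}"
            using F(1) finite_subset by blast
        qed (use ftop in \<open>auto simp: topX PiE_iff\<close>)
        moreover have "f \<in> U" using ftop by (auto simp: U_def topX PiE_iff)
        ultimately obtain h where h: "h \<in> A N" "h \<in> U"
          using f unfolding in_closure_of by blast
        then obtain L :: "'g atoms" where "short_sum N L" "close_on E (1/16) h L"
          by (auto simp: A_def)
        moreover have "h \<gamma> = f \<gamma>" if "\<gamma> \<in> F" for \<gamma>
          using h(2) that F(2) by (auto simp: U_def PiE_iff split: if_splits)
        ultimately show "\<exists>L. short_sum N L \<and> close_on F (1/16) f L"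
          using F(2) by (metis subsetD)
      qed
      with ftop show "f \<in> A N" by (simp add: A_def)
    qed
    then show ?thesis
      by (metis (no_types, lifting) A_def closure_of_subset_eq mem_Collect_eq subsetI closure_of_eq closure_of_subset subset_antisym)
  qed
  have cover: "topspace X \<subseteq> (\<Union>N. A N)"
  proof
    fix f assume f: "f \<in> topspace X"
    then have re: "of_real (Re (f \<gamma>)) = f \<gamma>" if "\<gamma> \<in> E" for \<gamma>
      using that by (auto simp: topX PiE_iff)
    have "bounded ((\<lambda>\<gamma>. Re (f \<gamma>)) ` E)"
      using f by (auto simp: topX PiE_iff intro!: finite_imp_bounded finite_subset[of _ "{1, -1}"])
    then obtain L :: "'g atoms" where "\<forall>\<gamma>\<in>E. norm (of_real (Re (f \<gamma>)) - trig_sum L \<gamma>) \<le> 1/16"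
      using approx[of "\<lambda>\<gamma>. Re (f \<gamma>)" "1/16"] by auto
    moreover obtain N where "short_sum N L" using ex_short_sum by blast
    ultimately show "f \<in> (\<Union>N. A N)" using f re by (auto simp: A_def)
  qed
  have "\<exists>N. X interior_of A N \<noteq> {}"
  proof (rule ccontr)
    assume "\<nexists>N. X interior_of A N \<noteq> {}"
    moreover have "compact_space X"
      unfolding X_def compact_space_product_topology by (simp add: compact_space_discrete_topology)
    moreover have "Hausdorff_space X"
      unfolding X_def by (simp add: Hausdorff_space_product_topology Hausdorff_space_discrete_topology)
    ultimately have "X interior_of \<Union>(range A) = {}"
      using closed by (intro Baire_category_alt)
        (auto simp: compact_imp_locally_compact_space compact_Hausdorff_or_regular_imp_normal_space
          compact_Hausdorff_imp_regular_space)
    moreover have "\<Union>(range A) = topspace X"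
      using cover by (auto simp: A_def)
    ultimately have "topspace X = {}" by simp
    moreover have "(\<lambda>\<gamma>\<in>E. 1) \<in> topspace X" by (simp add: topX)
    ultimately show False by blast
  qed
  then obtain N f0 where f0: "f0 \<in> X interior_of A N" by blast
  have "openin X (X interior_of A N)" by simp
  then obtain V where V: "finite {\<gamma> \<in> E. V \<gamma> \<noteq> {1, -1}}" "f0 \<in> Pi\<^sub>E E V" "Pi\<^sub>E E V \<subseteq> X interior_of A N"
    using f0 unfolding X_def openin_product_topology_alt by force
  define F where "F = {\<gamma> \<in> E. V \<gamma> \<noteq> {1, -1}}"
  have f0top: "f0 \<in> topspace X" using f0 by (meson interior_of_subset_topspace subsetD)
  obtain N' where N': "\<And>a. (\<forall>\<gamma>\<in>F. norm (a \<gamma>) \<le> 1) \<Longrightarrow> (\<exists>L :: 'g atoms. short_sum N' L \<and>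
      (\<forall>\<gamma>\<in>E. norm ((if \<gamma> \<in> F then 2 * a \<gamma> else 0) - trig_sum L \<gamma>) \<le> 1/16))"
    using finite_support_approximation[of E F "1/16", OF approx] V(1) unfolding F_def by auto
  have "\<exists>L :: 'g atoms. short_sum (N + N') L \<and> close_on E (1/8) f L"
    if f: "\<forall>\<gamma>\<in>E. f \<gamma> \<in> {1, -1}" for f
  proof -
    define h where "h = (\<lambda>\<gamma>\<in>E. if \<gamma> \<in> F then f0 \<gamma> else f \<gamma>)"
    have "h \<gamma> \<in> V \<gamma>" if "\<gamma> \<in> E" for \<gamma>
    proof (cases "\<gamma> \<in> F")
      case True
      then show ?thesis using V(2) that by (simp add: h_def PiE_mem)
    next
      case False
      then have "V \<gamma> = {1, -1}" using that by (simp add: F_def)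
      then show ?thesis using f that False by (simp add: h_def)
    qed
    then have "h \<in> Pi\<^sub>E E V" by (simp add: h_def PiE_iff)
    then have "h \<in> A N" using V(3) interior_of_subset[of X "A N"] by (meson subsetD)
    then obtain L :: "'g atoms" where L: "short_sum N L" "close_on E (1/16) h L"
      by (auto simp: A_def)
    define a where "a = (\<lambda>\<gamma>. (f \<gamma> - f0 \<gamma>) / 2)"
    have "norm (a \<gamma>) \<le> 1" if "\<gamma> \<in> F" for \<gamma>
    proof -
      have "f \<gamma> \<in> {1, -1}" "f0 \<gamma> \<in> {1, -1}"
        using f f0top that by (auto simp: F_def topX PiE_iff)
      then show ?thesis by (auto simp: a_def)
    qed
    then obtain L' :: "'g atoms" where L': "short_sum N' L'"
      "\<forall>\<gamma>\<in>E. norm ((if \<gamma> \<in> F then 2 * a \<gamma> else 0) - trig_sum L' \<gamma>) \<le> 1/16"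
      using N'[of a] by blast
    have "norm (f \<gamma> - trig_sum (L @ L') \<gamma>) \<le> 1/8" if \<gamma>: "\<gamma> \<in> E" for \<gamma>
    proof -
      have "f \<gamma> - trig_sum (L @ L') \<gamma> =
          (h \<gamma> - trig_sum L \<gamma>) + ((if \<gamma> \<in> F then 2 * a \<gamma> else 0) - trig_sum L' \<gamma>)"
        using \<gamma> by (auto simp: h_def a_def diff_divide_distrib)
      also have "norm \<dots> \<le> 1/16 + 1/16"
        using L(2) L'(2) \<gamma> by (intro order_trans[OF norm_triangle_ineq] add_mono) auto
      finally show ?thesis by simp
    qed
    with short_sum_append[OF L(1) L'(1)] show ?thesis by blast
  qed
  then show ?thesis unfolding signs_approximable_def by blast
qed

theorem interpolation_iff_uniformly_approximable:
  fixes E :: "('g::topological_ab_group_add \<Rightarrow> complex) set"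
  assumes haar: "normalized_haar_measure (\<mu> :: 'g measure)" and G: "compact (UNIV :: 'g set)"
    and E: "E \<subseteq> Collect character"
  shows "interpolation_set dual_group E \<longleftrightarrow> uniformly_approximable E"
  using interpolation_imp_signs_approximable[OF haar G E] signs_approximable_imp_uniformly
    uniformly_approximable_imp_interpolation[OF E] by blast

section \<open>Estimates for \<open>L\<^sub>p\<close> quasinorms\<close>

text \<open>
  The \<open>L\<^sub>p\<close> quasinorm of a nonnegative function. Its properties are derived,
  for finite and infinite \<open>p\<close>, from the descriptions of the inequality \<open>Lp M
  p u \<le> c\<close> below.
\<close>

definition Lp :: "'t measure \<Rightarrow> ennreal \<Rightarrow> ('t \<Rightarrow> real) \<Rightarrow> real" where
  "Lp M p u = (if p = \<infinity> then real_of_ereal (esssup M (\<lambda>t. ereal (u t)))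
      else (\<integral>t. u t powr enn2real p \<partial>M) powr (1 / enn2real p))"

lemma Lp_qnorm_eq_Lp: "Lp_qnorm M p X \<phi> = Lp M p (\<lambda>t. qnorm X (\<phi> t))"
  by (simp add: Lp_qnorm_def Lp_def)

definition bounded_measurable :: "'t measure \<Rightarrow> ('t \<Rightarrow> real) \<Rightarrow> bool" where
  "bounded_measurable M u \<longleftrightarrow> u \<in> borel_measurable M \<and> (\<forall>x\<in>space M. 0 \<le> u x) \<and> (\<exists>B. \<forall>x\<in>space M. u x \<le> B)"

lemma bounded_measurable_powr_integrable:
  assumes "prob_space M" "bounded_measurable M u" "0 \<le> q"
  shows "integrable M (\<lambda>t. u t powr q)"
proof -
  interpret prob_space M by fact
  obtain B where B: "\<forall>x\<in>space M. u x \<le> B" using assms(2) by (auto simp: bounded_measurable_def)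
  have [measurable]: "u \<in> borel_measurable M" using assms(2) by (simp add: bounded_measurable_def)
  show ?thesis
    using B assms(2,3) by (intro integrable_const_bound[of _ "B powr q"] AE_I2)
      (auto simp: bounded_measurable_def intro!: powr_mono2)
qed

lemma Lp_finite_le_iff:
  assumes "prob_space M" "0 < p" "p \<noteq> \<infinity>" "0 \<le> c"
  shows "Lp M p u \<le> c \<longleftrightarrow> (\<integral>t. u t powr enn2real p \<partial>M) \<le> c powr enn2real p"
proof -
  define q where "q = enn2real p"
  have q: "q > 0" using assms(2,3) by (simp add: q_def enn2real_positive_iff less_top)
  have I: "0 \<le> (\<integral>t. u t powr q \<partial>M)" by (rule Bochner_Integration.integral_nonneg) simp
  have "Lp M p u \<le> c \<longleftrightarrow> (\<integral>t. u t powr q \<partial>M) powr (1/q) \<le> c"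
    using assms(3) by (simp add: Lp_def q_def)
  also have "\<dots> \<longleftrightarrow> (\<integral>t. u t powr q \<partial>M) \<le> c powr q"
  proof
    assume "(\<integral>t. u t powr q \<partial>M) powr (1/q) \<le> c"
    then have "((\<integral>t. u t powr q \<partial>M) powr (1/q)) powr q \<le> c powr q"
      using q by (intro powr_mono2) auto
    then show "(\<integral>t. u t powr q \<partial>M) \<le> c powr q"
      using q I by (simp add: powr_powr)
  next
    assume "(\<integral>t. u t powr q \<partial>M) \<le> c powr q"
    then have "(\<integral>t. u t powr q \<partial>M) powr (1/q) \<le> (c powr q) powr (1/q)"
      using q I by (intro powr_mono2) auto
    then show "(\<integral>t. u t powr q \<partial>M) powr (1/q) \<le> c"
      using q assms(4) by (simp add: powr_powr)
  qed
  finally show ?thesis by (simp add: q_def)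
qed

lemma Lp_infinity_le_iff:
  assumes "prob_space M" "bounded_measurable M u"
  shows "Lp M \<infinity> u \<le> c \<longleftrightarrow> (AE t in M. u t \<le> c)"
proof -
  interpret prob_space M by fact
  obtain B where B: "\<forall>x\<in>space M. u x \<le> B" using assms(2) by (auto simp: bounded_measurable_def)
  have [measurable]: "u \<in> borel_measurable M" using assms(2) by (simp add: bounded_measurable_def)
  let ?e = "esssup M (\<lambda>t. ereal (u t))"
  have "?e \<le> ereal B"
    using B by (intro esssup_I) auto
  moreover have "0 \<le> ?e"
  proof -
    have "esssup M (\<lambda>t. 0 :: ereal) \<le> ?e"
      using assms(2) by (intro esssup_AE_mono AE_I2) (auto simp: bounded_measurable_def)
    then show ?thesis by (simp add: esssup_const emeasure_space_1)
  qed
  ultimately obtain v where v: "?e = ereal v" by (cases ?e) auto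
  have "AE t in M. ereal (u t) \<le> ?e" by (rule esssup_AE)
  then have ae: "AE t in M. u t \<le> v" by (simp add: v)
  have "v \<le> c" if "AE t in M. u t \<le> c"
  proof -
    have "?e \<le> ereal c" using that by (intro esssup_I) auto
    then show ?thesis by (simp add: v)
  qed
  moreover have "AE t in M. u t \<le> c" if "v \<le> c"
    using ae that by (auto elim!: eventually_mono)
  ultimately show ?thesis by (auto simp: Lp_def v)
qed

lemma Lp_nonneg:
  assumes "prob_space M" "bounded_measurable M u"
  shows "0 \<le> Lp M p u"
proof (cases "p = \<infinity>")
  case True
  interpret prob_space M by fact
  show ?thesis
  proof (rule ccontr)
    assume "\<not> ?thesis"
    then obtain c where c: "Lp M p u \<le> c" "c < 0" by (auto simp: not_le)
    then have "AE t in M. u t \<le> c" using Lp_infinity_le_iff[OF assms] True by blast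
    then have "AE t in M. False"
      using AE_space
    proof eventually_elim
      case (elim t)
      then show ?case using assms(2) c(2) by (force simp: bounded_measurable_def)
    qed
    then show False by simp
  qed
qed (simp add: Lp_def)

lemma Lp_le_const:
  assumes "prob_space M" "bounded_measurable M u" "0 < p" "0 \<le> c" "\<And>x. x \<in> space M \<Longrightarrow> u x \<le> c"
  shows "Lp M p u \<le> c"
proof (cases "p = \<infinity>")
  case True
  then show ?thesis using Lp_infinity_le_iff[OF assms(1,2)] assms(5) by auto
next
  case False
  interpret prob_space M by fact
  have "(\<integral>t. u t powr enn2real p \<partial>M) \<le> (\<integral>t. c powr enn2real p \<partial>M)"
    using assms by (intro integral_mono bounded_measurable_powr_integrable powr_mono2)
      (auto simp: bounded_measurable_def)
  then show ?thesis using Lp_finite_le_iff[OF assms(1,3) False assms(4)] by (simp add: prob_space)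
qed

text \<open>
  For infinite \<open>p\<close> the factor is 1, because \<open>enn2real\<close> sends
  \<open>\<infinity>\<close> to 0 and \<open>1 / 0 = 0\<close>.
\<close>

lemma Lp_quasi_triangle:
  assumes M: "prob_space M" and bm: "bounded_measurable M u" "bounded_measurable M v" "bounded_measurable M w"
    and p: "0 < p" and D: "0 \<le> D" and le: "\<And>x. x \<in> space M \<Longrightarrow> w x \<le> D * max (u x) (v x)"
  shows "Lp M p w \<le> D * 2 powr (1 / enn2real p) * (Lp M p u + Lp M p v)"
proof (cases "p = \<infinity>")
  case True
  let ?U = "Lp M p u" and ?V = "Lp M p v"
  have nn: "0 \<le> ?U" "0 \<le> ?V" using Lp_nonneg[OF M] bm by auto
  have "AE t in M. u t \<le> ?U" "AE t in M. v t \<le> ?V"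
    using Lp_infinity_le_iff[OF M bm(1), of ?U] Lp_infinity_le_iff[OF M bm(2), of ?V] True by simp_all
  then have "AE t in M. w t \<le> D * (?U + ?V)"
    using AE_space[of M]
  proof eventually_elim
    case (elim t)
    have "w t \<le> D * max (u t) (v t)" using le elim by blast
    also have "\<dots> \<le> D * (?U + ?V)"
      using elim nn D by (intro mult_left_mono) auto
    finally show ?case .
  qed
  then show ?thesis using Lp_infinity_le_iff[OF M bm(3)] True by simp
next
  case False
  define q where "q = enn2real p"
  have q: "q > 0" using p False by (simp add: q_def enn2real_positive_iff less_top)
  let ?U = "Lp M p u" and ?V = "Lp M p v"
  have nn: "0 \<le> ?U" "0 \<le> ?V" using Lp_nonneg[OF M] bm by auto
  have U: "(\<integral>t. u t powr q \<partial>M) \<le> ?U powr q" and V: "(\<integral>t. v t powr q \<partial>M) \<le> ?V powr q"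
    using Lp_finite_le_iff[OF M p False nn(1), of u] Lp_finite_le_iff[OF M p False nn(2), of v] by (simp_all add: q_def)
  note int = bounded_measurable_powr_integrable[OF M _ less_imp_le[OF q]]
  have "(\<integral>t. w t powr q \<partial>M) \<le> (\<integral>t. D powr q * (u t powr q + v t powr q) \<partial>M)"
  proof (rule integral_mono)
    fix t assume t: "t \<in> space M"
    have nn: "0 \<le> u t" "0 \<le> v t" "0 \<le> w t" using bm t by (auto simp: bounded_measurable_def)
    have "w t powr q \<le> (D * max (u t) (v t)) powr q"
      using le[OF t] nn q by (intro powr_mono2) auto
    also have "\<dots> = D powr q * max (u t) (v t) powr q"
      using nn D by (simp add: powr_mult)
    also have "\<dots> \<le> D powr q * (u t powr q + v t powr q)"
      by (intro mult_left_mono) (auto simp: max_def)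
    finally show "w t powr q \<le> D powr q * (u t powr q + v t powr q)" .
  qed (use int bm in auto)
  also have "\<dots> \<le> D powr q * (?U powr q + ?V powr q)"
    using int[OF bm(1)] int[OF bm(2)] U V by (simp add: mult_left_mono add_mono)
  also have "\<dots> \<le> D powr q * (2 * (?U + ?V) powr q)"
  proof -
    have "?U powr q \<le> (?U + ?V) powr q" "?V powr q \<le> (?U + ?V) powr q"
      using nn q by (auto intro!: powr_mono2)
    then show ?thesis by (intro mult_left_mono) auto
  qed
  also have "\<dots> = (D * 2 powr (1/q) * (?U + ?V)) powr q"
    using D nn q by (simp add: powr_mult powr_powr)
  finally show ?thesis
    using Lp_finite_le_iff[OF M p False, of "D * 2 powr (1/q) * (?U + ?V)" w] D nn by (simp add: q_def)
qed

lemma Lp_scale_le: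
  assumes M: "prob_space M" and bm: "bounded_measurable M u" and p: "0 < p" and c: "0 \<le> c"
  shows "Lp M p (\<lambda>t. c * u t) \<le> c * Lp M p u"
proof -
  have nn: "0 \<le> Lp M p u" by (rule Lp_nonneg[OF M bm])
  show ?thesis
  proof (cases "p = \<infinity>")
    case True
    have bm': "bounded_measurable M (\<lambda>t. c * u t)"
    proof -
      obtain B where "\<forall>x\<in>space M. u x \<le> B" using bm by (auto simp: bounded_measurable_def)
      then have "\<forall>x\<in>space M. c * u x \<le> c * B" using c by (auto intro: mult_left_mono)
      moreover have "(\<lambda>t. c * u t) \<in> borel_measurable M"
        using bm by (intro borel_measurable_times borel_measurable_const) (simp add: bounded_measurable_def)
      ultimately show ?thesis using bm c by (auto simp: bounded_measurable_def)
    qed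
    have "AE t in M. u t \<le> Lp M p u"
      using Lp_infinity_le_iff[OF M bm] True by blast
    then have "AE t in M. c * u t \<le> c * Lp M p u"
      by eventually_elim (rule mult_left_mono[OF _ c])
    then show ?thesis using Lp_infinity_le_iff[OF M bm'] True by simp
  next
    case False
    have "(\<integral>t. (c * u t) powr enn2real p \<partial>M) = (\<integral>t. c powr enn2real p * u t powr enn2real p \<partial>M)"
      using bm c by (intro Bochner_Integration.integral_cong) (auto simp: bounded_measurable_def powr_mult)
    also have "\<dots> \<le> c powr enn2real p * Lp M p u powr enn2real p"
      using Lp_finite_le_iff[OF M p False nn, of u] by (simp add: mult_left_mono)
    also have "\<dots> = (c * Lp M p u) powr enn2real p"
      using c nn by (simp add: powr_mult)
    finally show ?thesis
      using Lp_finite_le_iff[OF M p False, of "c * Lp M p u"] c nn by simp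
  qed
qed

lemma Lp_compose:
  assumes \<tau>: "\<tau> \<in> measurable M M" "distr M M \<tau> = M" and u: "u \<in> borel_measurable M"
  shows "Lp M p (\<lambda>t. u (\<tau> t)) = Lp M p u"
proof (cases "p = \<infinity>")
  case True
  have "(AE t in M. ereal (u (\<tau> t)) \<le> z) \<longleftrightarrow> (AE t in M. ereal (u t) \<le> z)" for z
  proof -
    have "{t \<in> space M. ereal (u t) \<le> z} \<in> sets M"
      using borel_measurable_le[OF borel_measurable_ereal[OF u] borel_measurable_const] .
    from AE_distr_iff[OF \<tau>(1) this] show ?thesis
      unfolding \<tau>(2) by simp
  qed
  moreover have "(\<lambda>t. ereal (u (\<tau> t))) \<in> borel_measurable M"
    by (intro borel_measurable_ereal measurable_compose[OF \<tau>(1) u])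
  moreover have "(\<lambda>t. ereal (u t)) \<in> borel_measurable M"
    by (intro borel_measurable_ereal u)
  ultimately have "esssup M (\<lambda>t. ereal (u (\<tau> t))) = esssup M (\<lambda>t. ereal (u t))"
    by (simp add: esssup_eq_AE)
  then show ?thesis using True by (simp add: Lp_def)
next
  case False
  have "(\<integral>t. u t powr enn2real p \<partial>M) = (\<integral>t. u t powr enn2real p \<partial>(distr M M \<tau>))"
    by (subst \<tau>(2)) (rule refl)
  also have "\<dots> = (\<integral>t. u (\<tau> t) powr enn2real p \<partial>M)"
    by (rule integral_distr[OF \<tau>(1)]) (use u in measurable)
  finally show ?thesis using False by (simp add: Lp_def)
qed

text \<open>
  For finite \<open>p\<close>, Fubini's theorem bounds the mean over \<open>y\<close> of the
  \<open>p\<close>-th powers, so some \<open>y\<close> lies below the mean; for infinite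
  \<open>p\<close> the two almost-everywhere quantifiers are exchanged.
\<close>

lemma Lp_section_exchange:
  assumes M: "prob_space M" and N: "prob_space N" and p: "0 < p" and c: "0 \<le> c"
    and u: "(\<lambda>(x, y). u x y) \<in> borel_measurable (M \<Otimes>\<^sub>M N)"
    and bound: "\<And>x y. x \<in> space M \<Longrightarrow> y \<in> space N \<Longrightarrow> 0 \<le> u x y \<and> u x y \<le> B"
    and le: "\<And>x. x \<in> space M \<Longrightarrow> Lp N p (u x) \<le> c"
  shows "\<exists>y\<in>space N. Lp M p (\<lambda>x. u x y) \<le> c"
proof -
  interpret M: prob_space M by fact
  interpret N: prob_space N by fact
  interpret P: pair_prob_space M N ..
  have ux: "bounded_measurable N (u x)" if "x \<in> space M" for x
    using measurable_compose[OF measurable_Pair1'[OF that, of N] u] bound that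
    by (auto simp: bounded_measurable_def)
  have uy: "bounded_measurable M (\<lambda>x. u x y)" if "y \<in> space N" for y
    using measurable_compose[OF measurable_Pair2'[OF that, of M] u] bound that
    by (auto simp: bounded_measurable_def)
  show ?thesis
  proof (cases "p = \<infinity>")
    case True
    have "AE x in M. AE y in N. u x y \<le> c"
    proof (rule AE_I2)
      fix x assume x: "x \<in> space M"
      show "AE y in N. u x y \<le> c"
        using le[OF x] Lp_infinity_le_iff[OF N ux[OF x]] True by simp
    qed
    moreover have "{x \<in> space (M \<Otimes>\<^sub>M N). u (fst x) (snd x) \<le> c} \<in> sets (M \<Otimes>\<^sub>M N)"
      using u by (simp add: case_prod_beta')
    ultimately have "AE y in N. AE x in M. u x y \<le> c"
      using P.AE_commute[of "\<lambda>x y. u x y \<le> c"] by (simp add: space_pair_measure)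
    then have "AE y in N. y \<in> space N \<and> Lp M p (\<lambda>x. u x y) \<le> c"
      using AE_space[of N]
    proof eventually_elim
      case (elim y)
      then show ?case using Lp_infinity_le_iff[OF M uy[of y]] True by simp
    qed
    then have "\<exists>y. y \<in> space N \<and> Lp M p (\<lambda>x. u x y) \<le> c"
      using N.ae_filter_bot by (rule eventually_happens'[rotated])
    then show ?thesis by blast
  next
    case False
    define q where "q = enn2real p"
    have q: "q \<ge> 0" by (simp add: q_def)
    have B: "0 \<le> B" using bound M.not_empty N.not_empty by (meson ex_in_conv order_trans)
    have "integrable (M \<Otimes>\<^sub>M N) (\<lambda>(x, y). u x y powr q)"
    proof -
      have "bounded_measurable (M \<Otimes>\<^sub>M N) (\<lambda>(x, y). u x y)"
        using u bound by (auto simp: bounded_measurable_def space_pair_measure)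
      from bounded_measurable_powr_integrable[OF P.prob_space_axioms this q]
      show ?thesis by (simp add: case_prod_beta')
    qed
    note int = this
    have "(\<integral>y. (\<integral>x. u x y powr q \<partial>M) \<partial>N) = (\<integral>x. (\<integral>y. u x y powr q \<partial>N) \<partial>M)"
      using P.Fubini_integral[OF int] .
    also have "\<dots> \<le> (\<integral>x. c powr q \<partial>M)"
      using P.integrable_fst'[OF int] le Lp_finite_le_iff[OF N p False c]
      by (intro integral_mono) (auto simp: q_def)
    also have "\<dots> = c powr q" by (simp add: M.prob_space)
    finally have le_c: "(\<integral>y. (\<integral>x. u x y powr q \<partial>M) \<partial>N) \<le> c powr q" .
    have "\<exists>y\<in>space N. (\<integral>x. u x y powr q \<partial>M) \<le> c powr q"
    proof (rule ccontr)
      assume "\<not> ?thesis"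
      then have less: "\<forall>y\<in>space N. c powr q < (\<integral>x. u x y powr q \<partial>M)" by auto
      have "(\<integral>y. c powr q \<partial>N) < (\<integral>y. (\<integral>x. u x y powr q \<partial>M) \<partial>N)"
      proof (rule N.integral_less_AE_space)
        show "integrable N (\<lambda>y. \<integral>x. u x y powr q \<partial>M)"
          using P.integrable_snd[OF int] by simp
      qed (use less in \<open>auto simp: N.emeasure_space_1\<close>)
      with le_c show False by (simp add: N.prob_space)
    qed
    then show ?thesis
      using Lp_finite_le_iff[OF M p False c] by (auto simp: q_def)
  qed
qed

section \<open>Bounded coefficient multipliers\<close>

text \<open>
  A vector of \<open>\<complex>\<^sup>n\<close> is a sequence whose entries from
  \<open>n\<close> on are ignored; this keeps one type for all dimensions. The main example maps
  \<open>a\<close> to the quasinorm of \<open>\<Sum>k<n. a\<^sub>k x\<^sub>k\<close> in a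
  quasi-Banach space.
\<close>

definition s_seminorm :: "real \<Rightarrow> nat \<Rightarrow> ((nat \<Rightarrow> complex) \<Rightarrow> real) \<Rightarrow> bool" where
  "s_seminorm s n \<Phi> \<longleftrightarrow>
     (\<forall>a. 0 \<le> \<Phi> a) \<and>
     (\<forall>c a. \<Phi> (\<lambda>k. c * a k) = norm c * \<Phi> a) \<and>
     (\<forall>a b. \<Phi> (\<lambda>k. a k + b k) powr s \<le> \<Phi> a powr s + \<Phi> b powr s) \<and>
     (\<forall>a b. (\<forall>k<n. a k = b k) \<longrightarrow> \<Phi> a = \<Phi> b)"

lemma s_seminormD:
  assumes "s_seminorm s n \<Phi>"
  shows "0 \<le> \<Phi> a" "\<Phi> (\<lambda>k. c * a k) = norm c * \<Phi> a"
    "\<Phi> (\<lambda>k. a k + b k) powr s \<le> \<Phi> a powr s + \<Phi> b powr s"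
    "(\<And>k. k < n \<Longrightarrow> a k = b k) \<Longrightarrow> \<Phi> a = \<Phi> b"
  using assms unfolding s_seminorm_def by blast+

lemma s_seminorm_le_max:
  assumes \<Phi>: "s_seminorm s n \<Phi>" and s: "0 < s"
  shows "\<Phi> (\<lambda>k. a k + b k) \<le> 2 powr (1/s) * max (\<Phi> a) (\<Phi> b)"
proof -
  let ?m = "max (\<Phi> a) (\<Phi> b)"
  have nn: "0 \<le> \<Phi> a" "0 \<le> \<Phi> b" "0 \<le> \<Phi> (\<lambda>k. a k + b k)" using s_seminormD(1)[OF \<Phi>] by blast+
  have "\<Phi> (\<lambda>k. a k + b k) powr s \<le> \<Phi> a powr s + \<Phi> b powr s" by (rule s_seminormD(3)[OF \<Phi>])
  also have "\<dots> \<le> ?m powr s + ?m powr s"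
    using nn s by (intro add_mono powr_mono2) auto
  finally have "(\<Phi> (\<lambda>k. a k + b k) powr s) powr (1/s) \<le> (2 * ?m powr s) powr (1/s)"
    using s by (intro powr_mono2) auto
  then show ?thesis
    using nn s by (simp add: powr_powr powr_mult)
qed

lemma s_seminorm_powr_le_sum:
  assumes \<Phi>: "s_seminorm s n \<Phi>" and s: "0 < s"
  shows "\<Phi> a powr s \<le> (\<Sum>k<n. norm (a k) powr s * \<Phi> (\<lambda>j. if j = k then 1 else 0) powr s)"
proof -
  have "\<Phi> (\<lambda>k. if k < m then a k else 0) powr s
      \<le> (\<Sum>k<m. norm (a k) powr s * \<Phi> (\<lambda>j. if j = k then 1 else 0) powr s)" for m
  proof (induction m)
    case 0
    have "\<Phi> (\<lambda>k. 0 * a k) = 0" by (simp only: s_seminormD(2)[OF \<Phi>]) simp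
    then show ?case by simp
  next
    case (Suc m)
    have "(\<lambda>k. if k < Suc m then a k else 0)
        = (\<lambda>k. (if k < m then a k else 0) + a m * (if k = m then 1 else 0))"
      by (auto simp: fun_eq_iff less_Suc_eq)
    then have "\<Phi> (\<lambda>k. if k < Suc m then a k else 0) powr s
        \<le> \<Phi> (\<lambda>k. if k < m then a k else 0) powr s + \<Phi> (\<lambda>k. a m * (if k = m then 1 else 0)) powr s"
      using s_seminormD(3)[OF \<Phi>, of "\<lambda>k. if k < m then a k else 0" "\<lambda>k. a m * (if k = m then 1 else 0)"] by simp
    also have "\<Phi> (\<lambda>k. a m * (if k = m then 1 else 0)) powr s
        = norm (a m) powr s * \<Phi> (\<lambda>j. if j = m then 1 else 0) powr s"
      using s_seminormD(1)[OF \<Phi>] by (simp add: s_seminormD(2)[OF \<Phi>] powr_mult)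
    finally show ?case using Suc by simp
  qed
  from this[of n] show ?thesis
    using s_seminormD(4)[OF \<Phi>, of "\<lambda>k. if k < n then a k else 0" a] by simp
qed

lemma s_seminorm_bounded:
  assumes \<Phi>: "s_seminorm s n \<Phi>" and s: "0 < s"
  shows "\<exists>B. \<forall>a. (\<forall>k<n. norm (a k) \<le> R) \<longrightarrow> \<Phi> a \<le> B"
proof -
  let ?e = "\<lambda>k. \<Phi> (\<lambda>j. if j = k then 1 else 0) powr s"
  have "\<Phi> a \<le> (\<Sum>k<n. R powr s * ?e k) powr (1/s)" if "\<forall>k<n. norm (a k) \<le> R" for a
  proof -
    have "\<Phi> a powr s \<le> (\<Sum>k<n. norm (a k) powr s * ?e k)"
      by (rule s_seminorm_powr_le_sum[OF \<Phi> s])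
    also have "\<dots> \<le> (\<Sum>k<n. R powr s * ?e k)"
      using that s by (intro sum_mono mult_right_mono powr_mono2) auto
    finally have "(\<Phi> a powr s) powr (1/s) \<le> (\<Sum>k<n. R powr s * ?e k) powr (1/s)"
      using s by (intro powr_mono2) auto
    then show ?thesis using s s_seminormD(1)[OF \<Phi>] by (simp add: powr_powr)
  qed
  then show ?thesis by blast
qed

text \<open>
  By the triangle inequality, the increments of \<open>\<Phi>\<^sup>s\<close> are dominated by
  the \<open>s\<close>-th powers of the coordinate differences.
\<close>

lemma s_seminorm_continuous:
  assumes \<Phi>: "s_seminorm s n \<Phi>" and s: "0 < s"
  shows "continuous_on UNIV \<Phi>"
proof -
  let ?e = "\<lambda>k. \<Phi> (\<lambda>j. if j = k then 1 else 0) powr s"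
  have diff: "\<bar>\<Phi> b powr s - \<Phi> a powr s\<bar> \<le> (\<Sum>k<n. norm (b k - a k) powr s * ?e k)" for a b
  proof -
    have le: "\<Phi> b powr s - \<Phi> a powr s \<le> (\<Sum>k<n. norm (b k - a k) powr s * ?e k)" for a b
      using s_seminormD(3)[OF \<Phi>, of a "\<lambda>k. b k - a k"] s_seminorm_powr_le_sum[OF \<Phi> s, of "\<lambda>k. b k - a k"]
      by simp
    from le[of b a] le[of a b] show ?thesis by (simp add: abs_le_iff norm_minus_commute)
  qed
  have "continuous_on UNIV (\<lambda>b. \<Phi> b powr s)"
    unfolding continuous_on_def
  proof
    fix a :: "nat \<Rightarrow> complex"
    have "continuous_on UNIV (\<lambda>b :: nat \<Rightarrow> complex. \<Sum>k<n. norm (b k - a k) powr s * ?e k)"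
      using s by (intro continuous_on_sum continuous_on_mult continuous_on_const continuous_on_powr'
          continuous_on_norm continuous_on_diff continuous_on_product_coordinates) auto
    then have "((\<lambda>b :: nat \<Rightarrow> complex. \<Sum>k<n. norm (b k - a k) powr s * ?e k) \<longlongrightarrow>
        (\<Sum>k<n. norm (a k - a k) powr s * ?e k)) (at a within UNIV)"
      unfolding continuous_on_def by blast
    then have "((\<lambda>b :: nat \<Rightarrow> complex. \<Sum>k<n. norm (b k - a k) powr s * ?e k) \<longlongrightarrow> 0) (at a within UNIV)"
      by simp
    then have "((\<lambda>b. \<Phi> b powr s - \<Phi> a powr s) \<longlongrightarrow> 0) (at a within UNIV)"
      by (rule Lim_null_comparison[rotated]) (simp add: diff)
    then show "((\<lambda>b. \<Phi> b powr s) \<longlongrightarrow> \<Phi> a powr s) (at a within UNIV)"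
      by (rule LIM_zero_cancel)
  qed
  then have "continuous_on UNIV (\<lambda>b. (\<Phi> b powr s) powr (1/s))"
    using s by (rule_tac continuous_on_powr'[OF _ continuous_on_const]) auto
  moreover have "(\<Phi> b powr s) powr (1/s) = \<Phi> b" for b
    using s s_seminormD(1)[OF \<Phi>] by (simp add: powr_powr)
  ultimately show ?thesis by simp
qed

lemma s_seminorm_bounded_measurable:
  assumes \<Phi>: "s_seminorm s n \<Phi>" and s: "0 < s"
    and meas: "\<And>k. k < n \<Longrightarrow> (\<lambda>x. h x k) \<in> borel_measurable M"
    and bound: "\<And>k x. k < n \<Longrightarrow> x \<in> space M \<Longrightarrow> norm (h x k) \<le> R"
  shows "bounded_measurable M (\<lambda>x. \<Phi> (h x))"
proof -
  have "(\<lambda>x k. if k < n then h x k else 0) \<in> borel_measurable M"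
  proof (rule measurable_coordinatewise_then_product)
    show "(\<lambda>x. if k < n then h x k else 0) \<in> borel_measurable M" for k
      using meas[of k] by (cases "k < n") auto
  qed
  moreover have "\<Phi> \<in> borel_measurable borel"
    by (rule borel_measurable_continuous_onI[OF s_seminorm_continuous[OF \<Phi> s]])
  ultimately have "(\<lambda>x. \<Phi> (\<lambda>k. if k < n then h x k else 0)) \<in> borel_measurable M"
    by (rule measurable_compose)
  moreover have "\<Phi> (\<lambda>k. if k < n then h x k else 0) = \<Phi> (h x)" for x
    by (rule s_seminormD(4)[OF \<Phi>]) simp
  ultimately have "(\<lambda>x. \<Phi> (h x)) \<in> borel_measurable M" by simp
  moreover obtain B where "\<forall>a. (\<forall>k<n. norm (a k) \<le> R) \<longrightarrow> \<Phi> a \<le> B"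
    using s_seminorm_bounded[OF \<Phi> s] by blast
  ultimately show ?thesis
    using bound s_seminormD(1)[OF \<Phi>] unfolding bounded_measurable_def by blast
qed

text \<open>
  Let \<open>K\<close> be the supremum of \<open>W (f a)\<close> over multipliers
  \<open>f\<close> bounded by 1. Up to an error of size \<open>1 / (2 \<kappa>)\<close>, a
  multiplier is a short combination of the multipliers \<open>\<lambda>k. e k g\<close>, which
  do not increase \<open>W\<close>. The error contributes at most \<open>K / 2\<close> and is
  absorbed on the left-hand side. The resulting constant depends on \<open>\<kappa>\<close> and
  \<open>N\<close> only, not on the dimension \<open>n\<close>.
\<close>

lemma multiplier_absorption:
  fixes W :: "(nat \<Rightarrow> complex) \<Rightarrow> real" and e :: "nat \<Rightarrow> 'g \<Rightarrow> complex"
  assumes nonneg: "\<And>a. 0 \<le> W a" and scale: "\<And>c a. W (\<lambda>k. c * a k) \<le> norm c * W a"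
    and add: "\<And>a b. W (\<lambda>k. a k + b k) \<le> \<kappa> * (W a + W b)" and \<kappa>: "1 \<le> \<kappa>"
    and local: "\<And>a b. (\<And>k. k < n \<Longrightarrow> a k = b k) \<Longrightarrow> W a = W b"
    and inv: "\<And>g a. W (\<lambda>k. e k g * a k) \<le> W a"
    and bounded: "\<And>a. \<exists>B. \<forall>f. (\<forall>k<n. norm (f k) \<le> 1) \<longrightarrow> W (\<lambda>k. f k * a k) \<le> B"
    and approx: "\<And>f. (\<forall>\<gamma>\<in>E. norm (f \<gamma>) \<le> 1) \<Longrightarrow>
        \<exists>L :: 'g atoms. short_sum N L \<and> close_on E (1 / (2 * \<kappa>)) f L"
    and e: "inj_on e {..<n}" "e ` {..<n} \<subseteq> E"
    and f: "\<And>k. k < n \<Longrightarrow> norm (f k) \<le> 1"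
  shows "W (\<lambda>k. f k * a k) \<le> 2 * \<kappa> * (\<kappa> ^ N * (real N * real N)) * W a"
proof -
  define C where "C = \<kappa> ^ N * (real N * real N)"
  have poly: "W (\<lambda>k. trig_sum L (e k) * a k) \<le> \<kappa> ^ length L * (\<Sum>(c, g)\<leftarrow>L. norm c) * W a"
    for L :: "'g atoms"
  proof (induction L)
    case Nil
    show ?case using scale[of 0 a] by simp
  next
    case (Cons l L)
    obtain c g where l: "l = (c, g)" by fastforce
    have nn: "0 \<le> (\<Sum>(c, g)\<leftarrow>L. norm c)" by (intro sum_list_nonneg) auto
    have "W (\<lambda>k. trig_sum (l # L) (e k) * a k) = W (\<lambda>k. c * (e k g * a k) + trig_sum L (e k) * a k)"
      by (simp add: l algebra_simps)
    also have "\<dots> \<le> \<kappa> * (W (\<lambda>k. c * (e k g * a k)) + W (\<lambda>k. trig_sum L (e k) * a k))"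
      by (rule add)
    also have "\<dots> \<le> \<kappa> * (norm c * W a + \<kappa> ^ length L * (\<Sum>(c, g)\<leftarrow>L. norm c) * W a)"
    proof (intro mult_left_mono add_mono Cons)
      show "W (\<lambda>k. c * (e k g * a k)) \<le> norm c * W a"
        using order_trans[OF scale mult_left_mono[OF inv]] by simp
    qed (use \<kappa> in simp)
    also have "\<dots> \<le> \<kappa> * (\<kappa> ^ length L * norm c * W a + \<kappa> ^ length L * (\<Sum>(c, g)\<leftarrow>L. norm c) * W a)"
    proof -
      have "1 * (norm c * W a) \<le> \<kappa> ^ length L * (norm c * W a)"
        using \<kappa> nonneg by (intro mult_right_mono one_le_power) auto
      then show ?thesis using \<kappa> by (intro mult_left_mono add_right_mono) (auto simp: mult.assoc)
    qed
    finally show ?case by (simp add: l algebra_simps)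
  qed
  define S where "S = {W (\<lambda>k. f k * a k) | f. \<forall>k<n. norm (f k) \<le> 1}"
  define K where "K = Sup S"
  obtain B where "\<forall>f. (\<forall>k<n. norm (f k) \<le> 1) \<longrightarrow> W (\<lambda>k. f k * a k) \<le> B" using bounded by blast
  then have bdd: "bdd_above S" by (auto simp: S_def bdd_above_def)
  have upper: "W (\<lambda>k. f k * a k) \<le> K" if "\<forall>k<n. norm (f k) \<le> 1" for f
    unfolding K_def using that by (intro cSup_upper bdd) (auto simp: S_def)
  have step: "W (\<lambda>k. f k * a k) \<le> \<kappa> * (C * W a) + K / 2" if f: "\<forall>k<n. norm (f k) \<le> 1" for f
  proof -
    define F where "F = (\<lambda>\<gamma>. if \<gamma> \<in> e ` {..<n} then f (the_inv_into {..<n} e \<gamma>) else 0)"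
    have Fe: "F (e k) = f k" if "k < n" for k
      using that by (simp add: F_def the_inv_into_f_f[OF e(1)])
    have "\<forall>\<gamma>\<in>E. norm (F \<gamma>) \<le> 1"
    proof
      fix \<gamma>
      show "norm (F \<gamma>) \<le> 1"
      proof (cases "\<gamma> \<in> e ` {..<n}")
        case True
        then obtain k where "k < n" "\<gamma> = e k" by auto
        then show ?thesis using Fe f by simp
      qed (simp add: F_def)
    qed
    then obtain L :: "'g atoms" where L: "short_sum N L" "close_on E (1 / (2 * \<kappa>)) F L"
      using approx by blast
    define h where "h = (\<lambda>k. 2 * of_real \<kappa> * (f k - trig_sum L (e k)))"
    have h: "\<forall>k<n. norm (h k) \<le> 1"
    proof (intro allI impI)
      fix k assume k: "k < n"
      then have "norm (f k - trig_sum L (e k)) \<le> 1 / (2 * \<kappa>)"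
        using L(2) e(2) Fe[OF k] by force
      then have "2 * \<kappa> * norm (f k - trig_sum L (e k)) \<le> 2 * \<kappa> * (1 / (2 * \<kappa>))"
        using \<kappa> by (intro mult_left_mono) auto
      moreover have "norm (h k) = 2 * \<kappa> * norm (f k - trig_sum L (e k))"
        unfolding h_def norm_mult using \<kappa> by simp
      ultimately show "norm (h k) \<le> 1" using \<kappa> by simp
    qed
    have "W (\<lambda>k. f k * a k) = W (\<lambda>k. trig_sum L (e k) * a k + of_real (1 / (2 * \<kappa>)) * (h k * a k))"
    proof (rule local)
      fix k
      show "f k * a k = trig_sum L (e k) * a k + of_real (1 / (2 * \<kappa>)) * (h k * a k)"
        using \<kappa> by (simp add: h_def field_simps)
    qed
    also have "\<dots> \<le> \<kappa> * (W (\<lambda>k. trig_sum L (e k) * a k) + W (\<lambda>k. of_real (1 / (2 * \<kappa>)) * (h k * a k)))"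
      by (rule add)
    also have "\<dots> \<le> \<kappa> * (C * W a + 1 / (2 * \<kappa>) * K)"
    proof (intro mult_left_mono add_mono)
      have sum_le: "(\<Sum>(c, g)\<leftarrow>L. norm c) \<le> real N * real N"
      proof -
        have "(\<Sum>(c, g)\<leftarrow>L. norm c) \<le> real (length L) * real N"
          if "\<forall>(c, g)\<in>set L. norm c \<le> real N" for L :: "'g atoms"
          using that by (induction L) (auto simp: algebra_simps)
        moreover have "real (length L) * real N \<le> real N * real N"
          using L(1) by (intro mult_right_mono) (auto simp: short_sum_def)
        ultimately show ?thesis using L(1) unfolding short_sum_def by force
      qed
      have "\<kappa> ^ length L * (\<Sum>(c, g)\<leftarrow>L. norm c) \<le> C"
        unfolding C_def using L(1) \<kappa> sum_le
        by (intro mult_mono power_increasing) (auto simp: short_sum_def intro!: sum_list_nonneg)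
      then show "W (\<lambda>k. trig_sum L (e k) * a k) \<le> C * W a"
        using order_trans[OF poly mult_right_mono] nonneg by blast
      have "W (\<lambda>k. of_real (1 / (2 * \<kappa>)) * (h k * a k)) \<le> norm (complex_of_real (1 / (2 * \<kappa>))) * W (\<lambda>k. h k * a k)"
        by (rule scale)
      also have "\<dots> = 1 / (2 * \<kappa>) * W (\<lambda>k. h k * a k)"
        using \<kappa> by (simp only: norm_of_real) simp
      also have "\<dots> \<le> 1 / (2 * \<kappa>) * K"
        using \<kappa> upper[OF h] by (intro mult_left_mono) auto
      finally show "W (\<lambda>k. of_real (1 / (2 * \<kappa>)) * (h k * a k)) \<le> 1 / (2 * \<kappa>) * K" .
    qed (use \<kappa> in simp)
    also have "\<dots> = \<kappa> * (C * W a) + K / 2" using \<kappa> by (simp add: field_simps)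
    finally show ?thesis .
  qed
  have "S \<noteq> {}" unfolding S_def using norm_zero by (auto intro!: exI[of _ "\<lambda>_. 0"])
  then have "K \<le> \<kappa> * (C * W a) + K / 2"
    unfolding K_def[of] using step by (intro cSup_least) (auto simp: S_def K_def)
  then have "K \<le> 2 * \<kappa> * C * W a" by simp
  then show ?thesis using upper[of f] f unfolding C_def by auto
qed

lemma norm_le_sum_norm: "k < n \<Longrightarrow> norm (a k) \<le> (\<Sum>j<n. norm (a j))" for k n :: nat
  by (intro member_le_sum) auto

definition multiplier_bound ::
    "'t measure \<Rightarrow> ennreal \<Rightarrow> ((nat \<Rightarrow> complex) \<Rightarrow> real) \<Rightarrow> nat \<Rightarrow> ('t \<Rightarrow> nat \<Rightarrow> complex) \<Rightarrow> real \<Rightarrow> bool" where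
  "multiplier_bound M p \<Phi> n h C \<longleftrightarrow>
     (\<forall>a f. (\<forall>k<n. norm (f k) \<le> 1) \<longrightarrow>
        Lp M p (\<lambda>x. \<Phi> (\<lambda>k. f k * (a k * h x k))) \<le> C * Lp M p (\<lambda>x. \<Phi> (\<lambda>k. a k * h x k)))"

text \<open>
  Composition with the measure preserving map \<open>\<tau> g\<close> leaves the
  \<open>L\<^sub>p\<close> quasinorm unchanged, and multiplies the \<open>k\<close>-th
  coefficient by \<open>e k g\<close>. It serves both the translations of \<open>G\<close> and
  those of the Cantor group.
\<close>

lemma multiplier_bound_of_invariance:
  fixes e :: "nat \<Rightarrow> 'g \<Rightarrow> complex"
  assumes M: "prob_space M" and p: "0 < p" and \<Phi>: "s_seminorm s n \<Phi>" and s: "0 < s"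
    and meas: "\<And>k. k < n \<Longrightarrow> (\<lambda>x. h x k) \<in> borel_measurable M"
    and bound: "\<And>k x. k < n \<Longrightarrow> x \<in> space M \<Longrightarrow> norm (h x k) \<le> 1"
    and \<tau>: "\<And>g. \<tau> g \<in> measurable M M" "\<And>g. distr M M (\<tau> g) = M"
    and h\<tau>: "\<And>g x k. k < n \<Longrightarrow> h (\<tau> g x) k = e k g * h x k"
    and \<kappa>: "\<kappa> = 2 powr (1/s) * 2 powr (1 / enn2real p)"
    and approx: "\<And>f. (\<forall>\<gamma>\<in>E. norm (f \<gamma>) \<le> 1) \<Longrightarrow>
        \<exists>L :: 'g atoms. short_sum N L \<and> close_on E (1 / (2 * \<kappa>)) f L"
    and e: "inj_on e {..<n}" "e ` {..<n} \<subseteq> E"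
  shows "multiplier_bound M p \<Phi> n h (2 * \<kappa> * (\<kappa> ^ N * (real N * real N)))"
proof -
  have bm: "bounded_measurable M (\<lambda>x. \<Phi> (\<lambda>k. a k * h x k))" for a
  proof (rule s_seminorm_bounded_measurable[OF \<Phi> s])
    show "(\<lambda>x. a k * h x k) \<in> borel_measurable M" if "k < n" for k
      by (intro borel_measurable_times borel_measurable_const meas that)
    show "norm (a k * h x k) \<le> (\<Sum>j<n. norm (a j))" if "k < n" "x \<in> space M" for k x
    proof -
      have "norm (a k * h x k) \<le> norm (a k) * 1"
        unfolding norm_mult using bound[OF that] by (intro mult_left_mono) auto
      also have "\<dots> \<le> (\<Sum>j<n. norm (a j))"
        using norm_le_sum_norm[OF that(1)] by simp
      finally show ?thesis .
    qed
  qed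
  define W where "W = (\<lambda>a. Lp M p (\<lambda>x. \<Phi> (\<lambda>k. a k * h x k)))"
  have "W (\<lambda>k. f k * a k) \<le> 2 * \<kappa> * (\<kappa> ^ N * (real N * real N)) * W a"
    if f: "\<And>k. k < n \<Longrightarrow> norm (f k) \<le> 1" for f a
  proof (rule multiplier_absorption[where W = W and \<kappa> = \<kappa> and n = n and e = e and E = E and N = N and f = f and a = a,
        OF _ _ _ _ _ _ _ approx e f])
    show "0 \<le> W a" for a unfolding W_def by (rule Lp_nonneg[OF M bm])
    show "W (\<lambda>k. c * a k) \<le> norm c * W a" for c a
      using Lp_scale_le[OF M bm p norm_ge_zero, of c a]
      by (simp add: W_def mult.assoc s_seminormD(2)[OF \<Phi>])
    show "W (\<lambda>k. a k + b k) \<le> \<kappa> * (W a + W b)" for a b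
      unfolding W_def \<kappa>
    proof (rule Lp_quasi_triangle[OF M bm bm bm p])
      show "\<Phi> (\<lambda>k. (a k + b k) * h x k)
          \<le> 2 powr (1/s) * max (\<Phi> (\<lambda>k. a k * h x k)) (\<Phi> (\<lambda>k. b k * h x k))" for x
        unfolding distrib_right by (rule s_seminorm_le_max[OF \<Phi> s])
    qed simp
    show "1 \<le> \<kappa>"
    proof -
      have "1 \<le> (2 :: real) powr (1/s)" "1 \<le> (2 :: real) powr (1 / enn2real p)"
        using s by (auto intro!: ge_one_powr_ge_zero)
      from mult_mono[OF this] show ?thesis by (simp add: \<kappa>)
    qed
    show "W a = W b" if "\<And>k. k < n \<Longrightarrow> a k = b k" for a b
    proof -
      have "\<Phi> (\<lambda>k. a k * h x k) = \<Phi> (\<lambda>k. b k * h x k)" for x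
        by (rule s_seminormD(4)[OF \<Phi>]) (simp add: that)
      then show ?thesis by (simp add: W_def)
    qed
    show "W (\<lambda>k. e k g * a k) \<le> W a" for g a
    proof -
      have "\<Phi> (\<lambda>k. e k g * a k * h x k) = \<Phi> (\<lambda>k. a k * h (\<tau> g x) k)" for x
        by (rule s_seminormD(4)[OF \<Phi>]) (simp add: h\<tau>)
      then have "W (\<lambda>k. e k g * a k) = Lp M p (\<lambda>x. \<Phi> (\<lambda>k. a k * h (\<tau> g x) k))"
        by (simp add: W_def)
      also have "\<dots> = W a"
        unfolding W_def using bm[of a] by (intro Lp_compose[OF \<tau>]) (simp add: bounded_measurable_def)
      finally show ?thesis by simp
    qed
    show "\<exists>B. \<forall>f. (\<forall>k<n. norm (f k) \<le> 1) \<longrightarrow> W (\<lambda>k. f k * a k) \<le> B" for a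
    proof -
      define R where "R = (\<Sum>j<n. norm (a j))"
      obtain B where B: "\<forall>a. (\<forall>k<n. norm (a k) \<le> R) \<longrightarrow> \<Phi> a \<le> B"
        using s_seminorm_bounded[OF \<Phi> s] by blast
      have W_le: "W (\<lambda>k. f k * a k) \<le> max 0 B" if f: "\<forall>k<n. norm (f k) \<le> 1" for f
        unfolding W_def
      proof (rule Lp_le_const[OF M bm p])
        fix x assume x: "x \<in> space M"
        have "norm (f k * a k * h x k) \<le> R" if k: "k < n" for k
        proof -
          have "norm (f k * a k * h x k) \<le> 1 * norm (a k) * 1"
            unfolding norm_mult using f bound[OF k x] k by (intro mult_mono) auto
          also have "\<dots> \<le> R" unfolding R_def using norm_le_sum_norm[OF k] by simp
          finally show ?thesis .
        qed
        then have "\<Phi> (\<lambda>k. f k * a k * h x k) \<le> B"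
          by (intro B[rule_format])
        then show "\<Phi> (\<lambda>k. f k * a k * h x k) \<le> max 0 B" by simp
      qed simp
      show ?thesis
      proof (intro exI allI impI)
        fix f :: "nat \<Rightarrow> complex" assume "\<forall>k<n. norm (f k) \<le> 1"
        then show "W (\<lambda>k. f k * a k) \<le> max 0 B" by (rule W_le)
      qed
    qed
  qed
  then show ?thesis
    unfolding multiplier_bound_def W_def by (simp add: mult.assoc)
qed

text \<open>
  Consider the vectors with entries \<open>h x k * h' y k\<close>. For fixed \<open>x\<close>,
  the entries \<open>h x k\<close> are a bounded multiplier, so the quasinorm in
  \<open>y\<close> is controlled by that of \<open>h'\<close>. Exchanging the variables yields
  one \<open>y\<close> for which the quasinorm in \<open>x\<close> is controlled as well; the
  unimodular multiplier \<open>h' y\<close> is then removed at the cost of a second factor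
  \<open>C\<close>.
\<close>

lemma multiplier_bound_comparison:
  assumes M: "prob_space M" and N: "prob_space N" and p: "0 < p" and \<Phi>: "s_seminorm s n \<Phi>" and s: "0 < s"
    and meas: "\<And>k. k < n \<Longrightarrow> (\<lambda>x. h x k) \<in> borel_measurable M" "\<And>k. k < n \<Longrightarrow> (\<lambda>y. h' y k) \<in> borel_measurable N"
    and unit: "\<And>k x. k < n \<Longrightarrow> x \<in> space M \<Longrightarrow> norm (h x k) = 1" "\<And>k y. k < n \<Longrightarrow> y \<in> space N \<Longrightarrow> norm (h' y k) = 1"
    and mb: "multiplier_bound M p \<Phi> n h C" "multiplier_bound N p \<Phi> n h' C" and C: "0 \<le> C"
  shows "Lp M p (\<lambda>x. \<Phi> (h x)) \<le> C * C * Lp N p (\<lambda>y. \<Phi> (h' y))"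
proof -
  define c where "c = Lp N p (\<lambda>y. \<Phi> (h' y))"
  have "bounded_measurable N (\<lambda>y. \<Phi> (h' y))"
    by (rule s_seminorm_bounded_measurable[OF \<Phi> s meas(2), where R = 1]) (simp_all add: unit)
  then have c: "0 \<le> c" unfolding c_def by (rule Lp_nonneg[OF N])
  have pair: "bounded_measurable (M \<Otimes>\<^sub>M N) (\<lambda>z. \<Phi> (\<lambda>k. h (fst z) k * h' (snd z) k))"
  proof (rule s_seminorm_bounded_measurable[OF \<Phi> s])
    show "(\<lambda>z. h (fst z) k * h' (snd z) k) \<in> borel_measurable (M \<Otimes>\<^sub>M N)" if "k < n" for k
      by (intro borel_measurable_times measurable_compose[OF measurable_fst meas(1)]
          measurable_compose[OF measurable_snd meas(2)] that)
    show "norm (h (fst z) k * h' (snd z) k) \<le> 1" if "k < n" "z \<in> space (M \<Otimes>\<^sub>M N)" for k z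
      using that by (auto simp: norm_mult space_pair_measure unit)
  qed
  then obtain B where B: "\<forall>z\<in>space (M \<Otimes>\<^sub>M N). \<Phi> (\<lambda>k. h (fst z) k * h' (snd z) k) \<le> B"
    by (auto simp: bounded_measurable_def)
  have "\<exists>y\<in>space N. Lp M p (\<lambda>x. \<Phi> (\<lambda>k. h x k * h' y k)) \<le> C * c"
  proof (rule Lp_section_exchange[OF M N p])
    show "0 \<le> C * c" using c C by simp
    show "(\<lambda>(x, y). \<Phi> (\<lambda>k. h x k * h' y k)) \<in> borel_measurable (M \<Otimes>\<^sub>M N)"
      using pair by (simp add: bounded_measurable_def case_prod_beta')
    show "0 \<le> \<Phi> (\<lambda>k. h x k * h' y k) \<and> \<Phi> (\<lambda>k. h x k * h' y k) \<le> B"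
      if "x \<in> space M" "y \<in> space N" for x y
      using B that s_seminormD(1)[OF \<Phi>] by (force simp: space_pair_measure)
    show "Lp N p (\<lambda>y. \<Phi> (\<lambda>k. h x k * h' y k)) \<le> C * c" if "x \<in> space M" for x
      using mb(2)[unfolded multiplier_bound_def, rule_format, of "h x" "\<lambda>_. 1"] unit(1)[OF _ that]
      by (simp add: c_def)
  qed
  then obtain y where y: "y \<in> space N" "Lp M p (\<lambda>x. \<Phi> (\<lambda>k. h x k * h' y k)) \<le> C * c" by blast
  have "\<Phi> (h x) = \<Phi> (\<lambda>k. cnj (h' y k) * (h' y k * h x k))" for x
  proof (rule s_seminormD(4)[OF \<Phi>])
    fix k assume "k < n"
    then have "cnj (h' y k) * h' y k = 1"
      using unit(2)[OF _ y(1)] by (simp add: complex_norm_square[symmetric] mult.commute[of "cnj _"])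
    then show "h x k = cnj (h' y k) * (h' y k * h x k)" by (simp flip: mult.assoc)
  qed
  then have "Lp M p (\<lambda>x. \<Phi> (h x)) = Lp M p (\<lambda>x. \<Phi> (\<lambda>k. cnj (h' y k) * (h' y k * h x k)))" by simp
  also have "\<dots> \<le> C * Lp M p (\<lambda>x. \<Phi> (\<lambda>k. h' y k * h x k))"
    using mb(1)[unfolded multiplier_bound_def, rule_format, of "\<lambda>k. cnj (h' y k)" "h' y"] unit(2)[OF _ y(1)] by simp
  also have "\<dots> \<le> C * (C * c)"
    using y(2) C by (intro mult_left_mono) (simp_all add: mult.commute)
  finally show ?thesis by (simp add: c_def mult.assoc)
qed

text \<open>
  The coordinate functions of the Cantor group, extended to all sequences in such a way that
  every sequence defines a sequence of signs.
\<close>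

definition sign_coord :: "nat \<Rightarrow> (nat \<Rightarrow> complex) \<Rightarrow> complex" where
  "sign_coord k t = (if t k = 1 then 1 else -1)"

lemma inj_sign_coord: "inj sign_coord"
proof (rule injI)
  fix j k assume eq: "sign_coord j = sign_coord k"
  show "j = k"
  proof (rule ccontr)
    assume "j \<noteq> k"
    then show False
      using fun_cong[OF eq, of "\<lambda>i. if i = j then 1 else 0"] by (simp add: sign_coord_def)
  qed
qed

text \<open>
  A choice of signs on the coordinate functions is itself a point of the Cantor group, so one
  atom suffices.
\<close>

lemma signs_approximable_sign_coord: "signs_approximable (range sign_coord)"
  unfolding signs_approximable_def
proof (intro exI[of _ 1] allI impI)
  fix f :: "((nat \<Rightarrow> complex) \<Rightarrow> complex) \<Rightarrow> complex"
  assume f: "\<forall>\<gamma>\<in>range sign_coord. f \<gamma> \<in> {1, -1}"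
  let ?t = "\<lambda>k. f (sign_coord k)"
  have eq: "f (sign_coord k) = sign_coord k ?t" for k
  proof -
    have "f (sign_coord k) \<in> {1, -1}" using f by blast
    then show ?thesis by (auto simp: sign_coord_def)
  qed
  have "norm (f \<gamma> - trig_sum [(1, ?t)] \<gamma>) \<le> 1 / 8" if "\<gamma> \<in> range sign_coord" for \<gamma>
    using that by (elim rangeE) (simp flip: eq)
  moreover have "short_sum 1 [(1, ?t)]" by (simp add: short_sum_def)
  ultimately show "\<exists>L. short_sum 1 L \<and> (\<forall>\<gamma>\<in>range sign_coord. norm (f \<gamma> - trig_sum L \<gamma>) \<le> 1 / 8)"
    by blast
qed

lemma cantor_coord_measurable: "(\<lambda>t. t k) \<in> borel_measurable cantor_haar"
proof -
  have "(\<lambda>t. t k) \<in> measurable cantor_haar (uniform_count_measure {1, -1})"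
    unfolding cantor_haar_def by (rule measurable_component_singleton) simp
  moreover have "(\<lambda>z. z) \<in> borel_measurable (uniform_count_measure {1, -1 :: complex})"
    by (auto simp: measurable_def space_uniform_count_measure sets_uniform_count_measure)
  ultimately show ?thesis by (rule measurable_compose)
qed

lemma cantor_translation_measurable:
  assumes s: "s \<in> UNIV \<rightarrow> {1, -1}"
  shows "(\<lambda>t k. s k * t k) \<in> measurable cantor_haar cantor_haar"
  unfolding cantor_haar_def
proof (rule measurable_PiM_single')
  fix k
  have sk: "s k = 1 \<or> s k = -1" using s by auto
  have "(\<lambda>t. t k) \<in> measurable (Pi\<^sub>M UNIV (\<lambda>_. uniform_count_measure {1, -1 :: complex})) (uniform_count_measure {1, -1})"
    by (rule measurable_component_singleton) simp
  moreover have "(\<lambda>z. s k * z) \<in> measurable (uniform_count_measure {1, -1}) (uniform_count_measure {1, -1})"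
    using sk by (auto simp: measurable_def space_uniform_count_measure sets_uniform_count_measure)
  ultimately show "(\<lambda>t. s k * t k) \<in> measurable (Pi\<^sub>M UNIV (\<lambda>_. uniform_count_measure {1, -1})) (uniform_count_measure {1, -1})"
    by (rule measurable_compose)
next
  have sk: "s k = 1 \<or> s k = -1" for k using s by auto
  have "s k * t k \<in> {1, -1}" if "t k \<in> {1, -1}" for t k
    using sk[of k] that by auto
  then show "(\<lambda>t k. s k * t k) \<in> space (Pi\<^sub>M UNIV (\<lambda>_. uniform_count_measure {1, -1})) \<rightarrow> (\<Pi>\<^sub>E k\<in>UNIV. space (uniform_count_measure {1, -1}))"
    by (force simp: space_PiM space_uniform_count_measure PiE_UNIV_domain Pi_iff)
qed

lemma cantor_coord_unimodular: "t \<in> space cantor_haar \<Longrightarrow> norm (t k) = 1"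
  using Pi_mem[of t UNIV "\<lambda>_. {1, -1}" k] by (auto simp: space_cantor_haar)

text \<open>
  Translations of \<open>G\<close> multiply the coefficient of \<open>\<gamma> k\<close> by
  \<open>\<gamma> k g\<close>, translations of the Cantor group multiply those of the
  coordinates by signs. Both systems of functions therefore have bounded multipliers, and are
  comparable with each other.
\<close>

theorem s_seminorm_comparison:
  fixes E :: "('g::topological_ab_group_add \<Rightarrow> complex) set"
  assumes haar: "normalized_haar_measure (\<mu> :: 'g measure)"
    and E: "E \<subseteq> Collect character" and ua: "uniformly_approximable E"
    and s: "0 < s" and p: "0 < p"
  shows "\<exists>C>0. \<forall>n \<gamma> \<Phi>. inj_on \<gamma> {..<n} \<longrightarrow> \<gamma> ` {..<n} \<subseteq> E \<longrightarrow> s_seminorm s n \<Phi> \<longrightarrow>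
     Lp cantor_haar p \<Phi> \<le> C * Lp \<mu> p (\<lambda>g. \<Phi> (\<lambda>k. \<gamma> k g)) \<and>
     Lp \<mu> p (\<lambda>g. \<Phi> (\<lambda>k. \<gamma> k g)) \<le> C * Lp cantor_haar p \<Phi>"
proof -
  define \<kappa> where "\<kappa> = 2 powr (1/s) * 2 powr (1 / enn2real p)"
  have \<kappa>: "0 < \<kappa>" by (simp add: \<kappa>_def)
  then have "0 < 1 / (2 * \<kappa>)" by simp
  then obtain N where N: "\<And>f. (\<forall>\<gamma>\<in>E. norm (f \<gamma>) \<le> 1) \<Longrightarrow>
    \<exists>L :: 'g atoms. short_sum N L \<and> close_on E (1 / (2 * \<kappa>)) f L"
    using ua unfolding uniformly_approximable_def by blast
  obtain N' where N': "\<And>f. (\<forall>\<gamma>\<in>range sign_coord. norm (f \<gamma>) \<le> 1) \<Longrightarrow>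
    \<exists>L :: (nat \<Rightarrow> complex) atoms. short_sum N' L \<and>
      (\<forall>\<gamma>\<in>range sign_coord. norm (f \<gamma> - trig_sum L \<gamma>) \<le> 1 / (2 * \<kappa>))"
    using signs_approximable_imp_uniformly[OF signs_approximable_sign_coord] \<open>0 < 1 / (2 * \<kappa>)\<close>
    unfolding uniformly_approximable_def by blast
  define A where "A = 2 * \<kappa> * (\<kappa> ^ N * (real N * real N))"
  define B where "B = 2 * \<kappa> * (\<kappa> ^ N' * (real N' * real N'))"
  define C where "C = A + B + 1"
  have AB: "0 \<le> A" "0 \<le> B" using \<kappa> by (simp_all add: A_def B_def)
  have C: "0 < C" "A \<le> C" "B \<le> C" using AB by (simp_all add: C_def)
  have mono: "multiplier_bound M p \<Phi> n h C"
    if mb: "multiplier_bound M p \<Phi> n h c" and "c \<le> C" and nn: "\<And>a. 0 \<le> Lp M p (\<lambda>x. \<Phi> (\<lambda>k. a k * h x k))"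
    for M :: "'t measure" and \<Phi> n h c
    using mb mult_right_mono[OF \<open>c \<le> C\<close> nn] unfolding multiplier_bound_def by (meson order_trans)
  have "Lp cantor_haar p \<Phi> \<le> C * C * Lp \<mu> p (\<lambda>g. \<Phi> (\<lambda>k. \<gamma> k g)) \<and>
      Lp \<mu> p (\<lambda>g. \<Phi> (\<lambda>k. \<gamma> k g)) \<le> C * C * Lp cantor_haar p \<Phi>"
    if \<gamma>: "inj_on \<gamma> {..<n}" "\<gamma> ` {..<n} \<subseteq> E" and \<Phi>: "s_seminorm s n \<Phi>" for n \<gamma> \<Phi>
  proof -
    have ch: "character (\<gamma> k)" if "k < n" for k using \<gamma>(2) E that by auto
    have M: "prob_space \<mu>" by (rule haar_prob_space[OF haar])
    note D = prob_space_cantor_haar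
    have meas: "(\<lambda>g. \<gamma> k g) \<in> borel_measurable \<mu>" if "k < n" for k
      using ch[OF that] by (intro haar_borel_measurable[OF haar]) (simp add: character_def)
    have unit: "norm (\<gamma> k g) = 1" if "k < n" for k g using ch[OF that] by (simp add: character_def)
    have "multiplier_bound \<mu> p \<Phi> n (\<lambda>g k. \<gamma> k g) A"
      unfolding A_def
    proof (rule multiplier_bound_of_invariance[where \<tau> = "(+)" and e = \<gamma> and E = E, OF M p \<Phi> s meas _ _ _ _ \<kappa>_def N \<gamma>])
      show "\<gamma> k (g + x) = \<gamma> k g * \<gamma> k x" if "k < n" for g x k
        using ch[OF that] by (simp add: character_def)
    qed (auto simp: unit haar_translation_measurable[OF haar] haar_translation_invariant[OF haar])
    then have mbG: "multiplier_bound \<mu> p \<Phi> n (\<lambda>g k. \<gamma> k g) C"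
    proof (rule mono[OF _ C(2)])
      show "0 \<le> Lp \<mu> p (\<lambda>g. \<Phi> (\<lambda>k. a k * \<gamma> k g))" for a
      proof (rule Lp_nonneg[OF M s_seminorm_bounded_measurable[OF \<Phi> s]])
        show "(\<lambda>g. a k * \<gamma> k g) \<in> borel_measurable \<mu>" if "k < n" for k
          by (intro borel_measurable_times borel_measurable_const meas that)
        show "norm (a k * \<gamma> k g) \<le> (\<Sum>j<n. norm (a j))" if "k < n" for k g
          using that by (simp add: norm_mult unit norm_le_sum_norm)
      qed
    qed
    have signs: "(\<lambda>k. sign_coord k g) \<in> UNIV \<rightarrow> {1, -1}" for g
      by (auto simp: sign_coord_def)
    have "multiplier_bound cantor_haar p \<Phi> n (\<lambda>t. t) B"
      unfolding B_def
    proof (rule multiplier_bound_of_invariance[where \<tau> = "\<lambda>g t k. sign_coord k g * t k" and e = sign_coord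
          and E = "range sign_coord", OF D p \<Phi> s cantor_coord_measurable _ _ _ _ \<kappa>_def N'])
      show "inj_on sign_coord {..<n}" using inj_sign_coord by (rule inj_on_subset) simp
      show "(\<lambda>t k. sign_coord k g * t k) \<in> measurable cantor_haar cantor_haar" for g
        by (rule cantor_translation_measurable[OF signs])
      show "distr cantor_haar cantor_haar (\<lambda>t k. sign_coord k g * t k) = cantor_haar" for g
        by (rule cantor_haar_translation_invariant[OF signs])
    qed (auto simp: cantor_coord_unimodular)
    then have mbD: "multiplier_bound cantor_haar p \<Phi> n (\<lambda>t. t) C"
    proof (rule mono[OF _ C(3)])
      show "0 \<le> Lp cantor_haar p (\<lambda>t. \<Phi> (\<lambda>k. a k * t k))" for a
      proof (rule Lp_nonneg[OF D s_seminorm_bounded_measurable[OF \<Phi> s]])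
        show "(\<lambda>t. a k * t k) \<in> borel_measurable cantor_haar" for k
          by (intro borel_measurable_times borel_measurable_const cantor_coord_measurable)
        show "norm (a k * t k) \<le> (\<Sum>j<n. norm (a j))" if "k < n" "t \<in> space cantor_haar" for k t
          using that by (simp add: norm_mult cantor_coord_unimodular norm_le_sum_norm)
      qed
    qed
    have C0: "0 \<le> C" using C(1) by simp
    have "Lp cantor_haar p (\<lambda>t. \<Phi> t) \<le> C * C * Lp \<mu> p (\<lambda>g. \<Phi> (\<lambda>k. \<gamma> k g))"
      by (rule multiplier_bound_comparison[where h = "\<lambda>t. t" and h' = "\<lambda>g k. \<gamma> k g", OF D M p \<Phi> s])
        (simp_all add: cantor_coord_measurable meas cantor_coord_unimodular unit mbD mbG C0)
    moreover have "Lp \<mu> p (\<lambda>g. \<Phi> (\<lambda>k. \<gamma> k g)) \<le> C * C * Lp cantor_haar p (\<lambda>t. \<Phi> t)"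
      by (rule multiplier_bound_comparison[where h' = "\<lambda>t. t" and h = "\<lambda>g k. \<gamma> k g", OF M D p \<Phi> s])
        (simp_all add: cantor_coord_measurable meas cantor_coord_unimodular unit mbD mbG C0)
    ultimately show ?thesis by blast
  qed
  note main = this
  have "0 < C * C" using C(1) by simp
  then show ?thesis
    by (intro exI[of _ "C * C"] conjI[of "0 < C * C"] allI impI main)
qed

section \<open>Interpolation sets satisfy property \<open>C\<^sub>p\<close>\<close>

lemma s_seminorm_of_quasi_normed:
  fixes X :: "('x, 'm) quasi_normed_scheme"
  assumes mod: "module complex_ring X" and q: "is_quasinorm X (qnorm X)" and r: "is_r_norm s X (qnorm X)"
    and x: "x ` {..<n} \<subseteq> carrier X"
  shows "s_seminorm s n (\<lambda>a. qnorm X (\<Oplus>\<^bsub>X\<^esub>k\<in>{..<n}. a k \<odot>\<^bsub>X\<^esub> x k))"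
proof -
  interpret X: module complex_ring X by fact
  have R: "carrier complex_ring = UNIV" "c \<oplus>\<^bsub>complex_ring\<^esub> d = c + d" "c \<otimes>\<^bsub>complex_ring\<^esub> d = c * d" for c d
    by (simp_all add: complex_ring_def)
  have xk: "x k \<in> carrier X" if "k < n" for k using x that by auto
  have smult: "c \<odot>\<^bsub>X\<^esub> x k \<in> carrier X" if "k < n" for c k using xk[OF that] by (simp add: R)
  have S: "(\<Oplus>\<^bsub>X\<^esub>k\<in>{..<n}. a k \<odot>\<^bsub>X\<^esub> x k) \<in> carrier X" for a
    by (rule X.M.finsum_closed) (auto simp: smult)
  have scale: "(\<Oplus>\<^bsub>X\<^esub>k\<in>{..<m}. (c * a k) \<odot>\<^bsub>X\<^esub> x k) = c \<odot>\<^bsub>X\<^esub> (\<Oplus>\<^bsub>X\<^esub>k\<in>{..<m}. a k \<odot>\<^bsub>X\<^esub> x k)"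
    if "m \<le> n" for c a m
    using that
  proof (induction m)
    case 0
    then show ?case by (simp add: X.smult_r_null R)
  next
    case (Suc m)
    have sm: "(\<lambda>k. b k \<odot>\<^bsub>X\<^esub> x k) \<in> {..<m} \<rightarrow> carrier X" "b m \<odot>\<^bsub>X\<^esub> x m \<in> carrier X" for b
      using Suc.prems smult by auto
    have "(\<Oplus>\<^bsub>X\<^esub>k\<in>{..<m}. a k \<odot>\<^bsub>X\<^esub> x k) \<in> carrier X"
      by (rule X.M.finsum_closed[OF sm(1)])
    moreover have "(c * a m) \<odot>\<^bsub>X\<^esub> x m = c \<odot>\<^bsub>X\<^esub> (a m \<odot>\<^bsub>X\<^esub> x m)"
      using X.smult_assoc1[of c "a m" "x m"] xk Suc.prems by (simp add: R)
    ultimately show ?case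
      using Suc sm by (simp add: lessThan_Suc X.smult_r_distr R)
  qed
  have add: "(\<Oplus>\<^bsub>X\<^esub>k\<in>{..<n}. (a k + b k) \<odot>\<^bsub>X\<^esub> x k)
      = (\<Oplus>\<^bsub>X\<^esub>k\<in>{..<n}. a k \<odot>\<^bsub>X\<^esub> x k) \<oplus>\<^bsub>X\<^esub> (\<Oplus>\<^bsub>X\<^esub>k\<in>{..<n}. b k \<odot>\<^bsub>X\<^esub> x k)" for a b
  proof -
    have "(\<Oplus>\<^bsub>X\<^esub>k\<in>{..<n}. (a k + b k) \<odot>\<^bsub>X\<^esub> x k) = (\<Oplus>\<^bsub>X\<^esub>k\<in>{..<n}. a k \<odot>\<^bsub>X\<^esub> x k \<oplus>\<^bsub>X\<^esub> b k \<odot>\<^bsub>X\<^esub> x k)"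
    proof (rule X.M.finsum_cong'[OF refl])
      show "(a k + b k) \<odot>\<^bsub>X\<^esub> x k = a k \<odot>\<^bsub>X\<^esub> x k \<oplus>\<^bsub>X\<^esub> b k \<odot>\<^bsub>X\<^esub> x k" if "k \<in> {..<n}" for k
        using X.smult_l_distr[of "a k" "b k" "x k"] xk that by (simp add: R)
    qed (auto simp: smult)
    also have "\<dots> = (\<Oplus>\<^bsub>X\<^esub>k\<in>{..<n}. a k \<odot>\<^bsub>X\<^esub> x k) \<oplus>\<^bsub>X\<^esub> (\<Oplus>\<^bsub>X\<^esub>k\<in>{..<n}. b k \<odot>\<^bsub>X\<^esub> x k)"
      by (rule X.M.finsum_addf) (auto simp: smult)
    finally show ?thesis .
  qed
  show ?thesis
    unfolding s_seminorm_def
  proof (intro conjI allI impI)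
    show "0 \<le> qnorm X (\<Oplus>\<^bsub>X\<^esub>k\<in>{..<n}. a k \<odot>\<^bsub>X\<^esub> x k)" for a
      using q S by (simp add: is_quasinorm_def)
    show "qnorm X (\<Oplus>\<^bsub>X\<^esub>k\<in>{..<n}. (c * a k) \<odot>\<^bsub>X\<^esub> x k) = norm c * qnorm X (\<Oplus>\<^bsub>X\<^esub>k\<in>{..<n}. a k \<odot>\<^bsub>X\<^esub> x k)" for c a
      using q S by (simp add: is_quasinorm_def scale)
    show "qnorm X (\<Oplus>\<^bsub>X\<^esub>k\<in>{..<n}. (a k + b k) \<odot>\<^bsub>X\<^esub> x k) powr s
        \<le> qnorm X (\<Oplus>\<^bsub>X\<^esub>k\<in>{..<n}. a k \<odot>\<^bsub>X\<^esub> x k) powr s + qnorm X (\<Oplus>\<^bsub>X\<^esub>k\<in>{..<n}. b k \<odot>\<^bsub>X\<^esub> x k) powr s" for a b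
      using r S by (simp add: is_r_norm_def add)
    show "qnorm X (\<Oplus>\<^bsub>X\<^esub>k\<in>{..<n}. a k \<odot>\<^bsub>X\<^esub> x k) = qnorm X (\<Oplus>\<^bsub>X\<^esub>k\<in>{..<n}. b k \<odot>\<^bsub>X\<^esub> x k)"
      if "\<forall>k<n. a k = b k" for a b
    proof -
      have "(\<Oplus>\<^bsub>X\<^esub>k\<in>{..<n}. a k \<odot>\<^bsub>X\<^esub> x k) = (\<Oplus>\<^bsub>X\<^esub>k\<in>{..<n}. b k \<odot>\<^bsub>X\<^esub> x k)"
        by (rule X.M.finsum_cong'[OF refl]) (use that smult in auto)
      then show ?thesis by simp
    qed
  qed
qed

theorem uniformly_approximable_imp_property_C:
  fixes E :: "('g::topological_ab_group_add \<Rightarrow> complex) set" and X :: "('x, 'm) quasi_normed_scheme"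
  assumes haar: "normalized_haar_measure (\<mu> :: 'g measure)"
    and E: "E \<subseteq> Collect character" and ua: "uniformly_approximable E" and p: "0 < p"
    and X: "quasi_banach X"
  shows "property_C \<mu> p X E"
proof -
  obtain s where s: "0 < s" "is_r_norm s X (qnorm X)" and mod: "module complex_ring X" "is_quasinorm X (qnorm X)"
    using X by (auto simp: quasi_banach_def)
  obtain C where C: "C > 0" "\<forall>n \<gamma> \<Phi>. inj_on \<gamma> {..<n} \<longrightarrow> \<gamma> ` {..<n} \<subseteq> E \<longrightarrow> s_seminorm s n \<Phi> \<longrightarrow>
     Lp cantor_haar p \<Phi> \<le> C * Lp \<mu> p (\<lambda>g. \<Phi> (\<lambda>k. \<gamma> k g)) \<and>
     Lp \<mu> p (\<lambda>g. \<Phi> (\<lambda>k. \<gamma> k g)) \<le> C * Lp cantor_haar p \<Phi>"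
    using s_seminorm_comparison[OF haar E ua s(1) p] by blast
  show ?thesis
    unfolding property_C_def Lp_qnorm_eq_Lp Let_def
  proof (intro exI[of _ C] conjI allI impI C(1))
    fix n and \<gamma> :: "nat \<Rightarrow> 'g \<Rightarrow> complex" and x :: "nat \<Rightarrow> 'x"
    assume \<gamma>: "inj_on \<gamma> {..<n}" "\<gamma> ` {..<n} \<subseteq> E" and x: "x ` {..<n} \<subseteq> carrier X"
    note sem = s_seminorm_of_quasi_normed[OF mod s(2) x]
    note le = C(2)[rule_format, OF \<gamma> sem]
    show "inverse C * Lp cantor_haar p (\<lambda>t. qnorm X (\<Oplus>\<^bsub>X\<^esub>k\<in>{..<n}. t k \<odot>\<^bsub>X\<^esub> x k))
        \<le> Lp \<mu> p (\<lambda>g. qnorm X (\<Oplus>\<^bsub>X\<^esub>k\<in>{..<n}. \<gamma> k g \<odot>\<^bsub>X\<^esub> x k))"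
      using conjunct1[OF le] C(1) by (simp add: field_simps)
    show "Lp \<mu> p (\<lambda>g. qnorm X (\<Oplus>\<^bsub>X\<^esub>k\<in>{..<n}. \<gamma> k g \<odot>\<^bsub>X\<^esub> x k))
        \<le> C * Lp cantor_haar p (\<lambda>t. qnorm X (\<Oplus>\<^bsub>X\<^esub>k\<in>{..<n}. t k \<odot>\<^bsub>X\<^esub> x k))"
      using conjunct2[OF le] .
  qed
qed

section \<open>The gauge of a finite set of characters\<close>

lemma powr_add_le_add_powr:
  fixes a b r :: real
  assumes "0 \<le> a" "0 \<le> b" "0 < r" "r \<le> 1"
  shows "(a + b) powr r \<le> a powr r + b powr r"
proof (cases "a + b = 0")
  case False
  then have ab: "0 < a + b" using assms by simp
  have le: "x / (a + b) * (a + b) powr r \<le> x powr r" if "0 \<le> x" "x \<le> a + b" for x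
  proof -
    have "x / (a + b) \<le> (x / (a + b)) powr r"
    proof (cases "x = 0")
      case False
      have "(x / (a + b)) powr 1 \<le> (x / (a + b)) powr r"
        using that ab False assms by (intro powr_mono') auto
      then show ?thesis using that ab by simp
    qed simp
    then have "x / (a + b) * (a + b) powr r \<le> (x / (a + b)) powr r * (a + b) powr r"
      by (rule mult_right_mono) simp
    also have "\<dots> = x powr r"
      using that ab by (simp flip: powr_mult)
    finally show ?thesis .
  qed
  have "(a + b) powr r = a / (a + b) * (a + b) powr r + b / (a + b) * (a + b) powr r"
    using ab by (simp flip: distrib_right add_divide_distrib)
  also have "\<dots> \<le> a powr r + b powr r"
    using assms by (intro add_mono le) auto
  finally show ?thesis .
qed (use assms in simp)

lemma norm_trig_sum_powr_le_cost:
  assumes "0 < r" "r \<le> 1" "\<And>x. norm (\<gamma> x) = 1"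
  shows "norm (trig_sum L \<gamma>) powr r \<le> cost r L"
proof (induction L)
  case (Cons l L)
  obtain c g where l: "l = (c, g)" by fastforce
  have "norm (trig_sum (l # L) \<gamma>) powr r \<le> (norm c + norm (trig_sum L \<gamma>)) powr r"
    using assms norm_triangle_ineq[of "c * \<gamma> g" "trig_sum L \<gamma>"]
    by (intro powr_mono2) (auto simp: l norm_mult)
  also have "\<dots> \<le> norm c powr r + norm (trig_sum L \<gamma>) powr r"
    using assms by (intro powr_add_le_add_powr) auto
  finally show ?case using Cons by (simp add: l)
qed simp

text \<open>
  For \<open>\<gamma> j x \<noteq> \<gamma> k x\<close> the measure \<open>(\<delta>\<^sub>x -
  \<gamma> j x \<delta>\<^sub>0) / (\<gamma> k x - \<gamma> j x)\<close> has transform 1 at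
  \<open>\<gamma> k\<close> and 0 at \<open>\<gamma> j\<close>; these measures are convolved.
\<close>

lemma ex_trig_sum_unit:
  fixes \<gamma> :: "nat \<Rightarrow> 'g::topological_ab_group_add \<Rightarrow> complex"
  assumes ch: "\<And>i. i < n \<Longrightarrow> character (\<gamma> i)" and inj: "inj_on \<gamma> {..<n}" and k: "k < n"
  shows "\<exists>L. \<forall>i<n. trig_sum L (\<gamma> i) = (if i = k then 1 else 0)"
proof -
  have "\<exists>L. trig_sum L (\<gamma> k) = 1 \<and> (\<forall>i\<in>J. trig_sum L (\<gamma> i) = 0)"
    if "finite J" "J \<subseteq> {..<n} - {k}" for J
    using that
  proof (induction J)
    case empty
    then show ?case
      by (intro exI[of _ "[(1, 0)]"]) (simp add: character_zero ch k)
  next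
    case (insert j J)
    then obtain L where L: "trig_sum L (\<gamma> k) = 1" "\<forall>i\<in>J. trig_sum L (\<gamma> i) = 0" by auto
    have j: "j < n" "j \<noteq> k" using insert.prems by auto
    then have "\<gamma> j \<noteq> \<gamma> k" using inj k by (auto simp: inj_on_def)
    then obtain x where x: "\<gamma> j x \<noteq> \<gamma> k x" by auto
    define d where "d = \<gamma> k x - \<gamma> j x"
    have d: "d \<noteq> 0" using x by (simp add: d_def)
    define D where "D = [(1 / d, x), (- (\<gamma> j x) / d, 0)]"
    have D: "trig_sum D (\<gamma> i) = (\<gamma> i x - \<gamma> j x) / d" if "i < n" for i
      using ch[OF that] by (simp add: D_def character_zero diff_divide_distrib)
    have mult: "trig_sum (convolve D L) (\<gamma> i) = trig_sum D (\<gamma> i) * trig_sum L (\<gamma> i)" if "i < n" for i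
      using ch[OF that] by (intro trig_sum_convolve) (simp add: character_def)
    have "trig_sum (convolve D L) (\<gamma> k) = 1"
      using d by (simp add: mult D k L d_def)
    moreover have "trig_sum (convolve D L) (\<gamma> i) = 0" if "i \<in> insert j J" for i
    proof -
      have "i < n" using that insert.prems by auto
      then show ?thesis using that L(2) by (auto simp: mult D)
    qed
    ultimately show ?case by blast
  qed
  from this[of "{..<n} - {k}"] obtain L
    where L: "trig_sum L (\<gamma> k) = 1" "\<forall>i\<in>{..<n} - {k}. trig_sum L (\<gamma> i) = 0" by auto
  then show ?thesis by (intro exI[of _ L]) auto
qed

lemma ex_trig_sum_eq:
  fixes \<gamma> :: "nat \<Rightarrow> 'g::topological_ab_group_add \<Rightarrow> complex"
  assumes ch: "\<And>i. i < n \<Longrightarrow> character (\<gamma> i)" and inj: "inj_on \<gamma> {..<n}"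
  shows "\<exists>L. \<forall>i<n. trig_sum L (\<gamma> i) = y i"
proof -
  have "\<exists>L. \<forall>i<n. trig_sum L (\<gamma> i) = (if i < m then y i else 0)" if "m \<le> n" for m
    using that
  proof (induction m)
    case 0
    show ?case by (intro exI[of _ "[]"]) simp
  next
    case (Suc m)
    then obtain L where L: "\<forall>i<n. trig_sum L (\<gamma> i) = (if i < m then y i else 0)" by auto
    obtain U where U: "\<forall>i<n. trig_sum U (\<gamma> i) = (if i = m then 1 else 0)"
      using ex_trig_sum_unit[of n \<gamma> m] ch inj Suc.prems by auto
    show ?case
      using L U by (intro exI[of _ "L @ scale_coeffs (y m) U"]) (auto simp: trig_sum_scale less_Suc_eq)
  qed
  from this[of n] show ?thesis by auto
qed

text \<open>
  The \<open>r\<close>-th power of the \<open>r\<close>-norm on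
  \<open>\<complex>\<^sup>n\<close> whose unit ball is the \<open>r\<close>-convex hull of the
  unimodular multiples of the vectors \<open>(\<gamma> i g)\<^sub>i\<close>, up to closure: the
  cheapest discrete measure with transform \<open>y i\<close> at \<open>\<gamma> i\<close>.
\<close>

definition gauge :: "real \<Rightarrow> nat \<Rightarrow> (nat \<Rightarrow> 'g \<Rightarrow> complex) \<Rightarrow> (nat \<Rightarrow> complex) \<Rightarrow> real" where
  "gauge r n \<gamma> y = Inf {cost r L | L. \<forall>i<n. trig_sum L (\<gamma> i) = y i}"

lemma gauge_le_cost: "(\<And>i. i < n \<Longrightarrow> trig_sum L (\<gamma> i) = y i) \<Longrightarrow> gauge r n \<gamma> y \<le> cost r L"
  unfolding gauge_def by (intro cInf_lower) (auto simp: bdd_below_def intro: cost_nonneg)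

lemma gauge_lessD:
  fixes \<gamma> :: "nat \<Rightarrow> 'g::topological_ab_group_add \<Rightarrow> complex"
  assumes "\<And>i. i < n \<Longrightarrow> character (\<gamma> i)" "inj_on \<gamma> {..<n}" "gauge r n \<gamma> y < c"
  shows "\<exists>L. cost r L < c \<and> (\<forall>i<n. trig_sum L (\<gamma> i) = y i)"
proof -
  have "{cost r L | L. \<forall>i<n. trig_sum L (\<gamma> i) = y i} \<noteq> {}"
    using ex_trig_sum_eq[of n \<gamma> y] assms by auto
  from cInf_lessD[OF this, of c] show ?thesis using assms(3) unfolding gauge_def by auto
qed

lemma le_gaugeI:
  fixes \<gamma> :: "nat \<Rightarrow> 'g::topological_ab_group_add \<Rightarrow> complex"
  assumes "\<And>i. i < n \<Longrightarrow> character (\<gamma> i)" "inj_on \<gamma> {..<n}"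
    and "\<And>L. (\<And>i. i < n \<Longrightarrow> trig_sum L (\<gamma> i) = y i) \<Longrightarrow> c \<le> cost r L"
  shows "c \<le> gauge r n \<gamma> y"
  unfolding gauge_def using ex_trig_sum_eq[of n \<gamma> y] assms by (intro cInf_greatest) auto

lemma gauge_s_seminorm:
  fixes \<gamma> :: "nat \<Rightarrow> 'g::topological_ab_group_add \<Rightarrow> complex"
  assumes ch: "\<And>i. i < n \<Longrightarrow> character (\<gamma> i)" and inj: "inj_on \<gamma> {..<n}" and r: "0 < r"
  shows "s_seminorm r n (\<lambda>y. gauge r n \<gamma> y powr (1/r))"
proof -
  let ?G = "gauge r n \<gamma>"
  have nonneg: "0 \<le> ?G y" for y by (rule le_gaugeI[OF ch inj cost_nonneg])
  have zero: "?G (\<lambda>_. 0) = 0"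
    using gauge_le_cost[of n "[]" \<gamma> "\<lambda>_. 0" r] nonneg[of "\<lambda>_. 0"] by simp
  have scale_le: "?G (\<lambda>k. c * y k) \<le> norm c powr r * ?G y" for c y
  proof (cases "c = 0")
    case True
    then show ?thesis using zero r by simp
  next
    case False
    then have pos: "0 < norm c powr r" by simp
    have "?G (\<lambda>k. c * y k) / norm c powr r \<le> ?G y"
    proof (rule le_gaugeI[OF ch inj])
      fix L assume "\<And>i. i < n \<Longrightarrow> trig_sum L (\<gamma> i) = y i"
      then have "?G (\<lambda>k. c * y k) \<le> cost r (scale_coeffs c L)"
        by (intro gauge_le_cost) (simp add: trig_sum_scale)
      then show "?G (\<lambda>k. c * y k) / norm c powr r \<le> cost r L"
        using pos by (simp add: cost_scale divide_le_eq mult.commute)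
    qed
    then show ?thesis using pos by (simp add: divide_le_eq mult.commute)
  qed
  have scale: "?G (\<lambda>k. c * y k) = norm c powr r * ?G y" for c y
  proof (cases "c = 0")
    case False
    have "norm c powr r * ?G y = norm c powr r * ?G (\<lambda>k. inverse c * (c * y k))"
      using False by (simp flip: mult.assoc)
    also have "\<dots> \<le> norm c powr r * (norm (inverse c) powr r * ?G (\<lambda>k. c * y k))"
      by (intro mult_left_mono scale_le) auto
    also have "\<dots> = ?G (\<lambda>k. c * y k)"
    proof -
      have "norm c powr r * norm (inverse c) powr r = 1"
        using False by (simp flip: powr_mult norm_mult)
      then show ?thesis by (simp flip: mult.assoc)
    qed
    finally show ?thesis using scale_le[of c y] by simp
  qed (use zero r in simp)
  have add: "?G (\<lambda>k. y k + z k) \<le> ?G y + ?G z" for y z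
  proof -
    have "?G (\<lambda>k. y k + z k) - ?G z \<le> ?G y"
    proof (rule le_gaugeI[OF ch inj])
      fix L assume L: "\<And>i. i < n \<Longrightarrow> trig_sum L (\<gamma> i) = y i"
      have "?G (\<lambda>k. y k + z k) - cost r L \<le> ?G z"
      proof (rule le_gaugeI[OF ch inj])
        fix L' assume "\<And>i. i < n \<Longrightarrow> trig_sum L' (\<gamma> i) = z i"
        then have "?G (\<lambda>k. y k + z k) \<le> cost r (L @ L')"
          using L by (intro gauge_le_cost) simp
        then show "?G (\<lambda>k. y k + z k) - cost r L \<le> cost r L'" by simp
      qed
      then show "?G (\<lambda>k. y k + z k) - ?G z \<le> cost r L" by simp
    qed
    then show ?thesis by simp
  qed
  show ?thesis
    unfolding s_seminorm_def
  proof (intro conjI allI impI)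
    show "?G (\<lambda>k. c * y k) powr (1/r) = norm c * ?G y powr (1/r)" for c y
      using nonneg r by (simp add: scale powr_mult powr_powr)
    show "(?G (\<lambda>k. y k + z k) powr (1/r)) powr r \<le> (?G y powr (1/r)) powr r + (?G z powr (1/r)) powr r" for y z
      using nonneg r add by (simp add: powr_powr)
    show "?G y powr (1/r) = ?G z powr (1/r)" if "\<forall>k<n. y k = z k" for y z
    proof -
      have "(\<forall>i<n. trig_sum L (\<gamma> i) = y i) \<longleftrightarrow> (\<forall>i<n. trig_sum L (\<gamma> i) = z i)" for L
        using that by auto
      then show ?thesis by (simp add: gauge_def)
    qed
  qed simp
qed

lemma norm_coord_le_gauge:
  fixes \<gamma> :: "nat \<Rightarrow> 'g::topological_ab_group_add \<Rightarrow> complex"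
  assumes ch: "\<And>i. i < n \<Longrightarrow> character (\<gamma> i)" and inj: "inj_on \<gamma> {..<n}" and r: "0 < r" "r \<le> 1" and k: "k < n"
  shows "norm (y k) \<le> gauge r n \<gamma> y powr (1/r)"
proof -
  have "norm (y k) powr r \<le> gauge r n \<gamma> y"
  proof (rule le_gaugeI[OF ch inj])
    fix L assume "\<And>i. i < n \<Longrightarrow> trig_sum L (\<gamma> i) = y i"
    then have "y k = trig_sum L (\<gamma> k)" using k by simp
    then show "norm (y k) powr r \<le> cost r L"
      using norm_trig_sum_powr_le_cost[OF r, of "\<gamma> k" L] ch[OF k] by (simp add: character_def)
  qed
  then have "(norm (y k) powr r) powr (1/r) \<le> gauge r n \<gamma> y powr (1/r)"
    using r by (intro powr_mono2) auto
  then show ?thesis using r by (simp add: powr_powr)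
qed

text \<open>
  This is where \<open>r < 1\<close> enters. A coefficient \<open>c\<close> with
  \<open>\<bar>c\<bar> < \<eta>\<close> satisfies \<open>\<bar>c\<bar> \<le>
  \<eta>\<^bsup>1-r\<^esup> \<bar>c\<bar>\<^sup>r\<close>, so dropping all of them changes the
  transform by at most \<open>\<eta>\<^bsup>1-r\<^esup>\<close> times the cost, while at most
  cost \<open>/ \<eta>\<^sup>r\<close> coefficients remain.
\<close>

lemma cost_bound_imp_short_sum:
  assumes r: "0 < r" "r < 1"
  shows "\<exists>N. \<forall>L :: 'g atoms. cost r L \<le> C \<longrightarrow> (\<exists>L'. short_sum N L' \<and>
    (\<forall>\<gamma>. (\<forall>x. norm (\<gamma> x) = 1) \<longrightarrow> norm (trig_sum L \<gamma> - trig_sum L' \<gamma>) \<le> 1/8))"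
proof -
  define D where "D = max C 1"
  \<comment> \<open>Chosen such that \<open>\<eta>\<^bsup>1-r\<^esup> D = 1/8\<close>.\<close>
  define \<eta> where "\<eta> = (1 / (8 * D)) powr (1 / (1 - r))"
  have D: "D \<ge> 1" "C \<le> D" by (simp_all add: D_def)
  have \<eta>: "0 < \<eta>" "\<eta> powr (1 - r) = 1 / (8 * D)"
    using D(1) r by (simp_all add: \<eta>_def powr_powr)
  define N where "N = nat \<lceil>D / \<eta> powr r\<rceil> + nat \<lceil>D powr (1/r)\<rceil>"
  have "\<exists>L'. short_sum N L' \<and> (\<forall>\<gamma>. (\<forall>x. norm (\<gamma> x) = 1) \<longrightarrow> norm (trig_sum L \<gamma> - trig_sum L' \<gamma>) \<le> 1/8)"
    if "cost r L \<le> C" for L :: "'g atoms"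
  proof (intro exI[of _ "filter (\<lambda>(c, g). \<eta> \<le> norm c) L"] conjI allI impI)
    have L: "cost r L \<le> D" using that D by simp
    have len: "real (length (filter (\<lambda>(c, g). \<eta> \<le> norm c) L)) * \<eta> powr r \<le> cost r L"
    proof (induction L)
      case (Cons l L)
      obtain c g where l: "l = (c, g)" by fastforce
      have "\<eta> powr r \<le> norm c powr r" if "\<eta> \<le> norm c"
        using that \<eta> r by (intro powr_mono2) auto
      then show ?case using Cons powr_ge_zero[of "norm c" r]
        by (cases "\<eta> \<le> norm c") (simp_all add: l algebra_simps add_increasing2)
    qed simp
    have single: "norm c powr r \<le> cost r L" if "(c, g) \<in> set L" for c g
      using that
    proof (induction L)
      case (Cons l L)
      then show ?case using cost_nonneg[of r L] by (cases l) (auto intro: add_increasing)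
    qed simp
    show "short_sum N (filter (\<lambda>(c, g). \<eta> \<le> norm c) L)"
      unfolding short_sum_def
    proof (intro conjI ballI)
      have "real (length (filter (\<lambda>(c, g). \<eta> \<le> norm c) L)) \<le> D / \<eta> powr r"
        using len L \<eta>(1) by (simp add: le_divide_eq)
      also have "\<dots> \<le> real (nat \<lceil>D / \<eta> powr r\<rceil>)" by (rule real_nat_ceiling_ge)
      finally show "length (filter (\<lambda>(c, g). \<eta> \<le> norm c) L) \<le> N" by (simp add: N_def)
      fix l assume "l \<in> set (filter (\<lambda>(c, g). \<eta> \<le> norm c) L)"
      moreover obtain c g where "l = (c, g)" by fastforce
      ultimately have l: "l = (c, g)" "(c, g) \<in> set L" by auto
      have "norm c powr r \<le> D" using single[OF l(2)] L by simp
      then have "(norm c powr r) powr (1/r) \<le> D powr (1/r)"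
        using r by (intro powr_mono2) auto
      then have "norm c \<le> D powr (1/r)" using r by (simp add: powr_powr)
      also have "\<dots> \<le> real (nat \<lceil>D powr (1/r)\<rceil>)" by (rule real_nat_ceiling_ge)
      finally show "case l of (c, g) \<Rightarrow> norm c \<le> real N" by (simp add: l N_def)
    qed
    fix \<gamma> :: "'g \<Rightarrow> complex" assume \<gamma>: "\<forall>x. norm (\<gamma> x) = 1"
    have "norm (trig_sum L \<gamma> - trig_sum (filter (\<lambda>(c, g). \<eta> \<le> norm c) L) \<gamma>) \<le> \<eta> powr (1 - r) * cost r L"
    proof (induction L)
      case (Cons l L)
      let ?L' = "filter (\<lambda>(c, g). \<eta> \<le> norm c) L"
      obtain c g where l: "l = (c, g)" by fastforce
      show ?case
      proof (cases "\<eta> \<le> norm c")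
        case True
        then show ?thesis using Cons by (simp add: l algebra_simps add_increasing2)
      next
        case False
        have "norm (c * \<gamma> g) = norm c powr (1 - r) * norm c powr r"
          using \<gamma> by (cases "c = 0") (simp_all add: norm_mult flip: powr_add)
        also have "\<dots> \<le> \<eta> powr (1 - r) * norm c powr r"
          using False r by (intro mult_right_mono powr_mono2) auto
        finally have "norm (c * \<gamma> g) \<le> \<eta> powr (1 - r) * norm c powr r" .
        then have "norm (c * \<gamma> g + (trig_sum L \<gamma> - trig_sum ?L' \<gamma>)) \<le> \<eta> powr (1 - r) * (norm c powr r + cost r L)"
          using Cons norm_triangle_ineq[of "c * \<gamma> g" "trig_sum L \<gamma> - trig_sum ?L' \<gamma>"]
          by (simp add: distrib_left)
        then show ?thesis using False by (simp add: l add_diff_eq)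
      qed
    qed simp
    also have "\<dots> \<le> \<eta> powr (1 - r) * D" using L by (intro mult_left_mono) auto
    also have "\<dots> = 1/8" using \<eta>(2) D(1) by simp
    finally show "norm (trig_sum L \<gamma> - trig_sum (filter (\<lambda>(c, g). \<eta> \<le> norm c) L) \<gamma>) \<le> 1/8" .
  qed
  then show ?thesis by blast
qed

lemma cheap_signs_imp_signs_approximable:
  fixes E :: "('g::topological_ab_group_add \<Rightarrow> complex) set"
  assumes G: "compact (UNIV :: 'g set)" and E: "E \<subseteq> Collect character" and r: "0 < r" "r < 1"
    and cheap: "\<And>n (\<gamma> :: nat \<Rightarrow> 'g \<Rightarrow> complex) s. inj_on \<gamma> {..<n} \<Longrightarrow> \<gamma> ` {..<n} \<subseteq> E \<Longrightarrow> (\<And>i. s i \<in> {1, -1}) \<Longrightarrow>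
      \<exists>L :: 'g atoms. cost r L \<le> C \<and> (\<forall>i<n. trig_sum L (\<gamma> i) = s i)"
  shows "signs_approximable E"
proof -
  obtain N where N: "\<forall>L :: 'g atoms. cost r L \<le> C \<longrightarrow> (\<exists>L'. short_sum N L' \<and>
    (\<forall>\<gamma>. (\<forall>x. norm (\<gamma> x) = 1) \<longrightarrow> norm (trig_sum L \<gamma> - trig_sum L' \<gamma>) \<le> 1/8))"
    using cost_bound_imp_short_sum[OF r] by blast
  have "\<exists>L :: 'g atoms. short_sum N L \<and> close_on E (1/8) f L"
    if f: "\<forall>\<gamma>\<in>E. f \<gamma> \<in> {1, -1}" for f
  proof (rule short_sum_compactness[OF G])
    show "continuous_on UNIV \<gamma>" if "\<gamma> \<in> E" for \<gamma> using that E by (auto simp: character_def)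
    fix F assume F: "finite F" "F \<subseteq> E"
    obtain \<gamma> where \<gamma>: "bij_betw \<gamma> {..<card F} F"
      using ex_bij_betw_nat_finite[OF F(1)] by (auto simp: atLeast0LessThan)
    define s where "s = (\<lambda>i. if i < card F then f (\<gamma> i) else 1)"
    have "s i \<in> {1, -1}" for i
      using f F(2) bij_betwE[OF \<gamma>] by (auto simp: s_def)
    then obtain L :: "'g atoms" where L: "cost r L \<le> C" "\<forall>i<card F. trig_sum L (\<gamma> i) = s i"
      using cheap[of \<gamma> "card F" s] \<gamma> F(2) by (auto simp: bij_betw_def)
    obtain L' where L': "short_sum N L'"
      "\<forall>\<gamma>. (\<forall>x. norm (\<gamma> x) = 1) \<longrightarrow> norm (trig_sum L \<gamma> - trig_sum L' \<gamma>) \<le> 1/8"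
      using N L(1) by blast
    have "norm (f \<psi> - trig_sum L' \<psi>) \<le> 1/8" if \<psi>: "\<psi> \<in> F" for \<psi>
    proof -
      obtain i where i: "i < card F" "\<psi> = \<gamma> i" using \<gamma> \<psi> by (auto simp: bij_betw_def)
      then have "f \<psi> = trig_sum L \<psi>" using L(2) by (simp add: s_def)
      moreover have "\<forall>x. norm (\<psi> x) = 1" using \<psi> F(2) E by (auto simp: character_def)
      ultimately show ?thesis using L'(2) by simp
    qed
    with L'(1) show "\<exists>L. short_sum N L \<and> close_on F (1/8) f L" by blast
  qed
  then show ?thesis unfolding signs_approximable_def by blast
qed

section \<open>Sums of countably many finite-dimensional spaces\<close>

text \<open>
  The \<open>\<ell>\<^sub>\<infinity>\<close> sum of the spaces \<open>\<complex>\<^bsup>N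
  m\<^esup>\<close> with quasinorms \<open>\<Phi> m\<close> combines countably many
  finite-dimensional spaces into one quasi-Banach space that has only as many elements as
  \<open>nat \<Rightarrow> complex\<close>.
\<close>

definition block_qnorm :: "(nat \<Rightarrow> (nat \<Rightarrow> complex) \<Rightarrow> real) \<Rightarrow> (nat \<Rightarrow> nat \<Rightarrow> complex) \<Rightarrow> real" where
  "block_qnorm \<Phi> x = (SUP m. \<Phi> m (x m))"

definition block_space :: "(nat \<Rightarrow> nat) \<Rightarrow> (nat \<Rightarrow> (nat \<Rightarrow> complex) \<Rightarrow> real) \<Rightarrow> (nat \<Rightarrow> nat \<Rightarrow> complex) set" where
  "block_space N \<Phi> = {x. (\<forall>m i. N m \<le> i \<longrightarrow> x m i = 0) \<and> bdd_above (range (\<lambda>m. \<Phi> m (x m)))}"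

text \<open>
  The injection \<open>J\<close> transports the space to a given type of vectors.
\<close>

definition block_sum ::
    "((nat \<Rightarrow> nat \<Rightarrow> complex) \<Rightarrow> 'x) \<Rightarrow> (nat \<Rightarrow> nat) \<Rightarrow> (nat \<Rightarrow> (nat \<Rightarrow> complex) \<Rightarrow> real) \<Rightarrow> 'x quasi_normed" where
  "block_sum J N \<Phi> =
     \<lparr>carrier = J ` block_space N \<Phi>,
      monoid.mult = (\<lambda>x y. J (\<lambda>_ _. 0)),
      one = J (\<lambda>_ _. 0),
      ring.zero = J (\<lambda>_ _. 0),
      add = (\<lambda>x y. J (\<lambda>m i. inv_into UNIV J x m i + inv_into UNIV J y m i)),
      smult = (\<lambda>a x. J (\<lambda>m i. a * inv_into UNIV J x m i)),
      qnorm = (\<lambda>x. block_qnorm \<Phi> (inv_into UNIV J x))\<rparr>"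

lemma block_sum_sel:
  "carrier (block_sum J N \<Phi>) = J ` block_space N \<Phi>"
  "\<zero>\<^bsub>block_sum J N \<Phi>\<^esub> = J (\<lambda>_ _. 0)"
  by (simp_all add: block_sum_def)

context
  fixes J :: "(nat \<Rightarrow> nat \<Rightarrow> complex) \<Rightarrow> 'x" and N :: "nat \<Rightarrow> nat"
    and \<Phi> :: "nat \<Rightarrow> (nat \<Rightarrow> complex) \<Rightarrow> real" and r :: real
  assumes J: "inj J" and \<Phi>: "\<And>m. s_seminorm r (N m) (\<Phi> m)" and r: "0 < r"
    and coord: "\<And>m i y. i < N m \<Longrightarrow> norm (y i) \<le> \<Phi> m y"
begin

abbreviation "\<S> \<equiv> block_space N \<Phi>"
abbreviation "\<Q> \<equiv> block_qnorm \<Phi>"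
abbreviation "\<X> \<equiv> block_sum J N \<Phi>"

lemma block_ops:
  "J x \<oplus>\<^bsub>\<X>\<^esub> J y = J (\<lambda>m i. x m i + y m i)"
  "a \<odot>\<^bsub>\<X>\<^esub> J x = J (\<lambda>m i. a * x m i)"
  "qnorm \<X> (J x) = \<Q> x"
  using J by (simp_all add: block_sum_def)

lemma block_le: "x \<in> \<S> \<Longrightarrow> \<Phi> m (x m) \<le> \<Q> x"
  unfolding block_qnorm_def by (rule cSUP_upper) (auto simp: block_space_def)

lemma block_leI: "(\<And>m. \<Phi> m (x m) \<le> c) \<Longrightarrow> \<Q> x \<le> c"
  unfolding block_qnorm_def by (rule cSUP_least) auto

lemma in_block_spaceI:
  "(\<And>m i. N m \<le> i \<Longrightarrow> x m i = 0) \<Longrightarrow> (\<And>m. \<Phi> m (x m) \<le> c) \<Longrightarrow> x \<in> \<S>"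
  by (auto simp: block_space_def bdd_above_def)

lemma block_outside: "x \<in> \<S> \<Longrightarrow> N m \<le> i \<Longrightarrow> x m i = 0"
  by (simp add: block_space_def)

lemma block_nonneg: "x \<in> \<S> \<Longrightarrow> 0 \<le> \<Q> x"
  using block_le[of x 0] s_seminormD(1)[OF \<Phi>, of 0 "x 0"] by simp

lemma block_zero: "(\<lambda>_ _. 0) \<in> \<S>" "\<Q> (\<lambda>_ _. 0) = 0"
proof -
  have 0: "\<Phi> m (\<lambda>_. 0) = 0" for m
    using s_seminormD(2)[OF \<Phi>, of m 0 "\<lambda>_. 0"] by simp
  then show "(\<lambda>_ _. 0) \<in> \<S>" by (intro in_block_spaceI[of _ 0]) auto
  show "\<Q> (\<lambda>_ _. 0) = 0" by (simp add: block_qnorm_def 0)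
qed

lemma block_add:
  assumes x: "x \<in> \<S>" and y: "y \<in> \<S>"
  shows "(\<lambda>m i. x m i + y m i) \<in> \<S>"
    and "\<Q> (\<lambda>m i. x m i + y m i) powr r \<le> \<Q> x powr r + \<Q> y powr r"
proof -
  define c where "c = (\<Q> x powr r + \<Q> y powr r) powr (1/r)"
  have le: "\<Phi> m (\<lambda>i. x m i + y m i) \<le> c" for m
  proof -
    have "\<Phi> m (\<lambda>i. x m i + y m i) powr r \<le> \<Phi> m (x m) powr r + \<Phi> m (y m) powr r"
      by (rule s_seminormD(3)[OF \<Phi>])
    also have "\<dots> \<le> \<Q> x powr r + \<Q> y powr r"
      using r block_le[OF x] block_le[OF y] s_seminormD(1)[OF \<Phi>] by (intro add_mono powr_mono2) auto
    finally have "(\<Phi> m (\<lambda>i. x m i + y m i) powr r) powr (1/r) \<le> c"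
      unfolding c_def using r by (intro powr_mono2) auto
    then show ?thesis using r s_seminormD(1)[OF \<Phi>] by (simp add: powr_powr)
  qed
  show \<S>: "(\<lambda>m i. x m i + y m i) \<in> \<S>"
    using le by (intro in_block_spaceI[of _ c]) (simp_all add: block_outside[OF x] block_outside[OF y])
  have "\<Q> (\<lambda>m i. x m i + y m i) \<le> c" using le by (rule block_leI)
  then have "\<Q> (\<lambda>m i. x m i + y m i) powr r \<le> c powr r"
    using r block_nonneg[OF \<S>] by (intro powr_mono2) auto
  then show "\<Q> (\<lambda>m i. x m i + y m i) powr r \<le> \<Q> x powr r + \<Q> y powr r"
    using r by (simp add: c_def powr_powr)
qed

lemma block_scale:
  assumes x: "x \<in> \<S>"
  shows "(\<lambda>m i. a * x m i) \<in> \<S>" and "\<Q> (\<lambda>m i. a * x m i) = norm a * \<Q> x"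
proof -
  have le: "\<Phi> m (\<lambda>i. a * x m i) \<le> norm a * \<Q> x" if "x \<in> \<S>" for a x m
    unfolding s_seminormD(2)[OF \<Phi>] using block_le[OF that] by (intro mult_left_mono) auto
  have \<S>: "(\<lambda>m i. a * x m i) \<in> \<S>" if "x \<in> \<S>" for a x
    using le[OF that] by (intro in_block_spaceI[of _ "norm a * \<Q> x"]) (simp_all add: block_outside[OF that])
  show "(\<lambda>m i. a * x m i) \<in> \<S>" by (rule \<S>[OF x])
  show "\<Q> (\<lambda>m i. a * x m i) = norm a * \<Q> x"
  proof (cases "a = 0")
    case True
    then show ?thesis using block_zero(2) by simp
  next
    case False
    have "\<Q> x = \<Q> (\<lambda>m i. inverse a * (a * x m i))" using False by (simp flip: mult.assoc)
    also have "\<dots> \<le> norm (inverse a) * \<Q> (\<lambda>m i. a * x m i)"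
      by (rule block_leI) (rule le[OF \<S>[OF x]])
    finally have "norm a * \<Q> x \<le> norm a * (norm (inverse a) * \<Q> (\<lambda>m i. a * x m i))"
      by (rule mult_left_mono) simp
    moreover have "norm a * norm (inverse a) = 1"
      using False by (simp flip: norm_mult)
    ultimately have "norm a * \<Q> x \<le> \<Q> (\<lambda>m i. a * x m i)"
      by (simp flip: mult.assoc)
    moreover have "\<Q> (\<lambda>m i. a * x m i) \<le> norm a * \<Q> x"
      by (rule block_leI) (rule le[OF x])
    ultimately show ?thesis by simp
  qed
qed

lemma block_definite:
  assumes x: "x \<in> \<S>" shows "\<Q> x = 0 \<longleftrightarrow> x = (\<lambda>_ _. 0)"
proof
  assume 0: "\<Q> x = 0"
  have "x m i = 0" for m i
  proof (cases "i < N m")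
    case True
    then have "norm (x m i) \<le> 0"
      using coord[OF True, of "x m"] block_le[OF x, of m] 0 by linarith
    then show ?thesis by simp
  qed (use block_outside[OF x] in simp)
  then show "x = (\<lambda>_ _. 0)" by (intro ext)
qed (simp add: block_zero)

lemma abelian_group_block_sum: "abelian_group \<X>"
proof (rule abelian_groupI)
  fix x y z assume "x \<in> carrier \<X>" "y \<in> carrier \<X>" "z \<in> carrier \<X>"
  then obtain x' y' z' where "x = J x'" "x' \<in> \<S>" "y = J y'" "y' \<in> \<S>" "z = J z'" "z' \<in> \<S>"
    by (auto simp: block_sum_sel)
  then show "x \<oplus>\<^bsub>\<X>\<^esub> y \<oplus>\<^bsub>\<X>\<^esub> z = x \<oplus>\<^bsub>\<X>\<^esub> (y \<oplus>\<^bsub>\<X>\<^esub> z)"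
    by (simp add: block_ops add.assoc)
next
  fix x y assume "x \<in> carrier \<X>" "y \<in> carrier \<X>"
  then obtain x' y' where "x = J x'" "x' \<in> \<S>" "y = J y'" "y' \<in> \<S>"
    by (auto simp: block_sum_sel)
  then show "x \<oplus>\<^bsub>\<X>\<^esub> y \<in> carrier \<X>" "x \<oplus>\<^bsub>\<X>\<^esub> y = y \<oplus>\<^bsub>\<X>\<^esub> x"
    by (simp_all add: block_ops block_sum_sel block_add(1) add.commute)
next
  show "\<zero>\<^bsub>\<X>\<^esub> \<in> carrier \<X>" by (simp add: block_sum_sel block_zero)
next
  fix x assume "x \<in> carrier \<X>"
  then obtain x' where x: "x = J x'" "x' \<in> \<S>" by (auto simp: block_sum_sel)
  then show "\<zero>\<^bsub>\<X>\<^esub> \<oplus>\<^bsub>\<X>\<^esub> x = x" by (simp add: block_ops block_sum_sel)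
  show "\<exists>y\<in>carrier \<X>. y \<oplus>\<^bsub>\<X>\<^esub> x = \<zero>\<^bsub>\<X>\<^esub>"
    using block_scale(1)[OF x(2), of "-1"]
    by (intro bexI[of _ "J (\<lambda>m i. -1 * x' m i)"]) (simp_all add: x block_ops block_sum_sel)
qed

lemma module_block_sum: "module complex_ring \<X>"
proof (rule moduleI)
  show "cring complex_ring"
    using field_complex_ring by (simp add: field_def domain_def)
  show "abelian_group \<X>" by (rule abelian_group_block_sum)
  fix a b x y
  assume "x \<in> carrier \<X>"
  then obtain x' where x: "x = J x'" "x' \<in> \<S>" by (auto simp: block_sum_sel)
  show "a \<odot>\<^bsub>\<X>\<^esub> x \<in> carrier \<X>"
    by (simp add: x block_ops block_sum_sel block_scale(1))
  show "\<one>\<^bsub>complex_ring\<^esub> \<odot>\<^bsub>\<X>\<^esub> x = x"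
    by (simp add: x block_ops complex_ring_def)
  show "(a \<oplus>\<^bsub>complex_ring\<^esub> b) \<odot>\<^bsub>\<X>\<^esub> x = a \<odot>\<^bsub>\<X>\<^esub> x \<oplus>\<^bsub>\<X>\<^esub> b \<odot>\<^bsub>\<X>\<^esub> x"
    by (simp add: x block_ops complex_ring_def distrib_right)
  show "(a \<otimes>\<^bsub>complex_ring\<^esub> b) \<odot>\<^bsub>\<X>\<^esub> x = a \<odot>\<^bsub>\<X>\<^esub> (b \<odot>\<^bsub>\<X>\<^esub> x)"
    by (simp add: x block_ops complex_ring_def mult.assoc)
  assume "y \<in> carrier \<X>"
  then obtain y' where y: "y = J y'" "y' \<in> \<S>" by (auto simp: block_sum_sel)
  show "a \<odot>\<^bsub>\<X>\<^esub> (x \<oplus>\<^bsub>\<X>\<^esub> y) = a \<odot>\<^bsub>\<X>\<^esub> x \<oplus>\<^bsub>\<X>\<^esub> a \<odot>\<^bsub>\<X>\<^esub> y"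
    by (simp add: x y block_ops distrib_left)
qed

lemma block_sum_minus:
  assumes x: "x \<in> \<S>" and y: "y \<in> \<S>"
  shows "J x \<ominus>\<^bsub>\<X>\<^esub> J y = J (\<lambda>m i. x m i - y m i)"
proof -
  interpret abelian_group \<X> by (rule abelian_group_block_sum)
  have y': "(\<lambda>m i. - y m i) \<in> \<S>" using block_scale(1)[OF y, of "-1"] by simp
  have "\<ominus>\<^bsub>\<X>\<^esub> J y = J (\<lambda>m i. - y m i)"
    using y y' by (intro minus_equality) (auto simp: block_sum_sel block_ops)
  then show ?thesis by (simp add: a_minus_def block_ops)
qed

lemma is_quasinorm_block_sum: "is_quasinorm \<X> (qnorm \<X>)"
  unfolding is_quasinorm_def
proof (intro conjI allI ballI exI[of _ "2 powr (1/r)"])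
  fix x assume "x \<in> carrier \<X>"
  then obtain x' where x: "x = J x'" "x' \<in> \<S>" by (auto simp: block_sum_sel)
  show "0 \<le> qnorm \<X> x" by (simp add: x block_ops block_nonneg)
  show "qnorm \<X> x = 0 \<longleftrightarrow> x = \<zero>\<^bsub>\<X>\<^esub>"
    using J by (simp add: x block_ops block_definite block_sum_sel inj_eq)
  show "qnorm \<X> (a \<odot>\<^bsub>\<X>\<^esub> x) = norm a * qnorm \<X> x" for a
    by (simp add: x block_ops block_scale)
  fix y assume "y \<in> carrier \<X>"
  then obtain y' where y: "y = J y'" "y' \<in> \<S>" by (auto simp: block_sum_sel)
  have "\<Q> (\<lambda>m i. x' m i + y' m i) \<le> 2 powr (1/r) * (\<Q> x' + \<Q> y')"
  proof (rule block_leI)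
    fix m
    have "\<Phi> m (\<lambda>i. x' m i + y' m i) \<le> 2 powr (1/r) * max (\<Phi> m (x' m)) (\<Phi> m (y' m))"
      by (rule s_seminorm_le_max[OF \<Phi> r])
    also have "\<dots> \<le> 2 powr (1/r) * (\<Q> x' + \<Q> y')"
      using block_le[OF x(2), of m] block_le[OF y(2), of m] block_nonneg[OF x(2)] block_nonneg[OF y(2)]
      by (intro mult_left_mono) auto
    finally show "\<Phi> m (\<lambda>i. x' m i + y' m i) \<le> 2 powr (1/r) * (\<Q> x' + \<Q> y')" .
  qed
  then show "qnorm \<X> (x \<oplus>\<^bsub>\<X>\<^esub> y) \<le> 2 powr (1/r) * (qnorm \<X> x + qnorm \<X> y)"
    by (simp add: x y block_ops)
qed

lemma is_r_norm_block_sum: "is_r_norm r \<X> (qnorm \<X>)"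
  unfolding is_r_norm_def by (auto simp: block_sum_sel block_ops block_add)

text \<open>
  A Cauchy sequence converges in each coordinate because \<open>\<Phi> m\<close> dominates the
  coordinates, and it converges to that limit in quasinorm because each \<open>\<Phi> m\<close>
  is continuous.
\<close>

lemma qnorm_complete_block_sum: "qnorm_complete \<X>"
  unfolding qnorm_complete_def
proof (intro allI impI)
  fix u :: "nat \<Rightarrow> 'x"
  assume u: "range u \<subseteq> carrier \<X>"
    and cauchy: "\<forall>e>0. \<exists>n0. \<forall>m\<ge>n0. \<forall>n\<ge>n0. qnorm \<X> (u m \<ominus>\<^bsub>\<X>\<^esub> u n) < e"
  define v where "v = (\<lambda>k. inv_into UNIV J (u k))"
  have v: "v k \<in> \<S>" "u k = J (v k)" for k
  proof -
    obtain x where "x \<in> \<S>" "u k = J x" using u by (auto simp: block_sum_sel)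
    then show "v k \<in> \<S>" "u k = J (v k)" using J by (simp_all add: v_def)
  qed
  have dS: "(\<lambda>m i. x m i - y m i) \<in> \<S>" if "x \<in> \<S>" "y \<in> \<S>" for x y
    using block_add(1)[OF that(1) block_scale(1)[OF that(2), of "-1"]] by simp
  have cauchyQ: "\<exists>n0. \<forall>k\<ge>n0. \<forall>l\<ge>n0. \<Q> (\<lambda>m i. v k m i - v l m i) < e" if "e > 0" for e
    using cauchy that by (simp add: v(2) block_sum_minus[OF v(1) v(1)] block_ops)
  have "Cauchy (\<lambda>k. v k m i)" for m i
  proof (cases "i < N m")
    case True
    show ?thesis
      unfolding Cauchy_def
    proof (intro allI impI)
      fix e :: real assume "0 < e"
      then obtain n0 where n0: "\<forall>k\<ge>n0. \<forall>l\<ge>n0. \<Q> (\<lambda>m i. v k m i - v l m i) < e" using cauchyQ by blast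
      have "dist (v k m i) (v l m i) < e" if "k \<ge> n0" "l \<ge> n0" for k l
      proof -
        have "norm (v k m i - v l m i) \<le> \<Phi> m (\<lambda>i. v k m i - v l m i)" by (rule coord[OF True])
        also have "\<dots> \<le> \<Q> (\<lambda>m i. v k m i - v l m i)" by (rule block_le[OF dS[OF v(1) v(1)]])
        finally show ?thesis using n0 that by (auto simp: dist_norm intro: le_less_trans)
      qed
      then show "\<exists>M. \<forall>m'\<ge>M. \<forall>n\<ge>M. dist (v m' m i) (v n m i) < e" by blast
    qed
  next
    case False
    then have "(\<lambda>k. v k m i) = (\<lambda>_. 0)" using block_outside[OF v(1)] by (simp add: fun_eq_iff)
    then show ?thesis by (simp add: Cauchy_def)
  qed
  then have "\<exists>l. (\<lambda>k. v k m i) \<longlonglongrightarrow> l" for m i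
    by (simp add: Cauchy_convergent_iff convergent_def)
  then obtain l where l: "\<And>m i. (\<lambda>k. v k m i) \<longlonglongrightarrow> l m i" by metis
  have l0: "l m i = 0" if "N m \<le> i" for m i
    using l[of m i] block_outside[OF v(1) that] by (simp add: LIMSEQ_const_iff)
  \<comment> \<open>The block quasinorms are continuous, so a uniform bound survives the coordinatewise limit.\<close>
  have lim: "\<Phi> m (\<lambda>i. v k m i - l m i) \<le> e"
    if n0: "\<forall>k\<ge>n0. \<forall>l\<ge>n0. \<Q> (\<lambda>m i. v k m i - v l m i) < e" and k: "k \<ge> n0" for n0 k e m
  proof (rule LIMSEQ_le_const2)
    have "continuous_on UNIV (\<Phi> m)" by (rule s_seminorm_continuous[OF \<Phi> r])
    then have "isCont (\<Phi> m) (\<lambda>i. v k m i - l m i)"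
      by (simp add: continuous_on_eq_continuous_at)
    moreover have "(\<lambda>j i. v k m i - v j m i) \<longlonglongrightarrow> (\<lambda>i. v k m i - l m i)"
    proof -
      have "limitin (product_topology (\<lambda>_. euclidean) UNIV) (\<lambda>j i. v k m i - v j m i)
          (\<lambda>i. v k m i - l m i) sequentially"
        unfolding limitin_componentwise by (auto intro!: tendsto_intros l)
      then show ?thesis by (simp add: euclidean_product_topology)
    qed
    ultimately show "(\<lambda>j. \<Phi> m (\<lambda>i. v k m i - v j m i)) \<longlonglongrightarrow> \<Phi> m (\<lambda>i. v k m i - l m i)"
      by (rule isCont_tendsto_compose)
    have "\<Phi> m (\<lambda>i. v k m i - v j m i) \<le> e" if "j \<ge> n0" for j
    proof -
      have "\<Phi> m (\<lambda>i. v k m i - v j m i) \<le> \<Q> (\<lambda>m i. v k m i - v j m i)"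
        by (rule block_le[OF dS[OF v(1) v(1)]])
      then show ?thesis using n0 k that by (meson less_imp_le order_trans)
    qed
    then show "\<exists>n. \<forall>j\<ge>n. \<Phi> m (\<lambda>i. v k m i - v j m i) \<le> e" by blast
  qed
  have diff: "(\<lambda>m i. v k m i - l m i) \<in> \<S>"
    if "\<forall>k\<ge>n0. \<forall>l\<ge>n0. \<Q> (\<lambda>m i. v k m i - v l m i) < e" "k \<ge> n0" for n0 k e
    using lim[OF that] by (rule in_block_spaceI[rotated]) (simp add: l0 block_outside[OF v(1)])
  have lS: "l \<in> \<S>"
  proof -
    obtain n0 where "\<forall>k\<ge>n0. \<forall>l\<ge>n0. \<Q> (\<lambda>m i. v k m i - v l m i) < 1" using cauchyQ[of 1] by auto
    from dS[OF v(1)[of n0] diff[OF this order_refl]] show ?thesis by simp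
  qed
  have "(\<lambda>k. qnorm \<X> (u k \<ominus>\<^bsub>\<X>\<^esub> J l)) \<longlonglongrightarrow> 0"
    unfolding LIMSEQ_def
  proof (intro allI impI)
    fix e :: real assume "0 < e"
    then obtain n0 where n0: "\<forall>k\<ge>n0. \<forall>l\<ge>n0. \<Q> (\<lambda>m i. v k m i - v l m i) < e/2"
      using cauchyQ[of "e/2"] by auto
    have "dist (qnorm \<X> (u k \<ominus>\<^bsub>\<X>\<^esub> J l)) 0 < e" if k: "k \<ge> n0" for k
    proof -
      have "\<Q> (\<lambda>m i. v k m i - l m i) \<le> e/2" by (rule block_leI) (rule lim[OF n0 k])
      moreover have "0 \<le> \<Q> (\<lambda>m i. v k m i - l m i)" by (rule block_nonneg[OF diff[OF n0 k]])
      ultimately show ?thesis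
        using \<open>0 < e\<close> by (simp add: v(2) block_sum_minus[OF v(1) lS] block_ops)
    qed
    then show "\<exists>no. \<forall>n\<ge>no. dist (qnorm \<X> (u n \<ominus>\<^bsub>\<X>\<^esub> J l)) 0 < e" by blast
  qed
  then show "\<exists>l\<in>carrier \<X>. (\<lambda>n. qnorm \<X> (u n \<ominus>\<^bsub>\<X>\<^esub> l)) \<longlonglongrightarrow> 0"
    using lS by (auto simp: block_sum_sel)
qed

lemma quasi_banach_block_sum: "r < 1 \<Longrightarrow> quasi_banach \<X>"
  unfolding quasi_banach_def
  using module_block_sum is_quasinorm_block_sum is_r_norm_block_sum qnorm_complete_block_sum r by blast

lemma r_normable_block_sum: "r_normable r \<X>"
  unfolding r_normable_def equivalent_quasinorms_def
  using is_quasinorm_block_sum is_r_norm_block_sum by (intro exI[of _ "qnorm \<X>"]) (auto intro!: exI[of _ 1])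

definition block_unit :: "nat \<Rightarrow> nat \<Rightarrow> nat \<Rightarrow> nat \<Rightarrow> complex" where
  "block_unit m k = (\<lambda>m' i. if m' = m \<and> i = k then 1 else 0)"

lemma block_single:
  assumes "\<And>i. N m \<le> i \<Longrightarrow> a i = 0"
  shows "(\<lambda>m' i. if m' = m then a i else 0) \<in> \<S>"
    and "\<Q> (\<lambda>m' i. if m' = m then a i else 0) = \<Phi> m a"
proof -
  let ?x = "\<lambda>m' i. if m' = m then a i else (0 :: complex)"
  have 0: "\<Phi> m (\<lambda>_. 0) = 0" for m
    using s_seminormD(2)[OF \<Phi>, of m 0 "\<lambda>_. 0"] by simp
  have le: "\<Phi> m' (?x m') \<le> \<Phi> m a" for m'
    using s_seminormD(1)[OF \<Phi>, of m a] by (cases "m' = m") (simp_all add: 0)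
  show \<S>: "?x \<in> \<S>" using le assms by (intro in_block_spaceI[of _ "\<Phi> m a"]) auto
  have "\<Phi> m (?x m) \<le> \<Q> ?x" by (rule block_le[OF \<S>])
  then show "\<Q> ?x = \<Phi> m a"
    using block_leI[of ?x "\<Phi> m a"] le by (intro antisym) auto
qed

lemma block_unit_in:
  assumes "k < N m" shows "block_unit m k \<in> \<S>"
proof -
  have "block_unit m k = (\<lambda>m' i. if m' = m then (if i = k then 1 else 0) else 0)"
    by (auto simp: block_unit_def fun_eq_iff)
  then show ?thesis
    using block_single(1)[of m "\<lambda>i. if i = k then 1 else 0"] assms by simp
qed

text \<open>
  The unit vectors of block \<open>m\<close> span an isometric copy of
  \<open>\<complex>\<^bsup>N m\<^esup>\<close> with the quasinorm \<open>\<Phi> m\<close>.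
\<close>

lemma qnorm_block_combination:
  "qnorm \<X> (\<Oplus>\<^bsub>\<X>\<^esub>k\<in>{..<N m}. a k \<odot>\<^bsub>\<X>\<^esub> J (block_unit m k)) = \<Phi> m a"
proof -
  interpret \<X>: abelian_group \<X> by (rule abelian_group_block_sum)
  have carr: "a k \<odot>\<^bsub>\<X>\<^esub> J (block_unit m k) \<in> carrier \<X>" if "k < N m" for k
    using block_scale(1)[OF block_unit_in[OF that]] by (simp add: block_ops block_sum_sel)
  have "(\<Oplus>\<^bsub>\<X>\<^esub>k\<in>{..<n}. a k \<odot>\<^bsub>\<X>\<^esub> J (block_unit m k))
      = J (\<lambda>m' i. if m' = m then (if i < n then a i else 0) else 0)" if "n \<le> N m" for n
    using that
  proof (induction n)
    case 0
    then show ?case by (simp add: block_sum_sel fun_eq_iff cong: if_cong)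
  next
    case (Suc n)
    have "(\<lambda>k. a k \<odot>\<^bsub>\<X>\<^esub> J (block_unit m k)) \<in> {..<n} \<rightarrow> carrier \<X>"
      using Suc.prems carr by auto
    then have "(\<Oplus>\<^bsub>\<X>\<^esub>k\<in>{..<Suc n}. a k \<odot>\<^bsub>\<X>\<^esub> J (block_unit m k))
        = a n \<odot>\<^bsub>\<X>\<^esub> J (block_unit m n) \<oplus>\<^bsub>\<X>\<^esub> (\<Oplus>\<^bsub>\<X>\<^esub>k\<in>{..<n}. a k \<odot>\<^bsub>\<X>\<^esub> J (block_unit m k))"
      using carr[of n] Suc.prems by (simp add: lessThan_Suc)
    also have "\<dots> = J (\<lambda>m' i. a n * block_unit m n m' i + (if m' = m then (if i < n then a i else 0) else 0))"
      using Suc by (simp add: block_ops)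
    also have "(\<lambda>m' i. a n * block_unit m n m' i + (if m' = m then (if i < n then a i else 0) else 0))
        = (\<lambda>m' i. if m' = m then (if i < Suc n then a i else 0) else 0)"
      by (auto simp: fun_eq_iff block_unit_def less_Suc_eq)
    finally show ?case .
  qed
  from this[of "N m"] have "qnorm \<X> (\<Oplus>\<^bsub>\<X>\<^esub>k\<in>{..<N m}. a k \<odot>\<^bsub>\<X>\<^esub> J (block_unit m k))
      = \<Phi> m (\<lambda>i. if i < N m then a i else 0)"
    using block_single(2)[of m "\<lambda>i. if i < N m then a i else 0"] by (simp add: block_ops)
  also have "\<dots> = \<Phi> m a" by (rule s_seminormD(4)[OF \<Phi>]) simp
  finally show ?thesis .
qed

end

section \<open>Property \<open>C\<^sub>p\<close> implies interpolation\<close>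

text \<open>
  Markov's inequality with \<open>5 c\<^sup>p\<close> as threshold for the \<open>p\<close>-th
  power, which gives \<open>1/5 < 1/4\<close>.
\<close>

lemma Lp_tail_bound:
  assumes M: "prob_space M" and bm: "bounded_measurable M u" and p: "0 < p" and c: "0 < c"
    and le: "Lp M p u \<le> c"
  shows "measure M {x \<in> space M. 5 powr (1 / enn2real p) * c < u x} < 1/4"
proof -
  interpret prob_space M by fact
  have [measurable]: "u \<in> borel_measurable M" using bm by (simp add: bounded_measurable_def)
  show ?thesis
  proof (cases "p = \<infinity>")
    case True
    then have "AE x in M. u x \<le> c" using Lp_infinity_le_iff[OF M bm] le by simp
    then have "AE x in M. x \<notin> {x \<in> space M. 5 powr (1 / enn2real p) * c < u x}"
      using True by (auto elim: eventually_mono)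
    then have "measure M {x \<in> space M. 5 powr (1 / enn2real p) * c < u x} = 0"
      by (intro prob_eq_0[THEN iffD2]) auto
    then show ?thesis by simp
  next
    case False
    define q where "q = enn2real p"
    have q: "q > 0" using p False by (simp add: q_def enn2real_positive_iff less_top)
    have int: "integrable M (\<lambda>x. u x powr q)"
      using bounded_measurable_powr_integrable[OF M bm] q by simp
    have I: "(\<integral>x. u x powr q \<partial>M) \<le> c powr q"
      using Lp_finite_le_iff[OF M p False, of c u] c le by (simp add: q_def)
    have "measure M {x \<in> space M. 5 powr (1/q) * c < u x} \<le> measure M {x \<in> space M. 5 * c powr q \<le> u x powr q}"
    proof (rule finite_measure_mono)
      show "{x \<in> space M. 5 powr (1/q) * c < u x} \<subseteq> {x \<in> space M. 5 * c powr q \<le> u x powr q}"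
      proof clarify
        fix x assume "5 powr (1/q) * c < u x"
        then have "(5 powr (1/q) * c) powr q \<le> u x powr q"
          using q c by (intro powr_mono2) auto
        then show "5 * c powr q \<le> u x powr q"
          using q c by (simp add: powr_mult powr_powr)
      qed
    qed measurable
    also have "\<dots> \<le> (\<integral>x. u x powr q \<partial>M) / (5 * c powr q)"
      using c by (intro integral_Markov_inequality_measure[OF int, of "{}"]) auto
    also have "\<dots> \<le> c powr q / (5 * c powr q)"
      using I c by (intro divide_right_mono) auto
    also have "\<dots> < 1/4" using c by simp
    finally show ?thesis by (simp add: q_def)
  qed
qed

text \<open>
  The sequence \<open>t\<close> is typical with probability above \<open>3/4\<close>, and by
  translation invariance so is \<open>s t\<close>. Hence both are typical for some
  \<open>t\<close>, and \<open>s = t \<cdot> (s t)\<close> is a product of two typical signs.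
\<close>

lemma typical_sign_factorization:
  fixes \<Phi> :: "(nat \<Rightarrow> complex) \<Rightarrow> real"
  assumes \<Phi>: "s_seminorm r n \<Phi>" and r: "0 < r" and p: "0 < p" and c: "0 < c"
    and le: "Lp cantor_haar p \<Phi> \<le> c" and s: "s \<in> UNIV \<rightarrow> {1, -1}"
  shows "\<exists>t\<in>UNIV \<rightarrow> {1, -1}. \<Phi> t \<le> 5 powr (1 / enn2real p) * c \<and>
    \<Phi> (\<lambda>k. s k * t k) \<le> 5 powr (1 / enn2real p) * c"
proof -
  interpret D: prob_space cantor_haar by (rule prob_space_cantor_haar)
  note D = prob_space_cantor_haar
  define K where "K = 5 powr (1 / enn2real p) * c"
  have sk: "norm (s k) = 1" for k
    using Pi_mem[OF s, of k] by auto
  have bm1: "bounded_measurable cantor_haar (\<lambda>t. \<Phi> t)"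
    by (rule s_seminorm_bounded_measurable[OF \<Phi> r cantor_coord_measurable, where R = 1])
      (simp add: cantor_coord_unimodular)
  have bm2: "bounded_measurable cantor_haar (\<lambda>t. \<Phi> (\<lambda>k. s k * t k))"
  proof (rule s_seminorm_bounded_measurable[OF \<Phi> r, where R = 1])
    show "(\<lambda>t. s k * t k) \<in> borel_measurable cantor_haar" for k
      by (intro borel_measurable_times borel_measurable_const cantor_coord_measurable)
  qed (simp add: norm_mult sk cantor_coord_unimodular)
  have "Lp cantor_haar p (\<lambda>t. \<Phi> (\<lambda>k. s k * t k)) = Lp cantor_haar p \<Phi>"
    using bm1 by (intro Lp_compose[OF cantor_translation_measurable[OF s] cantor_haar_translation_invariant[OF s]])
      (simp add: bounded_measurable_def)
  then have le2: "Lp cantor_haar p (\<lambda>t. \<Phi> (\<lambda>k. s k * t k)) \<le> c" using le by simp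
  define A where "A = {t \<in> space cantor_haar. K < \<Phi> t}"
  define B where "B = {t \<in> space cantor_haar. K < \<Phi> (\<lambda>k. s k * t k)}"
  have sets: "A \<in> sets cantor_haar" "B \<in> sets cantor_haar"
    using bm1 bm2 unfolding A_def B_def bounded_measurable_def by (auto intro: borel_measurable_less)
  have "measure cantor_haar (A \<union> B) \<le> measure cantor_haar A + measure cantor_haar B"
    using sets by (rule measure_subadditive) (auto simp: D.emeasure_eq_measure)
  also have "\<dots> < 1/4 + 1/4"
    unfolding A_def B_def K_def
    using Lp_tail_bound[OF D bm1 p c] Lp_tail_bound[OF D bm2 p c le2] le by (intro add_strict_mono) auto
  finally have "measure cantor_haar (A \<union> B) < 1" by simp
  then have "A \<union> B \<noteq> space cantor_haar" using D.prob_space by auto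
  moreover have "A \<union> B \<subseteq> space cantor_haar" by (auto simp: A_def B_def)
  ultimately obtain t where "t \<in> space cantor_haar" "t \<notin> A" "t \<notin> B" by blast
  then show ?thesis
    by (intro bexI[of _ t]) (auto simp: A_def B_def K_def space_cantor_haar not_less)
qed

text \<open>
  The vector \<open>(\<gamma> k g)\<^sub>k\<close> is the transform of the unit mass at
  \<open>g\<close>, so its gauge is at most 1 for every \<open>g\<close>. The comparison then
  makes typical sign vectors cheap, and every sign vector is a product of two typical ones,
  which corresponds to a convolution of measures.
\<close>

lemma cheap_signs_of_comparison:
  fixes \<gamma> :: "nat \<Rightarrow> 'g::topological_ab_group_add \<Rightarrow> complex"
  assumes haar: "normalized_haar_measure (\<mu> :: 'g measure)" and p: "0 < p" and r: "0 < r"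
    and ch: "\<And>i. i < n \<Longrightarrow> character (\<gamma> i)" and inj: "inj_on \<gamma> {..<n}" and M: "0 < M"
    and le: "Lp cantor_haar p (\<lambda>y. gauge r n \<gamma> y powr (1/r))
        \<le> M * Lp \<mu> p (\<lambda>g. gauge r n \<gamma> (\<lambda>k. \<gamma> k g) powr (1/r))"
    and s: "s \<in> UNIV \<rightarrow> {1, -1}"
  shows "\<exists>L. cost r L \<le> ((5 powr (1 / enn2real p) * M) powr r + 1)\<^sup>2 \<and> (\<forall>i<n. trig_sum L (\<gamma> i) = s i)"
proof -
  let ?\<Phi> = "\<lambda>y. gauge r n \<gamma> y powr (1/r)"
  define K where "K = 5 powr (1 / enn2real p) * M"
  have \<Phi>: "s_seminorm r n ?\<Phi>" by (rule gauge_s_seminorm[OF ch inj r])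
  have "Lp \<mu> p (\<lambda>g. ?\<Phi> (\<lambda>k. \<gamma> k g)) \<le> 1"
  proof (rule Lp_le_const[OF haar_prob_space[OF haar] _ p])
    show "bounded_measurable \<mu> (\<lambda>g. ?\<Phi> (\<lambda>k. \<gamma> k g))"
      using ch by (intro s_seminorm_bounded_measurable[OF \<Phi> r, where R = 1] haar_borel_measurable[OF haar])
        (auto simp: character_def)
    show "?\<Phi> (\<lambda>k. \<gamma> k g) \<le> 1" for g
    proof -
      have "gauge r n \<gamma> (\<lambda>k. \<gamma> k g) \<le> cost r [(1, g)]" by (rule gauge_le_cost) simp
      moreover have "0 \<le> gauge r n \<gamma> (\<lambda>k. \<gamma> k g)" by (rule le_gaugeI[OF ch inj cost_nonneg])
      ultimately show ?thesis using r by (auto intro: powr_le1)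
    qed
  qed simp
  then have "M * Lp \<mu> p (\<lambda>g. ?\<Phi> (\<lambda>k. \<gamma> k g)) \<le> M * 1" using M by (intro mult_left_mono) auto
  then have "Lp cantor_haar p ?\<Phi> \<le> M" using le by simp
  from typical_sign_factorization[OF \<Phi> r p M this s]
  obtain t where t: "t \<in> UNIV \<rightarrow> {1, -1}" "?\<Phi> t \<le> K" "?\<Phi> (\<lambda>k. s k * t k) \<le> K"
    unfolding K_def by blast
  have cheap: "\<exists>L. cost r L < K powr r + 1 \<and> (\<forall>i<n. trig_sum L (\<gamma> i) = y i)" if "?\<Phi> y \<le> K" for y
  proof (rule gauge_lessD[OF ch inj])
    have "0 \<le> gauge r n \<gamma> y" by (rule le_gaugeI[OF ch inj cost_nonneg])
    moreover have "?\<Phi> y powr r \<le> K powr r" using that r by (intro powr_mono2) auto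
    ultimately show "gauge r n \<gamma> y < K powr r + 1" using r by (simp add: powr_powr)
  qed
  obtain L where L: "cost r L < K powr r + 1" "\<forall>i<n. trig_sum L (\<gamma> i) = t i"
    using cheap[OF t(2)] by blast
  obtain L' where L': "cost r L' < K powr r + 1" "\<forall>i<n. trig_sum L' (\<gamma> i) = s i * t i"
    using cheap[OF t(3)] by blast
  have "cost r (convolve L L') \<le> (K powr r + 1)\<^sup>2"
    unfolding cost_convolve power2_eq_square
    using L(1) L'(1) cost_nonneg[of r L] cost_nonneg[of r L'] by (intro mult_mono) auto
  moreover have "trig_sum (convolve L L') (\<gamma> i) = s i" if i: "i < n" for i
  proof -
    have "t i * t i = 1" using Pi_mem[OF t(1), of i] by auto
    have "trig_sum (convolve L L') (\<gamma> i) = trig_sum L (\<gamma> i) * trig_sum L' (\<gamma> i)"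
      using ch[OF i] by (intro trig_sum_convolve) (simp add: character_def)
    also have "\<dots> = t i * t i * s i" using L(2) L'(2) i by simp
    finally show ?thesis using \<open>t i * t i = 1\<close> by simp
  qed
  ultimately show ?thesis unfolding K_def by blast
qed

text \<open>
  If the signs on finite subsets of \<open>E\<close> had no uniformly cheap representation,
  there would be a finite family of characters and a sign vector of cost above \<open>m\<close>
  for each \<open>m\<close>. Property \<open>C\<^sub>p\<close> for the block sum of the
  corresponding gauges gives one constant for all these families at once, which is a
  contradiction.
\<close>

theorem property_C_imp_signs_approximable:
  fixes E :: "('g::topological_ab_group_add \<Rightarrow> complex) set"
  assumes haar: "normalized_haar_measure (\<mu> :: 'g measure)" and G: "compact (UNIV :: 'g set)"
    and E: "E \<subseteq> Collect character" and r: "0 < r" "r < 1" and p: "0 < p"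
    and universe: "\<exists>emb :: (nat \<Rightarrow> complex) \<Rightarrow> 'x. inj emb"
    and C: "\<And>X :: 'x quasi_normed. quasi_banach X \<Longrightarrow> r_normable r X \<Longrightarrow> property_C \<mu> p X E"
  shows "signs_approximable E"
proof (rule ccontr)
  assume not: "\<not> signs_approximable E"
  have "\<exists>n (\<gamma> :: nat \<Rightarrow> 'g \<Rightarrow> complex) s. inj_on \<gamma> {..<n} \<and> \<gamma> ` {..<n} \<subseteq> E \<and> s \<in> UNIV \<rightarrow> {1, -1} \<and>
      \<not> (\<exists>L. cost r L \<le> real m \<and> (\<forall>i<n. trig_sum L (\<gamma> i) = s i))" for m :: nat
  proof (rule ccontr)
    assume "\<not> ?thesis"
    then have "\<exists>L. cost r L \<le> real m \<and> (\<forall>i<n. trig_sum L (\<gamma> i) = s i)"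
      if "inj_on \<gamma> {..<n}" "\<gamma> ` {..<n} \<subseteq> E" "\<And>i. s i \<in> {1, -1}" for n s and \<gamma> :: "nat \<Rightarrow> 'g \<Rightarrow> complex"
      using that by blast
    from cheap_signs_imp_signs_approximable[OF G E r this] not show False by blast
  qed
  then obtain n :: "nat \<Rightarrow> nat" and \<gamma> :: "nat \<Rightarrow> nat \<Rightarrow> 'g \<Rightarrow> complex" and s :: "nat \<Rightarrow> nat \<Rightarrow> complex" where
    \<gamma>: "\<And>m. inj_on (\<gamma> m) {..<n m}" "\<And>m. \<gamma> m ` {..<n m} \<subseteq> E" and s: "\<And>m. s m \<in> UNIV \<rightarrow> {1, -1}"
    and bad: "\<And>m. \<not> (\<exists>L. cost r L \<le> real m \<and> (\<forall>i<n m. trig_sum L (\<gamma> m i) = s m i))"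
    by metis
  have ch: "character (\<gamma> m i)" if "i < n m" for m i using \<gamma>(2)[of m] E that by auto
  obtain emb :: "(nat \<Rightarrow> complex) \<Rightarrow> 'x" where emb: "inj emb" using universe by blast
  define J :: "(nat \<Rightarrow> nat \<Rightarrow> complex) \<Rightarrow> 'x" where "J = (\<lambda>x. emb (\<lambda>k. case_prod x (prod_decode k)))"
  have J: "inj J"
  proof (rule injI)
    fix x y assume "J x = J y"
    then have eq: "(\<lambda>k. case_prod x (prod_decode k)) = (\<lambda>k. case_prod y (prod_decode k))"
      using emb unfolding J_def by (rule injD[rotated])
    have "x m i = y m i" for m i
      using fun_cong[OF eq, of "prod_encode (m, i)"] by simp
    then show "x = y" by (intro ext)
  qed
  define \<Phi> where "\<Phi> = (\<lambda>m y. gauge r (n m) (\<gamma> m) y powr (1/r))"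
  have \<Phi>: "s_seminorm r (n m) (\<Phi> m)" for m
    unfolding \<Phi>_def by (rule gauge_s_seminorm[OF ch \<gamma>(1) r(1)])
  have coord: "norm (y i) \<le> \<Phi> m y" if "i < n m" for m i y
    unfolding \<Phi>_def by (rule norm_coord_le_gauge[OF ch \<gamma>(1) r(1) less_imp_le[OF r(2)] that])
  let ?X = "block_sum J n \<Phi>"
  have "property_C \<mu> p ?X E"
    by (rule C[OF quasi_banach_block_sum[OF J \<Phi> r(1) coord r(2)] r_normable_block_sum[OF J \<Phi> r(1) coord]])
  then obtain M where M: "M > 0" and MC: "\<forall>N (\<psi> :: nat \<Rightarrow> 'g \<Rightarrow> complex) x. inj_on \<psi> {..<N} \<longrightarrow> \<psi> ` {..<N} \<subseteq> E \<longrightarrow>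
      x ` {..<N} \<subseteq> carrier ?X \<longrightarrow>
      inverse M * Lp cantor_haar p (\<lambda>t. qnorm ?X (\<Oplus>\<^bsub>?X\<^esub>k\<in>{..<N}. t k \<odot>\<^bsub>?X\<^esub> x k))
        \<le> Lp \<mu> p (\<lambda>g. qnorm ?X (\<Oplus>\<^bsub>?X\<^esub>k\<in>{..<N}. \<psi> k g \<odot>\<^bsub>?X\<^esub> x k)) \<and>
      Lp \<mu> p (\<lambda>g. qnorm ?X (\<Oplus>\<^bsub>?X\<^esub>k\<in>{..<N}. \<psi> k g \<odot>\<^bsub>?X\<^esub> x k))
        \<le> M * Lp cantor_haar p (\<lambda>t. qnorm ?X (\<Oplus>\<^bsub>?X\<^esub>k\<in>{..<N}. t k \<odot>\<^bsub>?X\<^esub> x k))"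
    unfolding property_C_def Lp_qnorm_eq_Lp Let_def by (elim exE conjE)
  have le: "Lp cantor_haar p (\<Phi> m) \<le> M * Lp \<mu> p (\<lambda>g. \<Phi> m (\<lambda>k. \<gamma> m k g))" for m
  proof -
    have units: "(\<lambda>k. J (block_unit m k)) ` {..<n m} \<subseteq> carrier ?X"
      using block_unit_in[OF J \<Phi> r(1) coord] by (auto simp: block_sum_sel)
    have eq: "qnorm ?X (\<Oplus>\<^bsub>?X\<^esub>k\<in>{..<n m}. a k \<odot>\<^bsub>?X\<^esub> J (block_unit m k)) = \<Phi> m a" for a
      by (rule qnorm_block_combination[OF J \<Phi> r(1) coord])
    from MC[rule_format, OF \<gamma>(1) \<gamma>(2) units, THEN conjunct1]
    have "inverse M * Lp cantor_haar p (\<lambda>t. \<Phi> m t) \<le> Lp \<mu> p (\<lambda>g. \<Phi> m (\<lambda>k. \<gamma> m k g))"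
      unfolding eq .
    then show ?thesis using M by (simp add: field_simps)
  qed
  define m where "m = nat \<lceil>((5 powr (1 / enn2real p) * M) powr r + 1)\<^sup>2\<rceil>"
  obtain L where "cost r L \<le> ((5 powr (1 / enn2real p) * M) powr r + 1)\<^sup>2" "\<forall>i<n m. trig_sum L (\<gamma> m i) = s m i"
    using cheap_signs_of_comparison[OF haar p r(1) ch \<gamma>(1) M le[of m, unfolded \<Phi>_def] s[of m]] by blast
  moreover have "((5 powr (1 / enn2real p) * M) powr r + 1)\<^sup>2 \<le> real m"
    unfolding m_def by (rule real_nat_ceiling_ge)
  ultimately show False using bad[of m] by (meson order_trans)
qed

theorem theorem3:
  fixes \<mu> :: "'g::{topological_ab_group_add, t2_space} measure"
    and E :: "('g \<Rightarrow> complex) set"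
    and r :: real and p :: ennreal
  assumes compact_G: "compact (UNIV :: 'g set)"
    and haar: "normalized_haar_measure \<mu>"
    and E: "E \<subseteq> carrier dual_group"
    and r: "0 < r" "r < 1"
    and p: "0 < p"
    and universe: "\<exists>emb :: (nat \<Rightarrow> complex) \<Rightarrow> 'x. inj emb"
  shows "(\<forall>X :: 'x quasi_normed. quasi_banach X \<and> r_normable r X \<longrightarrow> property_C \<mu> p X E)
         \<longleftrightarrow> interpolation_set dual_group E"
proof -
  have E': "E \<subseteq> Collect character" using E by (simp add: carrier_dual_group)
  show ?thesis
  proof
    assume C: "\<forall>X :: 'x quasi_normed. quasi_banach X \<and> r_normable r X \<longrightarrow> property_C \<mu> p X E"
    have "signs_approximable E"
      by (rule property_C_imp_signs_approximable[OF haar compact_G E' r p universe]) (use C in blast)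
    then show "interpolation_set dual_group E"
      unfolding interpolation_iff_uniformly_approximable[OF haar compact_G E']
      by (rule signs_approximable_imp_uniformly)
  next
    assume "interpolation_set dual_group E"
    then have "uniformly_approximable E"
      by (simp only: interpolation_iff_uniformly_approximable[OF haar compact_G E'])
    then show "\<forall>X :: 'x quasi_normed. quasi_banach X \<and> r_normable r X \<longrightarrow> property_C \<mu> p X E"
      using uniformly_approximable_imp_property_C[OF haar E' _ p] by blast
  qed
qed

end
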